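(* Let $\Omega\subset\mathbb{R}^d$ be a bounded $C^1$-domain. Let $(\alpha_\varepsilon)_{\varepsilon\in(0,1)}$ be a family of radial functions $\alpha_\varepsilon:\mathbb{R}^d\setminus\{0\}\to[0,\infty)$ and $(\mu_\varepsilon(h)\,\mathrm{d}h)_{\varepsilon\in(0,1)}$ a family of symmetric measures with radial densities $\mu_\varepsilon\ge0$ such that $$\int_{\mathbb{R}^d}\min\{1,|h|^2\}\,\alpha_\varepsilon(h)\mu_\varepsilon(h)\,\mathrm{d}h=d\quad\text{for all }\varepsilon\in(0,1),$$ $$\lim_{\varepsilon\to0^+}\int_{|h|>\delta}\alpha_\varepsilon(h)\mu_\varepsilon(h)\,\mathrm{d}h=0\quad\text{for all }\delta>0.$$ Let $F\in C^1(\overline\Omega;\mathbb{R}^d)$ and let $(f_\varepsilon)_{\varepsilon\in(0,1)}$ be the corresponding family of nonlocal vector fields generated by $F$ with respect to $(\alpha_\varepsilon)_\varepsilon$. Then $$\int_{\Omega^c}\mathcal{N}_\varepsilon f_\varepsilon(x)\,\mathrm{d}x\;\longrightarrow\;\int_{\partial\Omega}F(x)\cdot\vec{n}(x)\,\mathrm{d}\sigma_{d-1}(x)\qquad\text{as }\varepsilon\to0 .$$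
   Context: A domain is an open bounded connected subset of $\mathbb{R}^d$. $\vec{n}(x)$ is the outward unit normal vector at $x\in\partial\Omega$, $\sigma_{d-1}$ is the $(d-1)$-dimensional surface measure, and $\Omega^c=\mathbb{R}^d\setminus\Omega$. All functions are measurable. The vector field $F$ is assumed to be extended to a compactly supported $C^1$ vector field on $\mathbb{R}^d$, again denoted $F$. The nonlocal vector field generated by $F$ with respect to $\alpha_\varepsilon$ is the antisymmetric function $$f_\varepsilon(x,y)=\alpha_\varepsilon(x-y)\int_0^1F\big(x+t(y-x)\big)\cdot(y-x)\,\mathrm{d}t\quad(x\neq y),\qquad f_\varepsilon(x,x)=0 .$$ The nonlocal normal operator is $$\mathcal{N}_\varepsilon f(x)=-2\int_\Omega f(x,y)\,\mu_\varepsilon(y-x)\,\mathrm{d}y,\qquad x\in\Omega^c .$$ *)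

theory Defs
  imports "HOL-Analysis.Analysis"
begin

text \<open>
  The ambient space \<open>\<real>\<^sup>d\<close> is a type \<open>'a :: euclidean_space\<close> with \<open>d = DIM('a)\<close>.
\<close>

definition orthonormal_basis :: "'a::euclidean_space set \<Rightarrow> bool" where
  "orthonormal_basis B \<longleftrightarrow> pairwise orthogonal B \<and> (\<forall>b\<in>B. norm b = 1) \<and> span B = UNIV"

text \<open>
  \<open>\<Omega>\<close> is, inside \<open>ball x0 r\<close> and in the orthonormal coordinates given by \<open>B\<close>, the region above the
  graph of a \<open>C\<^sup>1\<close> function of the \<open>d - 1\<close> coordinates other than \<open>e\<close>. A function of these
  \<open>d - 1\<close> coordinates is encoded as a function \<open>\<gamma>\<close> on the whole space that is constant along \<open>e\<close>;
  \<open>g\<close> is its gradient, which is then orthogonal to \<open>e\<close>.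
\<close>

definition C1_graph_chart ::
    "'a::euclidean_space set \<Rightarrow> 'a \<Rightarrow> real \<Rightarrow> 'a set \<Rightarrow> 'a \<Rightarrow> ('a \<Rightarrow> real) \<Rightarrow> ('a \<Rightarrow> 'a) \<Rightarrow> bool" where
  "C1_graph_chart \<Omega> x0 r B e \<gamma> g \<longleftrightarrow>
     0 < r \<and> orthonormal_basis B \<and> e \<in> B \<and>
     (\<forall>x t. \<gamma> (x + t *\<^sub>R e) = \<gamma> x) \<and>
     (\<forall>x. GDERIV \<gamma> x :> g x) \<and> continuous_on UNIV g \<and>
     \<Omega> \<inter> ball x0 r = {x \<in> ball x0 r. \<gamma> x < x \<bullet> e}"

definition bounded_C1_domain :: "'a::euclidean_space set \<Rightarrow> bool" where
  "bounded_C1_domain \<Omega> \<longleftrightarrow>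
     open \<Omega> \<and> bounded \<Omega> \<and> connected \<Omega> \<and>
     (\<forall>x0\<in>frontier \<Omega>. \<exists>r B e \<gamma> g. C1_graph_chart \<Omega> x0 r B e \<gamma> g)"

text \<open>
  The \<open>(d - 1)\<close>-dimensional Lebesgue measure on the hyperplane orthogonal to \<open>e\<close>, built from the
  coordinates in \<open>B - {e}\<close> just as \<^const>\<open>lborel\<close> is built from the coordinates in \<^const>\<open>Basis\<close>.
  For \<open>d = 1\<close> it is the unit mass at \<open>0\<close>, so that the surface measure below is counting measure.
\<close>

definition hyperplane_lborel :: "'a::euclidean_space set \<Rightarrow> 'a \<Rightarrow> 'a measure" where
  "hyperplane_lborel B e =
     distr (\<Pi>\<^sub>M b\<in>B - {e}. (lborel :: real measure)) borel (\<lambda>c. \<Sum>b\<in>B - {e}. c b *\<^sub>R b)"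

text \<open>
  The surface measure of \<open>\<partial>\<Omega>\<close> is the Borel measure concentrated on \<open>\<partial>\<Omega>\<close> that has the area element
  \<open>sqrt (1 + |\<nabla>\<gamma>|\<^sup>2) dy\<close> in every local graph representation \<open>y \<mapsto> y + \<gamma> y e\<close>, \<open>y \<bottom> e\<close>.
\<close>

definition is_surface_measure :: "'a::euclidean_space set \<Rightarrow> 'a measure \<Rightarrow> bool" where
  "is_surface_measure \<Omega> \<sigma> \<longleftrightarrow>
     sets \<sigma> = sets borel \<and> emeasure \<sigma> (- frontier \<Omega>) = 0 \<and>
     (\<forall>x0 r B e \<gamma> g. C1_graph_chart \<Omega> x0 r B e \<gamma> g \<longrightarrow>
        (\<forall>A\<in>sets borel. A \<subseteq> frontier \<Omega> \<inter> ball x0 r \<longrightarrow>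
           emeasure \<sigma> A =
             (\<integral>\<^sup>+ y. ennreal (sqrt (1 + (norm (g y))\<^sup>2)) * indicator A (y + \<gamma> y *\<^sub>R e)
                \<partial>hyperplane_lborel B e)))"

definition surface_measure :: "'a::euclidean_space set \<Rightarrow> 'a measure" where
  "surface_measure \<Omega> = (THE \<sigma>. is_surface_measure \<Omega> \<sigma>)"

text \<open>Tangent vectors are the velocities of curves running in the given set.\<close>

definition tangent_vectors :: "'a::euclidean_space set \<Rightarrow> 'a \<Rightarrow> 'a set" where
  "tangent_vectors S x =
     {v. \<exists>c :: real \<Rightarrow> 'a. c 0 = x \<and> (\<forall>\<^sub>F t in nhds 0. c t \<in> S) \<and> (c has_vector_derivative v) (at 0)}"

definition is_outward_unit_normal :: "'a::euclidean_space set \<Rightarrow> 'a \<Rightarrow> 'a \<Rightarrow> bool" where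
  "is_outward_unit_normal \<Omega> x n \<longleftrightarrow>
     norm n = 1 \<and> (\<forall>v\<in>tangent_vectors (frontier \<Omega>) x. n \<bullet> v = 0) \<and>
     (\<forall>\<^sub>F t in at_right 0. x + t *\<^sub>R n \<notin> closure \<Omega> \<and> x - t *\<^sub>R n \<in> \<Omega>)"

definition outward_normal :: "'a::euclidean_space set \<Rightarrow> 'a \<Rightarrow> 'a" where
  "outward_normal \<Omega> x = (THE n. is_outward_unit_normal \<Omega> x n)"

text \<open>
  For open \<open>S\<close>, this is \<open>F \<in> C\<^sup>1(closure S)\<close>: \<open>F\<close> and its derivative on \<open>S\<close> extend continuously to
  the closure. For \<open>S = UNIV\<close> it is the usual class \<open>C\<^sup>1\<close> on the whole space.
\<close>

definition C1_closure :: "'a::euclidean_space set \<Rightarrow> ('a \<Rightarrow> 'a) \<Rightarrow> bool" where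
  "C1_closure S F \<longleftrightarrow>
     continuous_on (closure S) F \<and>
     (\<exists>DF :: 'a \<Rightarrow> 'a \<Rightarrow>\<^sub>L 'a. continuous_on (closure S) DF \<and>
        (\<forall>x\<in>S. (F has_derivative blinfun_apply (DF x)) (at x)))"

text \<open>Since \<open>0\<close> is the only vector of norm \<open>0\<close>, the value at \<open>0\<close> is unconstrained.\<close>

definition radial :: "('a::euclidean_space \<Rightarrow> real) \<Rightarrow> bool" where
  "radial f \<longleftrightarrow> (\<forall>x y. norm x = norm y \<longrightarrow> f x = f y)"

definition nonlocal_field :: "('a::euclidean_space \<Rightarrow> real) \<Rightarrow> ('a \<Rightarrow> 'a) \<Rightarrow> 'a \<Rightarrow> 'a \<Rightarrow> real" where
  "nonlocal_field \<alpha> F x y =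
     (if x = y then 0
      else \<alpha> (x - y) * integral {0..1} (\<lambda>t. F (x + t *\<^sub>R (y - x)) \<bullet> (y - x)))"

definition nonlocal_normal ::
    "'a::euclidean_space set \<Rightarrow> ('a \<Rightarrow> real) \<Rightarrow> ('a \<Rightarrow> 'a \<Rightarrow> real) \<Rightarrow> 'a \<Rightarrow> real" where
  "nonlocal_normal \<Omega> \<mu> f x = - 2 * (LINT y:\<Omega>|lebesgue. f x y * \<mu> (y - x))"

end

theory Submission
  imports Defs
begin

text \<open>
  Write \<open>\<nu> = \<alpha>\<^sub>\<epsilon> \<mu>\<^sub>\<epsilon>\<close> and \<open>\<Phi>(x, h) = \<integral>\<^sub>0\<^sup>1 E (x + t h) \<bullet> h dt\<close>. By Fubini the left-hand side is \<open>-2 \<integral> \<nu>(h) G(h) dh\<close>,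
  where \<open>G(h)\<close> integrates \<open>\<Phi>(x, h)\<close> over \<open>{x \<notin> \<Omega>, x + h \<in> \<Omega>}\<close>; this set has volume at most \<open>C min(1, |h|)\<close>, so
  everything is integrable. As \<open>\<nu>\<close> is even, only \<open>G(h) + G(-h) = - \<integral>\<^sub>\<Omega> (\<Phi>(x, h) + \<Phi>(x, -h)) dx\<close> matters; the
  boundary has disappeared and the right-hand side is \<open>- \<integral>\<^sub>\<Omega> DE(x) h \<bullet> h dx + o(|h|\<^sup>2)\<close>. Since the second moments
  of \<open>\<nu>\<close> are isotropic, the limit is \<open>\<integral>\<^sub>\<Omega> div E\<close>.

  The divergence theorem is proved in each graph chart by differentiating \<open>s \<mapsto> \<integral>\<^sub>\<Omega> \<phi> (x + s v) dx\<close> in two ways.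
  Because its volume side does not depend on the chart, it also shows that the area elements of two charts
  agree on their overlap, which yields the surface measure without the area formula.
\<close>

section \<open>Rotation invariance of Lebesgue measure\<close>

text \<open>Only \<open>min 1 |h|^2\<close> is integrable against the kernel, which may have
  infinite mass near \<open>0\<close>. The strip supplies one factor \<open>min 1 |h|\<close>; the
  second comes from the segment integral, bounded for large \<open>h\<close> because
  \<open>E\<close> has compact support: the part of the segment inside the support has bounded
  length. The terms of first order in \<open>h\<close> cancel between \<open>h\<close> and
  \<open>-h\<close>, and the factor \<open>2\<close> of the normal operator pays for averaging the
  two. The total mass \<open>DIM('a)\<close> cancels the factor \<open>1 / DIM('a)\<close> in the
  isotropic second moments. Since the mass away from \<open>0\<close> tends to zero, it is enough to
  have an estimate for a single kernel whose constants do not depend on that kernel and whose error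
  is the tail mass. The kernels are merely Lebesgue measurable, while Fubini and the changes of
  variables run over \<open>lborel\<close>. A Borel representative replaces them, and radiality
  survives as almost everywhere invariance under orthogonal maps. Charts use arbitrary orthonormal
  bases, so slicing by their hyperplanes rests on rotation invariance of
  \<open>lborel\<close>.\<close>

lemma translation_invariant_eq_lborel:
  fixes M :: "'a::euclidean_space measure"
  assumes sets_M: "sets M = sets borel" and "sigma_finite_measure M"
    and invariant: "\<And>a. distr M borel ((+) a) = M"
    and unit: "emeasure M (ball 0 1) = emeasure lborel (ball (0::'a) 1)"
  shows "M = lborel"
proof (rule measure_eqI)
  interpret M: sigma_finite_measure M by fact
  interpret P: pair_sigma_finite lborel M ..
  note [measurable_cong] = sets_M
  have space_M: "space M = UNIV" using sets_eq_imp_space_eq[OF sets_M] by simp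
  have M_shift: "(\<integral>\<^sup>+x. f (a + x) \<partial>M) = (\<integral>\<^sup>+x. f x \<partial>M)"
    if [measurable]: "f \<in> borel_measurable borel" for f and a :: 'a
    by (subst (2) invariant[of a, symmetric]) (simp add: nn_integral_distr)
  have L_shift: "(\<integral>\<^sup>+x. f (a + x) \<partial>lborel) = (\<integral>\<^sup>+x. f x \<partial>lborel)"
    if [measurable]: "f \<in> borel_measurable borel" for f and a :: 'a
    by (subst (2) lborel_distr_plus[of a, symmetric]) (simp add: nn_integral_distr)
  fix A assume "A \<in> sets M"
  then have A [measurable]: "A \<in> sets borel" by (simp add: sets_M)
  let ?D = "ball (0::'a) 1"
  have [measurable, simp]: "ball x r \<in> sets borel" for x :: 'a and r by simp
  have ball_eq: "emeasure M (ball y 1) = emeasure M ?D" for y :: 'a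
  proof -
    have "(\<integral>\<^sup>+x. indicator (ball y 1) x \<partial>M) = (\<integral>\<^sup>+x. indicator (ball y 1) (y + x) \<partial>M)"
      by (rule M_shift[symmetric]) (intro borel_measurable_indicator borel_open open_ball)
    also have "\<dots> = (\<integral>\<^sup>+x. indicator ?D x \<partial>M)"
      by (intro nn_integral_cong) (simp add: indicator_def dist_norm)
    finally show ?thesis by (simp add: sets_M)
  qed
  \<comment> \<open>Uniqueness of Haar measure by a double integral: Fubini and the invariance of
    both measures turn \<open>lborel D * M A\<close> into \<open>M D * lborel A\<close>, and
    \<open>unit\<close> identifies the two constants.\<close>
  have "emeasure lborel ?D * emeasure M A = (\<integral>\<^sup>+y. indicator ?D y * (\<integral>\<^sup>+x. indicator A x \<partial>M) \<partial>lborel)"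
    by (simp add: nn_integral_multc sets_M nn_integral_indicator)
  also have "\<dots> = (\<integral>\<^sup>+y. (\<integral>\<^sup>+x. indicator ?D y * indicator A (y + x) \<partial>M) \<partial>lborel)"
  proof (intro nn_integral_cong)
    fix y :: 'a
    have "(\<integral>\<^sup>+x. indicator A (y + x) \<partial>M) = (\<integral>\<^sup>+x. indicator A x \<partial>M)"
      by (rule M_shift) (rule borel_measurable_indicator[OF A])
    then show "indicator ?D y * (\<integral>\<^sup>+x. indicator A x \<partial>M)
        = (\<integral>\<^sup>+x. indicator ?D y * indicator A (y + x) \<partial>M)"
      by (subst nn_integral_cmult) simp_all
  qed
  also have "\<dots> = (\<integral>\<^sup>+x. (\<integral>\<^sup>+y. indicator ?D y * indicator A (y + x) \<partial>lborel) \<partial>M)"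
    by (rule P.Fubini'[symmetric]) simp
  also have "\<dots> = (\<integral>\<^sup>+x. (\<integral>\<^sup>+y. indicator ?D (y - x) * indicator A y \<partial>lborel) \<partial>M)"
  proof (rule nn_integral_cong)
    fix x :: 'a
    show "(\<integral>\<^sup>+y. indicator ?D y * indicator A (y + x) \<partial>lborel)
        = (\<integral>\<^sup>+y. indicator ?D (y - x) * indicator A y \<partial>lborel)"
      using L_shift[of "\<lambda>y. indicator ?D (y - x) * indicator A y" x] by (simp add: add.commute)
  qed
  also have "\<dots> = (\<integral>\<^sup>+y. (\<integral>\<^sup>+x. indicator ?D (y - x) * indicator A y \<partial>M) \<partial>lborel)"
    by (rule P.Fubini') simp
  also have "\<dots> = (\<integral>\<^sup>+y. emeasure M ?D * indicator A y \<partial>lborel)"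
  proof (intro nn_integral_cong)
    fix y :: 'a
    have "(\<integral>\<^sup>+x. indicator ?D (y - x) * indicator A y \<partial>M)
        = (\<integral>\<^sup>+x. indicator (ball y 1) x * indicator A y \<partial>M)"
      by (intro nn_integral_cong) (simp add: indicator_def dist_norm norm_minus_commute)
    also have "\<dots> = emeasure M ?D * indicator A y"
      by (subst nn_integral_multc) (simp_all add: ball_eq[of y] sets_M)
    finally show "(\<integral>\<^sup>+x. indicator ?D (y - x) * indicator A y \<partial>M) = emeasure M ?D * indicator A y" .
  qed
  also have "\<dots> = emeasure lborel ?D * emeasure lborel A"
    by (simp add: nn_integral_cmult unit)
  finally have eq: "emeasure lborel ?D * emeasure M A = emeasure lborel ?D * emeasure lborel A" .
  have "emeasure lborel ?D \<noteq> 0"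
    using open_ball[of "0::'a" 1] emeasure_lborel_ball_finite[of "0::'a" 1]
    by (simp add: emeasure_ball less_imp_neq[OF unit_ball_vol_pos, symmetric])
  moreover have "emeasure lborel ?D \<noteq> top"
    using emeasure_lborel_ball_finite[of "0::'a" 1] by (simp add: less_top)
  ultimately show "emeasure M A = emeasure lborel A"
    using eq ennreal_mult_cancel_left by blast
qed (simp add: sets_M)

lemma orthogonal_transformation_measurable:
  fixes T :: "'a::euclidean_space \<Rightarrow> 'a"
  assumes "orthogonal_transformation T"
  shows "T \<in> borel_measurable borel"
  using assms
  by (intro borel_measurable_continuous_onI linear_continuous_on linear_linear[THEN iffD2])
     (simp add: orthogonal_transformation_def linear_linear)

lemma orthogonal_transformation_inv_apply:
  fixes T :: "'a::euclidean_space \<Rightarrow> 'a"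
  assumes "orthogonal_transformation T"
  shows "T (inv T x) = x" "inv T (T x) = x"
  using orthogonal_transformation_surj[OF assms] orthogonal_transformation_inj[OF assms]
  by (auto simp: surj_f_inv_f)

text \<open>The image measure is again translation invariant, and \<open>T\<close> preserves the
  unit ball, so the normalising constant is \<open>1\<close>.\<close>

lemma lborel_distr_orthogonal_transformation:
  fixes T :: "'a::euclidean_space \<Rightarrow> 'a"
  assumes T: "orthogonal_transformation T"
  shows "distr lborel borel T = lborel"
proof (rule translation_invariant_eq_lborel)
  note [measurable] = orthogonal_transformation_measurable[OF T]
    orthogonal_transformation_measurable[OF orthogonal_transformation_inv[OF T]]
  have lin: "linear T" using T by (rule orthogonal_transformation_linear)
  \<comment> \<open>Sigma-finiteness is pulled back from a further image: pushing forward by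
    \<open>inv T\<close> returns \<open>lborel\<close>.\<close>
  have "distr (distr lborel borel T) borel (inv T) = distr lborel borel (\<lambda>x. x)"
    by (subst distr_distr) (auto simp: o_def orthogonal_transformation_inv_apply[OF T])
  also have "\<dots> = lborel"
    by (rule distr_id2) simp
  finally have "sigma_finite_measure (distr (distr lborel borel T) borel (inv T))"
    by (simp add: sigma_finite_lborel)
  then show "sigma_finite_measure (distr lborel borel T)"
    by (rule sigma_finite_measure_distr) simp
  show "distr (distr lborel borel T) borel ((+) a) = distr lborel borel T" for a
  proof -
    have "distr (distr lborel borel T) borel ((+) a) = distr lborel borel (\<lambda>x. a + T x)"
      by (subst distr_distr) (auto simp: o_def)
    also have "\<dots> = distr lborel borel (\<lambda>x. T (inv T a + x))"
      by (simp add: linear_add[OF lin] orthogonal_transformation_inv_apply[OF T])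
    also have "\<dots> = distr (distr lborel borel ((+) (inv T a))) borel T"
      by (subst distr_distr) (auto simp: o_def)
    also have "\<dots> = distr lborel borel T"
      by (simp add: lborel_distr_plus)
    finally show ?thesis .
  qed
  have "T -` ball 0 1 = ball 0 1"
    using orthogonal_transformation_norm[OF T] by (auto simp: dist_norm)
  then show "emeasure (distr lborel borel T) (ball 0 1) = emeasure lborel (ball (0::'a) 1)"
    by (simp add: emeasure_distr)
qed simp

section \<open>Lebesgue measure in the coordinates of an orthonormal basis\<close>

lemma orthonormal_basis_props:
  fixes B :: "'a::euclidean_space set"
  assumes "orthonormal_basis B"
  shows orthonormal_basis_finite: "finite B" and orthonormal_basis_card: "card B = DIM('a)"
    and orthonormal_basis_inner: "\<And>b c. b \<in> B \<Longrightarrow> c \<in> B \<Longrightarrow> b \<bullet> c = (if b = c then 1 else 0)"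
proof -
  have "0 \<notin> B" using assms by (force simp: orthonormal_basis_def)
  then have ind: "independent B"
    using assms by (intro pairwise_orthogonal_independent) (auto simp: orthonormal_basis_def)
  show "finite B" using ind independent_bound by blast
  have "dim (UNIV :: 'a set) = card B"
    using ind assms by (metis dim_span_eq_card_independent orthonormal_basis_def)
  then show "card B = DIM('a)" by simp
  show "b \<bullet> c = (if b = c then 1 else 0)" if "b \<in> B" "c \<in> B" for b c
    using assms that by (auto simp: orthonormal_basis_def pairwise_def orthogonal_def norm_eq_1)
qed

text \<open>\<open>lborel\<close> is constructed from the coordinates in \<open>Basis\<close>. An
  orthogonal map carrying \<open>Basis\<close> bijectively onto \<open>B\<close> transports this
  construction to \<open>B\<close> and leaves \<open>lborel\<close> unchanged.\<close>

lemma lborel_eq_distr_orthonormal_basis: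
  fixes B :: "'a::euclidean_space set"
  assumes B: "orthonormal_basis B"
  shows "lborel = distr (\<Pi>\<^sub>M b\<in>B. lborel) borel (\<lambda>c. \<Sum>b\<in>B. c b *\<^sub>R b)"
proof -
  note fin = orthonormal_basis_finite[OF B] and ip = orthonormal_basis_inner[OF B]
  obtain \<pi> where \<pi>: "bij_betw \<pi> (Basis :: 'a set) B"
    using finite_same_card_bij[OF finite_Basis fin] orthonormal_basis_card[OF B] by auto
  then have \<pi>B: "\<pi> i \<in> B" if "i \<in> Basis" for i using that by (auto simp: bij_betw_def)
  have \<pi>inj: "\<pi> i = \<pi> j \<longleftrightarrow> i = j" if "i \<in> Basis" "j \<in> Basis" for i j
    using \<pi> that by (auto simp: bij_betw_def inj_on_def)
  define T where "T x = (\<Sum>i\<in>Basis. (x \<bullet> i) *\<^sub>R \<pi> i)" for x :: 'a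
  have "T v \<bullet> T w = v \<bullet> w" for v w
  proof -
    have *: "T v \<bullet> \<pi> j = v \<bullet> j" if "j \<in> Basis" for j
    proof -
      have "T v \<bullet> \<pi> j = (\<Sum>i\<in>Basis. if i = j then v \<bullet> i else 0)"
        unfolding T_def inner_sum_left inner_scaleR_left
        using that by (intro sum.cong refl) (simp add: ip[OF \<pi>B \<pi>B] \<pi>inj)
      then show ?thesis using that by simp
    qed
    have "T v \<bullet> T w = (\<Sum>j\<in>Basis. (w \<bullet> j) * (T v \<bullet> \<pi> j))"
      by (subst (2) T_def) (simp add: inner_sum_right)
    also have "\<dots> = (\<Sum>j\<in>Basis. (v \<bullet> j) * (w \<bullet> j))"
      by (simp add: * mult.commute)
    also have "\<dots> = v \<bullet> w" by (rule euclidean_inner[symmetric])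
    finally show ?thesis .
  qed
  moreover have "linear T"
    unfolding T_def
    by (intro linearI)
      (simp_all add: inner_add_left scaleR_add_left sum.distrib scaleR_sum_right)
  ultimately have T: "orthogonal_transformation T" by (simp add: orthogonal_transformation_def)
  note [measurable] = orthogonal_transformation_measurable[OF T]
  interpret product_sigma_finite "\<lambda>_. lborel :: real measure" ..
  \<comment> \<open>\<open>r\<close> renames coordinates along the bijection \<open>\<pi>\<close>,
    which carries the product measure over \<open>B\<close> to the one over
    \<open>Basis\<close>.\<close>
  define r where "r c = (\<lambda>i\<in>Basis. c (\<pi> i))" for c :: "'a \<Rightarrow> real"
  have r [measurable]: "r \<in> measurable (\<Pi>\<^sub>M b\<in>B. lborel) (\<Pi>\<^sub>M b\<in>(Basis::'a set). lborel)"
    unfolding r_def using \<pi>B by (intro measurable_restrict measurable_component_singleton) auto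
  have r_eq: "distr (\<Pi>\<^sub>M b\<in>B. lborel) (\<Pi>\<^sub>M b\<in>(Basis::'a set). lborel) r = (\<Pi>\<^sub>M b\<in>Basis. lborel)"
  proof (rule PiM_eqI)
    fix A :: "'a \<Rightarrow> real set" assume A: "\<And>i. i \<in> Basis \<Longrightarrow> A i \<in> sets lborel"
    let ?q = "the_inv_into Basis \<pi>"
    have q: "?q (\<pi> i) = i" if "i \<in> Basis" for i
      using \<pi> that by (auto simp: bij_betw_def the_inv_into_f_f)
    have vim: "r -` (Pi\<^sub>E Basis A) \<inter> space (\<Pi>\<^sub>M b\<in>B. lborel) = Pi\<^sub>E B (\<lambda>b. A (?q b))"
    proof (intro set_eqI iffI)
      fix c assume "c \<in> r -` (Pi\<^sub>E Basis A) \<inter> space (\<Pi>\<^sub>M b\<in>B. lborel)"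
      then have c: "r c \<in> Pi\<^sub>E Basis A" "c \<in> extensional B" by (auto simp: space_PiM PiE_def)
      have "c b \<in> A (?q b)" if b: "b \<in> B" for b
      proof -
        obtain i where "i \<in> Basis" "b = \<pi> i" using \<pi> b by (auto simp: bij_betw_def)
        then show ?thesis using PiE_mem[OF c(1), of i] by (simp add: q r_def)
      qed
      then show "c \<in> Pi\<^sub>E B (\<lambda>b. A (?q b))" using c(2) by (simp add: PiE_def)
    next
      fix c assume c: "c \<in> Pi\<^sub>E B (\<lambda>b. A (?q b))"
      have "c (\<pi> i) \<in> A i" if "i \<in> Basis" for i
        using PiE_mem[OF c \<pi>B[OF that]] by (simp add: q that)
      then show "c \<in> r -` (Pi\<^sub>E Basis A) \<inter> space (\<Pi>\<^sub>M b\<in>B. lborel)"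
        using c by (simp add: r_def space_PiM PiE_def)
    qed
    have qB: "?q b \<in> Basis" if "b \<in> B" for b
      using \<pi> that by (metis bij_betw_def imageE q)
    have "emeasure (distr (\<Pi>\<^sub>M b\<in>B. lborel) (\<Pi>\<^sub>M b\<in>(Basis::'a set). lborel) r) (Pi\<^sub>E Basis A)
        = (\<Prod>b\<in>B. emeasure lborel (A (?q b)))"
      using A fin qB by (subst emeasure_distr) (auto simp: vim emeasure_PiM intro!: sets_PiM_I_finite)
    also have "\<dots> = (\<Prod>i\<in>Basis. emeasure lborel (A i))"
      using prod.reindex_bij_betw[OF \<pi>, of "\<lambda>b. emeasure lborel (A (?q b))"] q by simp
    finally show "emeasure (distr (\<Pi>\<^sub>M b\<in>B. lborel) (\<Pi>\<^sub>M b\<in>(Basis::'a set). lborel) r) (Pi\<^sub>E Basis A)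
        = (\<Prod>i\<in>Basis. emeasure lborel (A i))" .
  qed auto
  have "lborel = distr lborel borel T"
    by (rule lborel_distr_orthogonal_transformation[OF T, symmetric])
  also have "\<dots> = distr (distr (distr (\<Pi>\<^sub>M b\<in>B. lborel) (\<Pi>\<^sub>M b\<in>Basis. lborel) r) borel
      (\<lambda>f. \<Sum>b\<in>Basis. f b *\<^sub>R b)) borel T"
    by (subst lborel_eq) (simp only: r_eq)
  also have "\<dots> = distr (\<Pi>\<^sub>M b\<in>B. lborel) borel (\<lambda>c. T (\<Sum>i\<in>Basis. r c i *\<^sub>R i))"
  proof -
    have "(\<lambda>f. \<Sum>b\<in>Basis. f b *\<^sub>R b) \<in> borel_measurable (\<Pi>\<^sub>M b\<in>(Basis::'a set). lborel)"
      by measurable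
    then have "(\<lambda>c. \<Sum>b\<in>Basis. r c b *\<^sub>R b) \<in> borel_measurable (\<Pi>\<^sub>M b\<in>B. lborel)"
      using measurable_compose[OF r] by blast
    then show ?thesis
      by (simp add: distr_distr o_def)
  qed
  also have "(\<lambda>c. T (\<Sum>i\<in>Basis. r c i *\<^sub>R i)) = (\<lambda>c. \<Sum>b\<in>B. c b *\<^sub>R b)"
  proof
    fix c
    have "T (\<Sum>i\<in>Basis. r c i *\<^sub>R i) = (\<Sum>i\<in>Basis. c (\<pi> i) *\<^sub>R \<pi> i)"
      unfolding T_def by (intro sum.cong refl) (simp add: r_def)
    also have "\<dots> = (\<Sum>b\<in>B. c b *\<^sub>R b)"
      using sum.reindex_bij_betw[OF \<pi>, of "\<lambda>b. c b *\<^sub>R b"] by simp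
    finally show "T (\<Sum>i\<in>Basis. r c i *\<^sub>R i) = (\<Sum>b\<in>B. c b *\<^sub>R b)" .
  qed
  finally show ?thesis .
qed

section \<open>Fubini over a hyperplane\<close>

lemma sets_hyperplane_lborel [simp, measurable_cong]: "sets (hyperplane_lborel B e) = sets borel"
  by (simp add: hyperplane_lborel_def)

lemma space_hyperplane_lborel [simp]: "space (hyperplane_lborel B e) = UNIV"
  by (simp add: hyperplane_lborel_def)

lemma hyperplane_coordinates_measurable [measurable]:
  fixes B :: "'a::euclidean_space set"
  shows
  "(\<lambda>c. \<Sum>b\<in>B - {e}. c b *\<^sub>R b) \<in> borel_measurable (\<Pi>\<^sub>M b\<in>B - {e}. (lborel :: real measure))"
  by measurable

context
  fixes B :: "'a::euclidean_space set" and e :: 'a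
  assumes B: "orthonormal_basis B" and e: "e \<in> B"
begin

lemma orthonormal_basis_norm: "e \<bullet> e = 1" "norm e = 1"
  using orthonormal_basis_inner[OF B e e] by (simp_all add: norm_eq_1)

lemma hyperplane_coordinate:
  assumes "b \<in> B - {e}"
  shows "(\<Sum>b'\<in>B - {e}. c b' *\<^sub>R b') \<bullet> b = c b"
proof -
  have "(\<Sum>b'\<in>B - {e}. c b' *\<^sub>R b') \<bullet> b = (\<Sum>b'\<in>B - {e}. if b' = b then c b' else 0)"
    unfolding inner_sum_left using assms
    by (intro sum.cong refl) (simp add: orthonormal_basis_inner[OF B])
  then show ?thesis using assms orthonormal_basis_finite[OF B] by simp
qed

lemma hyperplane_coordinate_normal: "(\<Sum>b\<in>B - {e}. c b *\<^sub>R b) \<bullet> e = 0"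
  unfolding inner_sum_left using e
  by (intro sum.neutral ballI) (simp add: orthonormal_basis_inner[OF B])

lemma AE_hyperplane_lborel: "AE y in hyperplane_lborel B e. y \<bullet> e = 0"
  unfolding hyperplane_lborel_def
  by (subst AE_distr_iff) (simp_all add: hyperplane_coordinate_normal)

text \<open>Reading off coordinates inverts the parametrisation, so it maps the hyperplane measure
  back to a finite product of copies of \<open>lborel\<close>, from which sigma-finiteness is
  inherited.\<close>

lemma sigma_finite_hyperplane_lborel: "sigma_finite_measure (hyperplane_lborel B e)"
proof -
  interpret finite_product_sigma_finite "\<lambda>_. lborel :: real measure" "B - {e}"
    by standard (simp add: orthonormal_basis_finite[OF B])
  let ?P = "\<Pi>\<^sub>M b\<in>B - {e}. (lborel :: real measure)"
  let ?r = "\<lambda>y. \<lambda>b\<in>B - {e}. y \<bullet> b"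
  have [measurable]: "?r \<in> measurable borel ?P"
    by (intro measurable_restrict) simp
  have "distr (hyperplane_lborel B e) ?P ?r = distr ?P ?P (\<lambda>c. ?r (\<Sum>b\<in>B - {e}. c b *\<^sub>R b))"
    unfolding hyperplane_lborel_def by (subst distr_distr) (simp_all add: o_def)
  also have "\<dots> = distr ?P ?P (\<lambda>c. c)"
  proof (rule distr_cong)
    fix c :: "'a \<Rightarrow> real" assume "c \<in> space ?P"
    then have "c \<in> extensional (B - {e})" by (simp add: space_PiM PiE_def)
    then show "?r (\<Sum>b\<in>B - {e}. c b *\<^sub>R b) = c"
      by (intro extensionalityI[of _ "B - {e}"]) (simp_all add: hyperplane_coordinate)
  qed simp_all
  also have "\<dots> = ?P" by (rule distr_id2) simp
  finally have "sigma_finite_measure (distr (hyperplane_lborel B e) ?P ?r)"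
    by (simp add: sigma_finite_measure_axioms)
  then show ?thesis by (rule sigma_finite_measure_distr) measurable
qed

text \<open>Tonelli, with the coordinate along \<open>e\<close> split off from those in
  \<open>B - {e}\<close>.\<close>

lemma nn_integral_lborel_hyperplane:
  assumes [measurable]: "f \<in> borel_measurable borel"
  shows "(\<integral>\<^sup>+x. f x \<partial>lborel) = (\<integral>\<^sup>+y. \<integral>\<^sup>+t. f (y + t *\<^sub>R e) \<partial>lborel \<partial>hyperplane_lborel B e)"
proof -
  interpret product_sigma_finite "\<lambda>_. lborel :: real measure" ..
  have ins: "insert e (B - {e}) = B" using e by auto
  have fin: "finite (B - {e})" using orthonormal_basis_finite[OF B] by simp
  have [measurable]: "(\<lambda>c. \<Sum>b\<in>B. c b *\<^sub>R b) \<in> borel_measurable (\<Pi>\<^sub>M b\<in>B. (lborel :: real measure))"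
    by measurable
  have "(\<integral>\<^sup>+x. f x \<partial>lborel) = (\<integral>\<^sup>+c. f (\<Sum>b\<in>B. c b *\<^sub>R b) \<partial>(\<Pi>\<^sub>M b\<in>B. lborel))"
    by (subst lborel_eq_distr_orthonormal_basis[OF B], subst nn_integral_distr) simp_all
  also have "\<dots> = (\<integral>\<^sup>+c. \<integral>\<^sup>+t. f (\<Sum>b\<in>B. (c(e := t)) b *\<^sub>R b) \<partial>lborel \<partial>(\<Pi>\<^sub>M b\<in>B - {e}. lborel))"
    using product_nn_integral_insert[OF fin, of e "\<lambda>c. f (\<Sum>b\<in>B. c b *\<^sub>R b)"] by (simp only: ins) simp
  also have "\<dots> = (\<integral>\<^sup>+c. \<integral>\<^sup>+t. f ((\<Sum>b\<in>B - {e}. c b *\<^sub>R b) + t *\<^sub>R e) \<partial>lborel \<partial>(\<Pi>\<^sub>M b\<in>B - {e}. lborel))"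
    by (intro nn_integral_cong arg_cong[where f = f])
      (simp add: sum.remove[OF orthonormal_basis_finite[OF B] e] add.commute)
  also have "\<dots> = (\<integral>\<^sup>+y. \<integral>\<^sup>+t. f (y + t *\<^sub>R e) \<partial>lborel \<partial>hyperplane_lborel B e)"
    unfolding hyperplane_lborel_def by (subst nn_integral_distr) simp_all
  finally show ?thesis .
qed

text \<open>The slicing formula as an identity of measures, the form from which Fubini for signed
  integrands follows.\<close>

lemma lborel_eq_distr_hyperplane:
  "lborel = distr (hyperplane_lborel B e \<Otimes>\<^sub>M lborel) borel (\<lambda>(y, t). y + t *\<^sub>R e)"
proof (rule measure_eqI)
  interpret H: sigma_finite_measure "hyperplane_lborel B e" by (rule sigma_finite_hyperplane_lborel)
  interpret pair_sigma_finite "hyperplane_lborel B e" "lborel :: real measure" ..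
  fix A :: "'a set" assume "A \<in> sets lborel"
  then have [measurable]: "A \<in> sets borel" by simp
  have "emeasure lborel A = (\<integral>\<^sup>+x. indicator A x \<partial>lborel)" by simp
  also have "\<dots> = (\<integral>\<^sup>+y. \<integral>\<^sup>+t. indicator A (y + t *\<^sub>R e) \<partial>lborel \<partial>hyperplane_lborel B e)"
    by (rule nn_integral_lborel_hyperplane) simp
  also have "\<dots> = (\<integral>\<^sup>+p. indicator A (fst p + snd p *\<^sub>R e) \<partial>(hyperplane_lborel B e \<Otimes>\<^sub>M lborel))"
    using lborel.nn_integral_fst[of "\<lambda>p. indicator A (fst p + snd p *\<^sub>R e)" "hyperplane_lborel B e"] by simp
  also have "\<dots> = (\<integral>\<^sup>+x. indicator A x \<partial>distr (hyperplane_lborel B e \<Otimes>\<^sub>M lborel) borel (\<lambda>(y, t). y + t *\<^sub>R e))"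
    by (subst nn_integral_distr) (simp_all add: case_prod_beta)
  finally show "emeasure lborel A
      = emeasure (distr (hyperplane_lborel B e \<Otimes>\<^sub>M lborel) borel (\<lambda>(y, t). y + t *\<^sub>R e)) A"
    by simp
qed simp

lemma integral_lborel_hyperplane:
  fixes f :: "'a \<Rightarrow> real"
  assumes f: "integrable lborel f"
  shows "(LBINT x. f x) = (\<integral>y. \<integral>t. f (y + t *\<^sub>R e) \<partial>lborel \<partial>hyperplane_lborel B e)"
    and "integrable (hyperplane_lborel B e) (\<lambda>y. \<integral>t. f (y + t *\<^sub>R e) \<partial>lborel)"
    and "AE y in hyperplane_lborel B e. integrable lborel (\<lambda>t. f (y + t *\<^sub>R e))"
proof -
  interpret H: sigma_finite_measure "hyperplane_lborel B e" by (rule sigma_finite_hyperplane_lborel)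
  interpret pair_sigma_finite "hyperplane_lborel B e" "lborel :: real measure" ..
  let ?\<phi> = "\<lambda>(y, t). y + t *\<^sub>R e"
  have [measurable]: "f \<in> borel_measurable borel" using f by auto
  have "integrable (distr (hyperplane_lborel B e \<Otimes>\<^sub>M lborel) borel ?\<phi>) f"
    using f lborel_eq_distr_hyperplane by simp
  then have "integrable (hyperplane_lborel B e \<Otimes>\<^sub>M lborel) (\<lambda>p. f (?\<phi> p))"
    by (subst (asm) integrable_distr_eq) simp_all
  then have int: "integrable (hyperplane_lborel B e \<Otimes>\<^sub>M lborel) (\<lambda>(y, t). f (y + t *\<^sub>R e))"
    by (simp add: case_prod_beta')
  have "(LBINT x. f x) = (\<integral>p. f (?\<phi> p) \<partial>(hyperplane_lborel B e \<Otimes>\<^sub>M lborel))"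
    by (subst lborel_eq_distr_hyperplane, subst integral_distr) simp_all
  also have "\<dots> = (\<integral>y. \<integral>t. f (y + t *\<^sub>R e) \<partial>lborel \<partial>hyperplane_lborel B e)"
    using integral_fst[OF int] by (simp add: case_prod_beta')
  finally show "(LBINT x. f x) = (\<integral>y. \<integral>t. f (y + t *\<^sub>R e) \<partial>lborel \<partial>hyperplane_lborel B e)" .
  show "integrable (hyperplane_lborel B e) (\<lambda>y. \<integral>t. f (y + t *\<^sub>R e) \<partial>lborel)"
    using integrable_fst[OF int] by simp
  show "AE y in hyperplane_lborel B e. integrable lborel (\<lambda>t. f (y + t *\<^sub>R e))"
    using AE_integrable_fst[OF int] by simp
qed

text \<open>A cylinder of height \<open>1\<close> over a ball of radius \<open>R\<close> fits into a
  ball of radius \<open>R + 1\<close>; the finite volume of the latter bounds the base.\<close>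

lemma emeasure_hyperplane_lborel_bounded:
  assumes "bounded S"
  shows "emeasure (hyperplane_lborel B e) S < \<infinity>"
proof -
  obtain R where R: "S \<subseteq> cball 0 R" using assms unfolding bounded_iff by (metis mem_cball_0 subsetI)
  let ?H = "hyperplane_lborel B e"
  have "emeasure ?H (cball 0 R) = (\<integral>\<^sup>+y. indicator (cball 0 R) y \<partial>?H)"
    by simp
  also have "\<dots> \<le> (\<integral>\<^sup>+y. \<integral>\<^sup>+t. indicator (cball 0 (R + 1)) (y + t *\<^sub>R e) \<partial>lborel \<partial>?H)"
  proof (intro nn_integral_mono)
    fix y :: 'a
    have "indicator (cball 0 R) y = (\<integral>\<^sup>+t. indicator (cball 0 R) y * indicator {0..1::real} t \<partial>lborel)"
      by (subst nn_integral_cmult) simp_all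
    also have "\<dots> \<le> (\<integral>\<^sup>+t. indicator (cball 0 (R + 1)) (y + t *\<^sub>R e) \<partial>lborel)"
    proof (intro nn_integral_mono)
      fix t :: real
      have "norm (y + t *\<^sub>R e) \<le> norm y + \<bar>t\<bar>"
        using norm_triangle_ineq[of y "t *\<^sub>R e"] by (simp add: orthonormal_basis_norm)
      then show "indicator (cball 0 R) y * indicator {0..1} t
          \<le> (indicator (cball 0 (R + 1)) (y + t *\<^sub>R e) :: ennreal)"
        by (auto simp: indicator_def split: if_splits)
    qed
    finally show "indicator (cball 0 R) y
        \<le> (\<integral>\<^sup>+t. indicator (cball 0 (R + 1)) (y + t *\<^sub>R e) \<partial>lborel)" .
  qed
  also have "\<dots> = (\<integral>\<^sup>+x. indicator (cball (0::'a) (R + 1)) x \<partial>lborel)"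
    by (rule nn_integral_lborel_hyperplane[symmetric]) (intro borel_measurable_indicator borel_closed closed_cball)
  also have "\<dots> < \<infinity>"
    using emeasure_lborel_cball_finite[of "0::'a" "R + 1"] by simp
  finally have "emeasure ?H (cball 0 R) < \<infinity>" .
  then show ?thesis using emeasure_mono[OF R, of ?H] by (simp add: le_less_trans)
qed

end

section \<open>Continuously differentiable functions\<close>

definition C1_gradient :: "('a::euclidean_space \<Rightarrow> real) \<Rightarrow> ('a \<Rightarrow> 'a) \<Rightarrow> bool" where
  "C1_gradient \<phi> G \<longleftrightarrow> (\<forall>x. GDERIV \<phi> x :> G x) \<and> continuous_on UNIV G"

lemma C1_gradient_has_derivative:
  "C1_gradient \<phi> G \<Longrightarrow> (\<phi> has_derivative (\<lambda>h. h \<bullet> G x)) (at x within S)"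
  using has_derivative_at_withinI unfolding C1_gradient_def gderiv_def by blast

lemma C1_gradient_continuous:
  assumes "C1_gradient \<phi> G"
  shows "continuous_on S \<phi>" "continuous_on S G"
proof -
  show "continuous_on S \<phi>"
    by (rule has_derivative_continuous_on[OF C1_gradient_has_derivative[OF assms]])
  show "continuous_on S G"
    using assms continuous_on_subset by (auto simp: C1_gradient_def)
qed

lemma C1_gradient_measurable [measurable_dest]:
  assumes "C1_gradient \<phi> G"
  shows "\<phi> \<in> borel_measurable borel" "G \<in> borel_measurable borel"
  using C1_gradient_continuous[OF assms, of UNIV] by (auto intro: borel_measurable_continuous_onI)

lemma C1_gradient_line_derivative:
  assumes "C1_gradient \<phi> G"
  shows "((\<lambda>s. \<phi> (x + s *\<^sub>R v)) has_real_derivative G (x + s *\<^sub>R v) \<bullet> v) (at s)"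
proof -
  have "((\<lambda>s. \<phi> (x + s *\<^sub>R v)) has_derivative (\<lambda>h. (h *\<^sub>R v) \<bullet> G (x + s *\<^sub>R v))) (at s)"
    by (rule has_derivative_compose[OF _ C1_gradient_has_derivative[OF assms]])
      (auto intro!: derivative_eq_intros)
  moreover have "(\<lambda>h. (h *\<^sub>R v) \<bullet> G (x + s *\<^sub>R v)) = (*) (G (x + s *\<^sub>R v) \<bullet> v)"
    by (auto simp: inner_commute mult.commute)
  ultimately show ?thesis
    by (simp add: has_field_derivative_def)
qed

lemma C1_gradient_lipschitz:
  assumes \<phi>: "C1_gradient \<phi> G"
  obtains L where "0 \<le> L" "\<And>x y. x \<in> cball z R \<Longrightarrow> y \<in> cball z R \<Longrightarrow> \<bar>\<phi> x - \<phi> y\<bar> \<le> L * norm (x - y)"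
proof -
  have "bounded (G ` cball z R)"
    using compact_continuous_image[OF C1_gradient_continuous(2)[OF \<phi>] compact_cball] compact_imp_bounded by blast
  then obtain L where L: "\<And>x. x \<in> cball z R \<Longrightarrow> norm (G x) \<le> L"
    unfolding bounded_iff by blast
  have "\<bar>\<phi> x - \<phi> y\<bar> \<le> max 0 L * norm (x - y)" if "x \<in> cball z R" "y \<in> cball z R" for x y
  proof -
    have "norm (\<phi> x - \<phi> y) \<le> max 0 L * norm (x - y)"
    proof (rule differentiable_bound[OF convex_cball C1_gradient_has_derivative[OF \<phi>]])
      fix w assume "w \<in> cball z R"
      then have "norm (G w) \<le> max 0 L" using L[of w] by simp
      then show "onorm (\<lambda>h. h \<bullet> G w) \<le> max 0 L"
        by (intro onorm_bound)
          (auto intro!: order_trans[OF Cauchy_Schwarz_ineq2] mult_left_mono simp: mult.commute[of "max 0 L"])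
    qed fact+
    then show ?thesis by simp
  qed
  then show ?thesis using that[of "max 0 L"] by simp
qed

lemma C1_gradient_bounded_support:
  assumes \<phi>: "C1_gradient \<phi> G" and supp: "\<And>x. x \<notin> ball z R \<Longrightarrow> \<phi> x = 0"
  obtains M where "0 \<le> M" "\<And>x. \<bar>\<phi> x\<bar> \<le> M"
proof -
  have "bounded (\<phi> ` cball z R)"
    using compact_continuous_image[OF C1_gradient_continuous(1)[OF \<phi>] compact_cball] compact_imp_bounded by blast
  then obtain M where M: "\<And>x. x \<in> cball z R \<Longrightarrow> norm (\<phi> x) \<le> M"
    unfolding bounded_iff by blast
  have "\<bar>\<phi> x\<bar> \<le> max 0 M" for x
    using M[of x] supp[of x] by (cases "x \<in> ball z R") auto
  then show ?thesis using that[of "max 0 M"] by simp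
qed

section \<open>Differentiating the integral of a translated function in two ways\<close>

lemma real_derivative_sequence:
  assumes "(f has_real_derivative D) (at 0)"
  shows "(\<lambda>n. (f (inverse (real (Suc n))) - f 0) / inverse (real (Suc n))) \<longlonglongrightarrow> D"
proof -
  have "filterlim (\<lambda>n. inverse (real (Suc n))) (at 0) sequentially"
    by (intro filterlim_atI LIMSEQ_inverse_real_of_nat) simp
  moreover have "(\<lambda>h. (f (0 + h) - f 0) / h) \<midarrow>0\<rightarrow> D"
    using assms by (simp add: DERIV_def)
  ultimately show ?thesis
    using filterlim_compose by (force simp: o_def)
qed

text \<open>One way to differentiate: the derivative falls on \<open>\<phi>\<close>, by dominated
  convergence along the steps \<open>1 / (n + 1)\<close>. The majorant is a Lipschitz constant on a
  bounded set.\<close>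

lemma difference_quotient_integral:
  fixes \<phi> :: "'a::euclidean_space \<Rightarrow> real"
  assumes \<phi>: "C1_gradient \<phi> G" and supp: "\<And>x. x \<notin> ball z R \<Longrightarrow> \<phi> x = 0"
    and W [measurable]: "W \<in> sets borel"
  shows "(\<lambda>n. \<integral>x. indicator W x * ((\<phi> (x + inverse (real (Suc n)) *\<^sub>R v) - \<phi> x) / inverse (real (Suc n))) \<partial>lborel)
      \<longlonglongrightarrow> (LBINT x. indicator W x * (G x \<bullet> v))"
proof -
  note [measurable] = C1_gradient_measurable[OF \<phi>]
  obtain L where L: "0 \<le> L"
      "\<And>x y. x \<in> cball z (R + 2 * norm v) \<Longrightarrow> y \<in> cball z (R + 2 * norm v) \<Longrightarrow> \<bar>\<phi> x - \<phi> y\<bar> \<le> L * norm (x - y)"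
    using C1_gradient_lipschitz[OF \<phi>] by blast
  \<comment> \<open>All steps are at most \<open>1\<close>, so every quotient vanishes outside
    radius \<open>R + norm v\<close>. The translated points still lie within
    \<open>R + 2 * norm v\<close>, where the Lipschitz constant was taken.\<close>
  let ?w = "\<lambda>x. indicator (cball z (R + norm v)) x * (L * norm v)"
  show ?thesis
  proof (rule integral_dominated_convergence[where w = ?w])
    have "emeasure lborel (cball z (R + norm v)) < \<infinity>"
      by (rule emeasure_lborel_cball_finite)
    then show "integrable lborel ?w"
      by simp
    show "AE x in lborel. (\<lambda>n. indicator W x * ((\<phi> (x + inverse (real (Suc n)) *\<^sub>R v) - \<phi> x) / inverse (real (Suc n))))
        \<longlonglongrightarrow> indicator W x * (G x \<bullet> v)"
    proof (intro AE_I2 tendsto_mult_left)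
      fix x
      show "(\<lambda>n. (\<phi> (x + inverse (real (Suc n)) *\<^sub>R v) - \<phi> x) / inverse (real (Suc n))) \<longlonglongrightarrow> G x \<bullet> v"
        using real_derivative_sequence[OF C1_gradient_line_derivative[OF \<phi>, of x v 0, simplified]] by simp
    qed
    fix n
    define s where "s = inverse (real (Suc n))"
    have s: "0 < s" "s \<le> 1" by (simp_all add: s_def field_simps)
    have "\<bar>(\<phi> (x + s *\<^sub>R v) - \<phi> x) / s\<bar> \<le> ?w x" for x
    proof (cases "x \<in> cball z (R + norm v)")
      case True
      have "norm (s *\<^sub>R v) \<le> norm v" using s by (simp add: mult_left_le_one_le)
      moreover have "dist z (x + s *\<^sub>R v) \<le> dist z x + norm (s *\<^sub>R v)"
        using dist_triangle[of z "x + s *\<^sub>R v" x] by (simp add: dist_norm)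
      ultimately have "x \<in> cball z (R + 2 * norm v)" "x + s *\<^sub>R v \<in> cball z (R + 2 * norm v)"
        using True norm_ge_zero[of v] by (simp_all del: norm_ge_zero)
      from L(2)[OF this(2,1)] show ?thesis using s True by (simp add: field_simps abs_mult)
    next
      case False
      have "norm (s *\<^sub>R v) \<le> norm v" using s by (simp add: mult_left_le_one_le)
      moreover have "dist z x \<le> dist z (x + s *\<^sub>R v) + norm (s *\<^sub>R v)"
        using dist_triangle[of z x "x + s *\<^sub>R v"] by (simp add: dist_norm)
      ultimately have "x \<notin> ball z R" "x + s *\<^sub>R v \<notin> ball z R"
        using False norm_ge_zero[of v] by (simp_all del: norm_ge_zero)
      then show ?thesis using L(1) by (simp add: supp)
    qed
    moreover have "norm (indicator W x * c) \<le> \<bar>c\<bar>" for x c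
      by (simp add: indicator_def)
    ultimately have "norm (indicator W x * ((\<phi> (x + s *\<^sub>R v) - \<phi> x) / s)) \<le> ?w x" for x
      using order_trans by blast
    then show "AE x in lborel. norm (indicator W x * ((\<phi> (x + inverse (real (Suc n)) *\<^sub>R v) - \<phi> x) / inverse (real (Suc n)))) \<le> ?w x"
      by (simp add: s_def)
  qed measurable
qed

lemma integral_lborel_translation:
  fixes f :: "'a::euclidean_space \<Rightarrow> real"
  assumes [measurable]: "f \<in> borel_measurable borel"
  shows "(LBINT x. f (a + x)) = (LBINT x. f x)"
  by (subst (2) lborel_distr_plus[of a, symmetric]) (simp add: integral_distr)

lemma integrable_lborel_translation:
  fixes f :: "'a::euclidean_space \<Rightarrow> real"
  assumes "integrable lborel f"
  shows "integrable lborel (\<lambda>x. f (a + x))"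
proof -
  have "integrable (distr lborel borel ((+) a)) f" using assms by (simp add: lborel_distr_plus)
  then show ?thesis by (subst (asm) integrable_distr_eq) (use assms in auto)
qed

lemma C1_gradient_integrable:
  fixes \<phi> :: "'a::euclidean_space \<Rightarrow> real"
  assumes \<phi>: "C1_gradient \<phi> G" and supp: "\<And>x. x \<notin> ball z R \<Longrightarrow> \<phi> x = 0"
  shows "integrable lborel \<phi>"
proof -
  note [measurable] = C1_gradient_measurable[OF \<phi>]
  obtain M where M: "0 \<le> M" "\<And>x. \<bar>\<phi> x\<bar> \<le> M"
    using C1_gradient_bounded_support[OF \<phi> supp] by blast
  have "emeasure lborel (ball z R) < \<infinity>" by (rule emeasure_lborel_ball_finite)
  then have "integrable lborel (\<lambda>x. M * indicator (ball z R) x)" by simp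
  then show ?thesis
    by (rule Bochner_Integration.integrable_bound) (use M supp in \<open>auto simp: indicator_def\<close>)
qed

text \<open>By translation invariance every difference quotient has integral \<open>0\<close>. This
  is the divergence theorem away from the boundary.\<close>

lemma integral_gradient_eq_0:
  fixes \<phi> :: "'a::euclidean_space \<Rightarrow> real"
  assumes \<phi>: "C1_gradient \<phi> G" and supp: "\<And>x. x \<notin> ball z R \<Longrightarrow> \<phi> x = 0"
  shows "(LBINT x. G x \<bullet> v) = 0"
proof -
  note [measurable] = C1_gradient_measurable[OF \<phi>]
  have int: "integrable lborel \<phi>" by (rule C1_gradient_integrable[OF \<phi> supp])
  have quotient: "(LBINT x. (\<phi> (x + s *\<^sub>R v) - \<phi> x) / s) = 0" for s
    using integrable_lborel_translation[OF int, of "s *\<^sub>R v"] integral_lborel_translation[of \<phi> "s *\<^sub>R v"] int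
    by (simp add: add.commute)
  have "(\<lambda>n. \<integral>x. indicator UNIV x * ((\<phi> (x + inverse (real (Suc n)) *\<^sub>R v) - \<phi> x) / inverse (real (Suc n))) \<partial>lborel)
      \<longlonglongrightarrow> (LBINT x. indicator UNIV x * (G x \<bullet> v))"
    by (rule difference_quotient_integral[OF \<phi> supp]) simp_all
  then have "(\<lambda>n. 0) \<longlonglongrightarrow> (LBINT x. G x \<bullet> v)"
    by (simp only: indicator_UNIV mult_1_left quotient)
  then show ?thesis
    using LIMSEQ_unique tendsto_const by blast
qed

text \<open>The difference of two half-line indicators is the signed indicator of the interval
  between \<open>p\<close> and \<open>q\<close>, so one formula serves both orders of the
  endpoints.\<close>

lemma integral_interval_mean_value:
  fixes f :: "real \<Rightarrow> real"
  assumes f: "continuous_on UNIV f"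
  obtains \<xi> where "\<bar>\<xi> - p\<bar> \<le> \<bar>q - p\<bar>"
    "(LBINT t. f t * (indicator {q<..} t - indicator {p<..} t)) = (p - q) * f \<xi>"
proof -
  note [measurable] = borel_measurable_continuous_onI[OF f]
  have *: "\<exists>\<xi>\<in>{a..b}. (LBINT t. f t * indicator {a<..b} t) = (b - a) * f \<xi>" if "a < b" for a b
  proof -
    have cont: "continuous_on {a..b} f" using f continuous_on_subset by blast
    then obtain g where g: "\<And>x. x \<in> {a..b} \<Longrightarrow> (g has_vector_derivative f x) (at x within {a..b})"
      using antiderivative_continuous by blast
    have "(LBINT t. f t * indicator {a<..b} t) = (LBINT t. indicator {a..b} t *\<^sub>R f t)"
    proof (rule integral_cong_AE)
      show "AE t in lborel. f t * indicator {a<..b} t = indicator {a..b} t *\<^sub>R f t"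
        using AE_lborel_singleton[of a] by eventually_elim (auto simp: indicator_def)
    qed measurable
    also have "\<dots> = g b - g a"
      using that g cont by (intro integral_FTC_Icc) auto
    finally have int: "(LBINT t. f t * indicator {a<..b} t) = g b - g a" .
    have "\<exists>x\<in>{a<..<b}. g b - g a = (\<lambda>h. h *\<^sub>R f x) (b - a)"
      by (rule mvt_simple[OF that]) (use g in \<open>auto simp: has_vector_derivative_def\<close>)
    then obtain \<xi> where "\<xi> \<in> {a<..<b}" "g b - g a = (b - a) * f \<xi>" by auto
    then show ?thesis using int by (intro bexI[of _ \<xi>]) auto
  qed
  consider "q < p" | "p < q" | "p = q" by linarith
  then show ?thesis
  proof cases
    case 1
    from *[OF this] obtain \<xi> where \<xi>: "\<xi> \<in> {q..p}"
      "(LBINT t. f t * indicator {q<..p} t) = (p - q) * f \<xi>" by blast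
    moreover have "(\<lambda>t. f t * (indicator {q<..} t - indicator {p<..} t)) = (\<lambda>t. f t * indicator {q<..p} t)"
      using 1 by (auto simp: indicator_def fun_eq_iff)
    ultimately show ?thesis using that[of \<xi>] by auto
  next
    case 2
    from *[OF this] obtain \<xi> where \<xi>: "\<xi> \<in> {p..q}"
      "(LBINT t. f t * indicator {p<..q} t) = (q - p) * f \<xi>" by blast
    moreover have "(\<lambda>t. f t * (indicator {q<..} t - indicator {p<..} t)) = (\<lambda>t. - (f t * indicator {p<..q} t))"
      using 2 by (auto simp: indicator_def fun_eq_iff)
    ultimately show ?thesis using that[of \<xi>] by (auto simp: algebra_simps)
  next
    case 3
    then show ?thesis using that[of p] by simp
  qed
qed

text \<open>The other way to differentiate: the translation is moved onto the epigraph. On the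
  vertical line over \<open>y\<close> the two indicators differ on a signed interval, and its length
  divided by the step tends to \<open>(g y - e) \<bullet> v\<close>. This vector is the normal with
  the area element already multiplied in.\<close>

lemma epigraph_divergence:
  fixes \<phi> \<gamma> :: "'a::euclidean_space \<Rightarrow> real"
  assumes B: "orthonormal_basis B" and e: "e \<in> B"
    and \<gamma>e: "\<And>x t. \<gamma> (x + t *\<^sub>R e) = \<gamma> x" and \<gamma>: "C1_gradient \<gamma> g"
    and \<phi>: "C1_gradient \<phi> G" and supp: "\<And>x. x \<notin> ball z R \<Longrightarrow> \<phi> x = 0"
  shows "(LBINT x. indicator {x. \<gamma> x < x \<bullet> e} x * (G x \<bullet> v))
    = (\<integral>y. \<phi> (y + \<gamma> y *\<^sub>R e) * ((g y - e) \<bullet> v) \<partial>hyperplane_lborel B e)"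
proof -
  let ?H = "hyperplane_lborel B e"
  note ee = orthonormal_basis_norm[OF B e]
  note [measurable] = C1_gradient_measurable[OF \<phi>] C1_gradient_measurable[OF \<gamma>]
  define W where "W = {x. \<gamma> x < x \<bullet> e}"
  have W [measurable]: "W \<in> sets borel" unfolding W_def by measurable
  define s where "s n = inverse (real (Suc n))" for n
  have s: "0 < s n" "s n \<le> 1" for n by (simp_all add: s_def field_simps)
  define F where "F n x = \<phi> x * ((indicator W (x - s n *\<^sub>R v) - indicator W x) / s n)" for n x
  have int\<phi>: "integrable lborel \<phi>" by (rule C1_gradient_integrable[OF \<phi> supp])
  have int1: "integrable lborel (\<lambda>x. \<phi> x * indicator A x)" if "A \<in> sets borel" for A
    using integrable_mult_indicator[OF _ int\<phi>, of A] that by (simp add: mult.commute)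
  have intF: "integrable lborel (F n)"
    and shift: "(LBINT x. indicator W x * ((\<phi> (x + s n *\<^sub>R v) - \<phi> x) / s n)) = (LBINT x. F n x)" for n
  proof -
    have [measurable]: "(\<lambda>x. x - s n *\<^sub>R v) -` W \<in> sets borel"
      using measurable_sets_borel[of "\<lambda>x. x - s n *\<^sub>R v" borel W] by simp
    have i1: "integrable lborel (\<lambda>x. \<phi> x * indicator W (x - s n *\<^sub>R v))"
      using int1[of "(\<lambda>x. x - s n *\<^sub>R v) -` W"] by (simp add: indicator_vimage[symmetric] o_def indicator_def)
    have i2: "integrable lborel (\<lambda>x. \<phi> x * indicator W x)" by (rule int1) simp
    have i3: "integrable lborel (\<lambda>x. \<phi> (x + s n *\<^sub>R v) * indicator W x)"
      using integrable_lborel_translation[OF i1, of "s n *\<^sub>R v"] by (simp add: add.commute)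
    have eq: "(LBINT x. \<phi> (x + s n *\<^sub>R v) * indicator W x) = (LBINT x. \<phi> x * indicator W (x - s n *\<^sub>R v))"
      using integral_lborel_translation[of "\<lambda>x. \<phi> x * indicator W (x - s n *\<^sub>R v)" "s n *\<^sub>R v"]
      by (simp add: add.commute)
    have F: "F n = (\<lambda>x. (\<phi> x * indicator W (x - s n *\<^sub>R v) - \<phi> x * indicator W x) / s n)"
      by (auto simp: F_def fun_eq_iff diff_divide_distrib right_diff_distrib)
    show "integrable lborel (F n)" unfolding F using i1 i2 by simp
    have "(LBINT x. indicator W x * ((\<phi> (x + s n *\<^sub>R v) - \<phi> x) / s n))
        = (LBINT x. (\<phi> (x + s n *\<^sub>R v) * indicator W x - \<phi> x * indicator W x) / s n)"
      by (intro Bochner_Integration.integral_cong) (auto simp: algebra_simps diff_divide_distrib)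
    also have "\<dots> = (LBINT x. F n x)"
      unfolding F using i1 i2 i3 by (simp add: eq)
    finally show "(LBINT x. indicator W x * ((\<phi> (x + s n *\<^sub>R v) - \<phi> x) / s n)) = (LBINT x. F n x)" .
  qed
  \<comment> \<open>\<open>q y n\<close> is the height above \<open>y\<close> of the graph
    translated by the vector \<open>s n *\<^sub>R v\<close>.\<close>
  define q where "q y n = \<gamma> (y - s n *\<^sub>R v) + s n * (v \<bullet> e)" for y n
  have inner: "\<exists>\<xi>. \<bar>\<xi> - \<gamma> y\<bar> \<le> \<bar>q y n - \<gamma> y\<bar>
      \<and> (LBINT t. F n (y + t *\<^sub>R e)) = \<phi> (y + \<xi> *\<^sub>R e) * ((\<gamma> y - q y n) / s n)"
    if "y \<bullet> e = 0" for y n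
  proof -
    have "continuous_on UNIV (\<lambda>t. \<phi> (y + t *\<^sub>R e))"
      by (rule continuous_on_compose2[OF C1_gradient_continuous(1)[OF \<phi>, of UNIV]])
        (auto intro!: continuous_intros)
    then obtain \<xi> where \<xi>: "\<bar>\<xi> - \<gamma> y\<bar> \<le> \<bar>q y n - \<gamma> y\<bar>"
      "(LBINT t. \<phi> (y + t *\<^sub>R e) * (indicator {q y n<..} t - indicator {\<gamma> y<..} t))
        = (\<gamma> y - q y n) * \<phi> (y + \<xi> *\<^sub>R e)"
      by (rule integral_interval_mean_value[where p = "\<gamma> y" and q = "q y n"])
    have "F n (y + t *\<^sub>R e) = \<phi> (y + t *\<^sub>R e) * (indicator {q y n<..} t - indicator {\<gamma> y<..} t) / s n" for t
    proof -
      have "\<gamma> (y + t *\<^sub>R e - s n *\<^sub>R v) = \<gamma> (y - s n *\<^sub>R v)"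
        using \<gamma>e[of "y - s n *\<^sub>R v" t] by (simp only: diff_add_eq)
      then have "y + t *\<^sub>R e - s n *\<^sub>R v \<in> W \<longleftrightarrow> q y n < t"
        using that ee by (auto simp: W_def q_def inner_add_left inner_diff_left)
      moreover have "y + t *\<^sub>R e \<in> W \<longleftrightarrow> \<gamma> y < t"
        using that ee by (simp add: W_def \<gamma>e inner_add_left)
      ultimately show ?thesis by (simp add: F_def indicator_def)
    qed
    then have "(LBINT t. F n (y + t *\<^sub>R e))
        = (LBINT t. \<phi> (y + t *\<^sub>R e) * (indicator {q y n<..} t - indicator {\<gamma> y<..} t)) / s n"
      by simp
    then show ?thesis using \<xi> by (intro exI[of _ \<xi>]) simp
  qed
  \<comment> \<open>Orthogonal projection does not increase norms, so a vertical line over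
    \<open>y\<close> with \<open>norm y > C\<close> misses the support of
    \<open>\<phi>\<close>.\<close>
  define C where "C = norm z + R"
  obtain L where L: "0 \<le> L"
    "\<And>x y. x \<in> cball 0 (C + norm v) \<Longrightarrow> y \<in> cball 0 (C + norm v) \<Longrightarrow> \<bar>\<gamma> x - \<gamma> y\<bar> \<le> L * norm (x - y)"
    using C1_gradient_lipschitz[OF \<gamma>] by blast
  obtain M where M: "0 \<le> M" "\<And>x. \<bar>\<phi> x\<bar> \<le> M"
    using C1_gradient_bounded_support[OF \<phi> supp] by blast
  \<comment> \<open>The two summands bound the change of \<open>\<gamma>\<close> and the vertical
    component of the translation, both per unit step.\<close>
  let ?w = "\<lambda>y. indicator (cball 0 C) y * (M * (L * norm v + norm v))"
  have "(\<lambda>n. \<integral>y. (LBINT t. F n (y + t *\<^sub>R e)) \<partial>?H)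
      \<longlonglongrightarrow> (\<integral>y. \<phi> (y + \<gamma> y *\<^sub>R e) * ((g y - e) \<bullet> v) \<partial>?H)"
  proof (rule integral_dominated_convergence[where w = ?w])
    show "integrable ?H ?w"
      using emeasure_hyperplane_lborel_bounded[OF B e bounded_cball, of 0 C] by simp
    show "AE y in ?H. (\<lambda>n. \<integral>t. F n (y + t *\<^sub>R e) \<partial>lborel) \<longlonglongrightarrow> \<phi> (y + \<gamma> y *\<^sub>R e) * ((g y - e) \<bullet> v)"
      using AE_hyperplane_lborel[OF B e]
    proof eventually_elim
      case (elim y)
      have "\<forall>n. \<exists>\<xi>. \<bar>\<xi> - \<gamma> y\<bar> \<le> \<bar>q y n - \<gamma> y\<bar>
          \<and> (LBINT t. F n (y + t *\<^sub>R e)) = \<phi> (y + \<xi> *\<^sub>R e) * ((\<gamma> y - q y n) / s n)"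
        using inner[OF elim] by blast
      then obtain \<xi> where \<xi>: "\<And>n. \<bar>\<xi> n - \<gamma> y\<bar> \<le> \<bar>q y n - \<gamma> y\<bar>"
        "\<And>n. (LBINT t. F n (y + t *\<^sub>R e)) = \<phi> (y + \<xi> n *\<^sub>R e) * ((\<gamma> y - q y n) / s n)" by metis
      have "((\<lambda>s. \<gamma> (y + s *\<^sub>R (- v)) + s * (v \<bullet> e)) has_real_derivative g y \<bullet> (- v) + v \<bullet> e) (at 0)"
        using C1_gradient_line_derivative[OF \<gamma>, of y "- v" 0] by (auto intro!: derivative_eq_intros)
      from real_derivative_sequence[OF this]
      have lim: "(\<lambda>n. (q y n - \<gamma> y) / s n) \<longlonglongrightarrow> - (g y \<bullet> v) + v \<bullet> e"
        by (simp add: q_def s_def)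
      have "s \<longlonglongrightarrow> 0" unfolding s_def by (rule LIMSEQ_inverse_real_of_nat)
      from tendsto_mult[OF lim this] have "(\<lambda>n. q y n - \<gamma> y) \<longlonglongrightarrow> 0"
        using s(1) by (simp add: less_imp_neq[symmetric])
      then have "(\<lambda>n. \<bar>q y n - \<gamma> y\<bar>) \<longlonglongrightarrow> 0" by (simp add: tendsto_rabs_zero_iff)
      then have "(\<lambda>n. \<xi> n - \<gamma> y) \<longlonglongrightarrow> 0"
        by (rule Lim_null_comparison[rotated]) (simp add: \<xi>(1))
      then have "\<xi> \<longlonglongrightarrow> \<gamma> y" by (simp add: LIM_zero_iff)
      then have "(\<lambda>n. y + \<xi> n *\<^sub>R e) \<longlonglongrightarrow> y + \<gamma> y *\<^sub>R e" by (intro tendsto_intros)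
      then have "(\<lambda>n. \<phi> (y + \<xi> n *\<^sub>R e)) \<longlonglongrightarrow> \<phi> (y + \<gamma> y *\<^sub>R e)"
        using continuous_on_tendsto_compose[OF C1_gradient_continuous(1)[OF \<phi>, of UNIV]] by simp
      from tendsto_mult[OF this tendsto_minus[OF lim]] show ?case
        by (simp add: \<xi>(2) inner_diff_left inner_diff_right inner_commute diff_divide_distrib)
    qed
    fix n
    show "AE y in ?H. norm (LBINT t. F n (y + t *\<^sub>R e)) \<le> ?w y"
      using AE_hyperplane_lborel[OF B e]
    proof eventually_elim
      case (elim y)
      obtain \<xi> where \<xi>: "(LBINT t. F n (y + t *\<^sub>R e)) = \<phi> (y + \<xi> *\<^sub>R e) * ((\<gamma> y - q y n) / s n)"
        using inner[OF elim] by blast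
      show ?case
      proof (cases "norm y \<le> C")
        case True
        have "norm (s n *\<^sub>R v) \<le> norm v" using s[of n] by (simp add: mult_left_le_one_le)
        moreover have "norm (y - s n *\<^sub>R v) \<le> norm y + norm (s n *\<^sub>R v)" by (rule norm_triangle_ineq4)
        ultimately have "y \<in> cball 0 (C + norm v)" "y - s n *\<^sub>R v \<in> cball 0 (C + norm v)"
          using True norm_ge_zero[of v] by (simp_all del: norm_ge_zero)
        from L(2)[OF this] have "\<bar>\<gamma> y - \<gamma> (y - s n *\<^sub>R v)\<bar> \<le> L * (s n * norm v)"
          using s[of n] by simp
        moreover have "\<bar>s n * (v \<bullet> e)\<bar> \<le> s n * norm v"
          using s[of n] Cauchy_Schwarz_ineq2[of v e] ee by (simp add: abs_mult)
        moreover have "\<gamma> y - q y n = \<gamma> y - \<gamma> (y - s n *\<^sub>R v) - s n * (v \<bullet> e)"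
          by (simp add: q_def)
        ultimately have "\<bar>\<gamma> y - q y n\<bar> \<le> L * (s n * norm v) + s n * norm v"
          by linarith
        then have "\<bar>(\<gamma> y - q y n) / s n\<bar> \<le> L * norm v + norm v"
          using s[of n] by (simp add: field_simps)
        then have "\<bar>\<phi> (y + \<xi> *\<^sub>R e)\<bar> * \<bar>(\<gamma> y - q y n) / s n\<bar> \<le> M * (L * norm v + norm v)"
          using M by (intro mult_mono) auto
        then show ?thesis using True by (simp add: \<xi> abs_mult)
      next
        case False
        have "(norm y)\<^sup>2 \<le> (norm (y + \<xi> *\<^sub>R e))\<^sup>2"
          using elim ee by (simp add: power2_norm_eq_inner inner_add_left inner_add_right inner_commute)
        then have "norm y \<le> norm (y + \<xi> *\<^sub>R e)" by (simp add: power2_le_iff_abs_le)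
        then have "y + \<xi> *\<^sub>R e \<notin> ball z R"
          using False norm_triangle_sub[of "y + \<xi> *\<^sub>R e" z] by (auto simp: C_def dist_norm norm_minus_commute)
        then show ?thesis using L M by (simp add: \<xi> supp)
      qed
    qed
    show "(\<lambda>y. \<integral>t. F n (y + t *\<^sub>R e) \<partial>lborel) \<in> borel_measurable ?H"
      using integral_lborel_hyperplane(2)[OF B e intF] by auto
  qed measurable
  moreover have "(\<integral>y. (LBINT t. F n (y + t *\<^sub>R e)) \<partial>?H)
      = (LBINT x. indicator W x * ((\<phi> (x + s n *\<^sub>R v) - \<phi> x) / s n))" for n
    using integral_lborel_hyperplane(1)[OF B e intF] shift by simp
  ultimately have "(\<lambda>n. \<integral>x. indicator W x * ((\<phi> (x + s n *\<^sub>R v) - \<phi> x) / s n) \<partial>lborel)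
      \<longlonglongrightarrow> (\<integral>y. \<phi> (y + \<gamma> y *\<^sub>R e) * ((g y - e) \<bullet> v) \<partial>?H)"
    by simp
  moreover have "(\<lambda>n. \<integral>x. indicator W x * ((\<phi> (x + s n *\<^sub>R v) - \<phi> x) / s n) \<partial>lborel)
      \<longlonglongrightarrow> (LBINT x. indicator W x * (G x \<bullet> v))"
    unfolding s_def by (rule difference_quotient_integral[OF \<phi> supp W])
  ultimately show ?thesis
    unfolding W_def by (rule LIMSEQ_unique[rotated])
qed

section \<open>The outward normal in a graph chart\<close>

text \<open>The set lies where \<open>\<gamma> x - x \<bullet> e\<close> is negative, hence the
  gradient \<open>g x - e\<close> of this function points outward. As \<open>g x\<close> is
  orthogonal to \<open>e\<close>, its length is the area element in the denominator.\<close>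

definition graph_normal :: "'a::euclidean_space \<Rightarrow> ('a \<Rightarrow> 'a) \<Rightarrow> 'a \<Rightarrow> 'a" where
  "graph_normal e g x = (g x - e) /\<^sub>R sqrt (1 + (norm (g x))\<^sup>2)"

context
  fixes \<Omega> :: "'a::euclidean_space set" and x0 r B e \<gamma> g
  assumes chart: "C1_graph_chart \<Omega> x0 r B e \<gamma> g"
begin

lemma chart_gradient: "C1_gradient \<gamma> g"
  using chart by (simp add: C1_graph_chart_def C1_gradient_def)

lemma chart_basis: "orthonormal_basis B" "e \<in> B"
  using chart by (simp_all add: C1_graph_chart_def)

lemma chart_const: "\<gamma> (x + t *\<^sub>R e) = \<gamma> x"
  using chart by (simp add: C1_graph_chart_def)

lemma chart_mem: "x \<in> ball x0 r \<Longrightarrow> x \<in> \<Omega> \<longleftrightarrow> \<gamma> x < x \<bullet> e"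
  using chart unfolding C1_graph_chart_def by blast

lemma chart_gradient_orthogonal: "g x \<bullet> e = 0"
proof -
  have "((\<lambda>s. \<gamma> (x + s *\<^sub>R e)) has_real_derivative g x \<bullet> e) (at 0)"
    using C1_gradient_line_derivative[OF chart_gradient, of x e 0] by simp
  then have "((\<lambda>s. \<gamma> x) has_real_derivative g x \<bullet> e) (at 0)" by (simp add: chart_const)
  then show ?thesis using DERIV_unique DERIV_const by blast
qed

lemma chart_gradient_const: "g (x + t *\<^sub>R e) = g x"
proof -
  have "((\<lambda>z. \<gamma> (z + t *\<^sub>R e)) has_derivative (\<lambda>h. h \<bullet> g (x + t *\<^sub>R e))) (at x)"
    by (rule has_derivative_compose[OF _ C1_gradient_has_derivative[OF chart_gradient]])
      (auto intro!: derivative_eq_intros)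
  then have "(\<lambda>h. h \<bullet> g (x + t *\<^sub>R e)) = (\<lambda>h. h \<bullet> g x)"
    using has_derivative_unique[OF _ C1_gradient_has_derivative[OF chart_gradient]] by (simp add: chart_const)
  then have "\<forall>h. h \<bullet> g (x + t *\<^sub>R e) = h \<bullet> g x" by (simp add: fun_eq_iff)
  then show ?thesis by (simp add: vector_eq_ldot)
qed

lemma norm_graph_normal: "norm (graph_normal e g x) = 1"
proof -
  have "(norm (g x - e))\<^sup>2 = 1 + (norm (g x))\<^sup>2"
    using orthonormal_basis_norm[OF chart_basis] chart_gradient_orthogonal[of x]
    by (simp add: power2_norm_eq_inner inner_diff_left inner_diff_right inner_commute)
  then have "norm (g x - e) = sqrt (1 + (norm (g x))\<^sup>2)"
    by (metis norm_ge_zero real_sqrt_unique)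
  moreover have "sqrt (1 + (norm (g x))\<^sup>2) > 0" by (simp add: add_pos_nonneg)
  ultimately show ?thesis by (simp add: graph_normal_def)
qed

text \<open>The area element cancels the normalisation; this converts the integrand of
  \<open>epigraph_divergence\<close> into a flux against surface measure.\<close>

lemma graph_normal_inner:
  "sqrt (1 + (norm (g x))\<^sup>2) * (graph_normal e g x \<bullet> v) = (g x - e) \<bullet> v"
proof -
  have "sqrt (1 + (norm (g x))\<^sup>2) > 0" by (simp add: add_pos_nonneg)
  then show ?thesis by (simp add: graph_normal_def)
qed

lemma graph_normal_continuous: "continuous_on S (graph_normal e g)"
proof -
  have "1 + (norm (g x))\<^sup>2 \<noteq> 0" for x
    using zero_le_power2[of "norm (g x)"] by linarith
  then show ?thesis
    unfolding graph_normal_def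
    by (intro continuous_intros C1_gradient_continuous(2)[OF chart_gradient]) simp
qed

lemma graph_normal_measurable [measurable]: "graph_normal e g \<in> borel_measurable borel"
  by (intro borel_measurable_continuous_onI graph_normal_continuous)

lemma graph_normal_const: "graph_normal e g (x + t *\<^sub>R e) = graph_normal e g x"
  by (simp add: graph_normal_def chart_gradient_const)

context
  assumes open_\<Omega>: "open \<Omega>"
begin

lemma chart_not_mem_closure:
  assumes "x \<in> ball x0 r" "x \<bullet> e < \<gamma> x"
  shows "x \<notin> closure \<Omega>"
proof -
  have "open {x. x \<bullet> e < \<gamma> x}"
    by (intro open_Collect_less continuous_intros C1_gradient_continuous(1)[OF chart_gradient])
  then have "open (ball x0 r \<inter> {x. x \<bullet> e < \<gamma> x})" by auto
  moreover have "ball x0 r \<inter> {x. x \<bullet> e < \<gamma> x} \<inter> \<Omega> = {}"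
    using chart_mem by force
  ultimately show ?thesis
    using assms open_Int_closure_eq_empty by blast
qed

text \<open>A point below the graph has a neighbourhood that misses \<open>\<Omega>\<close>, while a
  point on the graph is the limit of the points \<open>x + t *\<^sub>R e\<close> above it.\<close>

lemma chart_frontier:
  assumes "x \<in> ball x0 r"
  shows "x \<in> frontier \<Omega> \<longleftrightarrow> \<gamma> x = x \<bullet> e"
proof
  assume "x \<in> frontier \<Omega>"
  then have "x \<in> closure \<Omega>" "x \<notin> \<Omega>" using open_\<Omega> by (auto simp: frontier_def interior_open)
  then show "\<gamma> x = x \<bullet> e"
    using chart_not_mem_closure[OF assms] chart_mem[OF assms] by force
next
  assume eq: "\<gamma> x = x \<bullet> e"
  then have "x \<notin> \<Omega>" using chart_mem[OF assms] by simp
  moreover have "x \<in> closure \<Omega>"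
    unfolding closure_approachable
  proof (intro allI impI)
    fix d :: real assume "0 < d"
    obtain d' where d': "0 < d'" "ball x d' \<subseteq> ball x0 r"
      using assms open_ball openE by blast
    define t where "t = min d d' / 2"
    have t: "0 < t" "t < d" "t < d'" using \<open>0 < d\<close> d'(1) by (auto simp: t_def)
    have "dist x (x + t *\<^sub>R e) = t"
      using t orthonormal_basis_norm[OF chart_basis] by (simp add: dist_norm)
    then have "x + t *\<^sub>R e \<in> ball x d'" "dist (x + t *\<^sub>R e) x < d"
      using t by (auto simp: dist_commute)
    moreover from this have "x + t *\<^sub>R e \<in> ball x0 r" using d'(2) by blast
    ultimately have "x + t *\<^sub>R e \<in> ball x0 r" "dist (x + t *\<^sub>R e) x < d" by simp_all
    then show "\<exists>y\<in>\<Omega>. dist y x < d"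
      using t eq orthonormal_basis_norm[OF chart_basis]
      by (intro bexI[of _ "x + t *\<^sub>R e"]) (auto simp: chart_mem chart_const inner_add_left)
  qed
  ultimately show "x \<in> frontier \<Omega>" using open_\<Omega> by (auto simp: frontier_def interior_open)
qed

lemma eventually_chart_ball:
  assumes "x \<in> ball x0 r" "(c \<longlongrightarrow> x) F"
  shows "\<forall>\<^sub>F t in F. c t \<in> ball x0 r"
  using topological_tendstoD[OF assms(2) open_ball assms(1)] .

text \<open>\<open>\<gamma> x - x \<bullet> e\<close> vanishes on the frontier and has a positive
  derivative in the direction of the normal, so its sign separates the two sides.\<close>

lemma eventually_chart_side:
  assumes x: "x \<in> ball x0 r" "\<gamma> x = x \<bullet> e"
  shows "\<forall>\<^sub>F t in at_right 0. x + t *\<^sub>R graph_normal e g x \<notin> closure \<Omega>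
    \<and> x - t *\<^sub>R graph_normal e g x \<in> \<Omega>"
proof -
  let ?n = "graph_normal e g x"
  have pos: "0 < (g x - e) \<bullet> ?n"
  proof -
    have "1 = ?n \<bullet> ?n" using norm_graph_normal[of x] by (simp add: norm_eq_1)
    then have "sqrt (1 + (norm (g x))\<^sup>2) = (g x - e) \<bullet> ?n"
      using graph_normal_inner[of x ?n] by simp
    moreover have "sqrt (1 + (norm (g x))\<^sup>2) > 0" by (simp add: add_pos_nonneg)
    ultimately show ?thesis by simp
  qed
  let ?u = "\<lambda>t. \<gamma> (x + t *\<^sub>R ?n) - (x + t *\<^sub>R ?n) \<bullet> e"
  have D: "(?u has_real_derivative (g x - e) \<bullet> ?n) (at 0)"
  proof -
    have "((\<lambda>t. \<gamma> (x + t *\<^sub>R ?n) - (x \<bullet> e + t * (?n \<bullet> e))) has_real_derivative g x \<bullet> ?n - ?n \<bullet> e) (at 0)"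
      using C1_gradient_line_derivative[OF chart_gradient, of x ?n 0]
      by (auto intro!: derivative_eq_intros)
    then show ?thesis by (simp add: inner_add_left inner_add_right inner_diff_left inner_commute)
  qed
  obtain d1 where d1: "0 < d1" "\<And>h. 0 < h \<Longrightarrow> h < d1 \<Longrightarrow> ?u 0 < ?u (0 + h)"
    using DERIV_pos_inc_right[OF D pos] by blast
  obtain d2 where d2: "0 < d2" "\<And>h. 0 < h \<Longrightarrow> h < d2 \<Longrightarrow> ?u (0 - h) < ?u 0"
    using DERIV_pos_inc_left[OF D pos] by blast
  have "((\<lambda>t. x + t *\<^sub>R ?n) \<longlongrightarrow> x + 0 *\<^sub>R ?n) (at_right 0)"
    by (intro tendsto_intros)
  then have b1: "\<forall>\<^sub>F t in at_right 0. x + t *\<^sub>R ?n \<in> ball x0 r"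
    using x by (intro eventually_chart_ball) simp_all
  have "((\<lambda>t. x - t *\<^sub>R ?n) \<longlongrightarrow> x - 0 *\<^sub>R ?n) (at_right 0)"
    by (intro tendsto_intros)
  then have b2: "\<forall>\<^sub>F t in at_right 0. x - t *\<^sub>R ?n \<in> ball x0 r"
    using x by (intro eventually_chart_ball) simp_all
  have "\<forall>\<^sub>F t in at_right (0::real). 0 < t \<and> t < min d1 d2"
    using d1(1) d2(1) by (auto simp: eventually_at_right_field intro!: exI[of _ "min d1 d2"])
  with b1 b2 show ?thesis
  proof eventually_elim
    case (elim t)
    have "0 < ?u t" using d1(2)[of t] elim x by simp
    moreover have "?u (- t) < 0" using d2(2)[of t] elim x by simp
    ultimately show ?case
      using chart_not_mem_closure[OF elim(1)] chart_mem[OF elim(2)] by simp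
  qed
qed

text \<open>A curve in the frontier keeps \<open>\<gamma> x - x \<bullet> e\<close> at zero near
  time \<open>0\<close>; differentiate this identity.\<close>

lemma chart_tangent_vector:
  assumes x: "x \<in> ball x0 r" "\<gamma> x = x \<bullet> e" and v: "v \<in> tangent_vectors (frontier \<Omega>) x"
  shows "g x \<bullet> v = v \<bullet> e"
proof -
  obtain c where c: "c 0 = x" "\<forall>\<^sub>F t in nhds 0. c t \<in> frontier \<Omega>"
    "(c has_vector_derivative v) (at (0::real))"
    using v by (auto simp: tangent_vectors_def)
  have "isCont c 0" using c(3) has_vector_derivative_continuous by blast
  then have "\<forall>\<^sub>F t in nhds 0. c t \<in> ball x0 r"
    using eventually_chart_ball[OF x(1), of c "nhds 0"] c(1) by (simp add: tendsto_nhds_iff isCont_def)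
  with c(2) have ev: "\<forall>\<^sub>F t in nhds 0. \<gamma> (c t) - c t \<bullet> e = 0"
    by eventually_elim (simp add: chart_frontier)
  have "((\<lambda>t. \<gamma> (c t) - c t \<bullet> e) has_derivative (\<lambda>h. (h *\<^sub>R v) \<bullet> g (c 0) - (h *\<^sub>R v) \<bullet> e)) (at 0)"
    using c(3) unfolding has_vector_derivative_def
    by (intro has_derivative_diff has_derivative_compose[OF _ C1_gradient_has_derivative[OF chart_gradient]]
        has_derivative_inner_left)
  moreover have "((\<lambda>t. \<gamma> (c t) - c t \<bullet> e) has_derivative (\<lambda>h. 0)) (at 0)"
  proof -
    obtain S where S: "open S" "0 \<in> S" "\<And>t. t \<in> S \<Longrightarrow> \<gamma> (c t) - c t \<bullet> e = 0"
      using ev unfolding eventually_nhds by blast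
    show ?thesis
      by (rule has_derivative_transform_within_open[OF has_derivative_const S(1,2)]) (simp add: S(3))
  qed
  ultimately have "(\<lambda>h. (h *\<^sub>R v) \<bullet> g (c 0) - (h *\<^sub>R v) \<bullet> e) = (\<lambda>h. 0)"
    by (rule has_derivative_unique)
  from fun_cong[OF this, of 1] show ?thesis by (simp add: c(1) inner_commute)
qed

text \<open>The line through \<open>x\<close> with horizontal direction \<open>w\<close>, lifted to
  the graph, is a curve in the frontier with this velocity.\<close>

lemma graph_tangent_vector:
  assumes x: "x \<in> ball x0 r" "\<gamma> x = x \<bullet> e" and w: "w \<bullet> e = 0"
  shows "w + (g x \<bullet> w) *\<^sub>R e \<in> tangent_vectors (frontier \<Omega>) x"
proof -
  let ?c = "\<lambda>t. x + t *\<^sub>R w + (\<gamma> (x + t *\<^sub>R w) - \<gamma> x) *\<^sub>R e"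
  have ct: "continuous_on UNIV ?c"
    by (intro continuous_intros continuous_on_compose2[OF C1_gradient_continuous(1)[OF chart_gradient, of UNIV]])
      auto
  then have "(?c \<longlongrightarrow> ?c 0) (nhds 0)"
    by (auto simp: continuous_on_eq_continuous_at isCont_def tendsto_nhds_iff dest: spec[of _ 0])
  then have "\<forall>\<^sub>F t in nhds 0. ?c t \<in> ball x0 r"
    using eventually_chart_ball[OF x(1), of ?c "nhds 0"] by simp
  then have "\<forall>\<^sub>F t in nhds 0. ?c t \<in> frontier \<Omega>"
  proof eventually_elim
    case (elim t)
    then show ?case
      using x w orthonormal_basis_norm[OF chart_basis]
      by (simp only: chart_frontier chart_const) (simp add: inner_add_left)
  qed
  moreover have "(?c has_vector_derivative w + (g x \<bullet> w) *\<^sub>R e) (at 0)"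
    using C1_gradient_line_derivative[OF chart_gradient, of x w 0]
    by (auto intro!: derivative_eq_intros simp: has_real_derivative_iff_has_vector_derivative[symmetric])
  moreover have "?c 0 = x" by simp
  ultimately show ?thesis
    unfolding tangent_vectors_def mem_Collect_eq by - (intro exI[of _ ?c] conjI)
qed

lemma graph_normal_outward:
  assumes x: "x \<in> ball x0 r" "\<gamma> x = x \<bullet> e"
  shows "is_outward_unit_normal \<Omega> x (graph_normal e g x)"
  unfolding is_outward_unit_normal_def
proof (intro conjI ballI)
  show "norm (graph_normal e g x) = 1" by (rule norm_graph_normal)
  show "graph_normal e g x \<bullet> v = 0" if "v \<in> tangent_vectors (frontier \<Omega>) x" for v
    using chart_tangent_vector[OF x that] by (simp add: graph_normal_def inner_diff_left inner_diff_right inner_commute)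
  show "\<forall>\<^sub>F t in at_right 0. x + t *\<^sub>R graph_normal e g x \<notin> closure \<Omega> \<and> x - t *\<^sub>R graph_normal e g x \<in> \<Omega>"
    by (rule eventually_chart_side[OF x])
qed

text \<open>Orthogonality to the lifted tangent vectors fixes the line spanned by \<open>n\<close>,
  unit length fixes \<open>n\<close> up to sign, and the side condition fixes the sign.\<close>

lemma outward_unit_normal_unique:
  assumes x: "x \<in> ball x0 r" "\<gamma> x = x \<bullet> e" and n: "is_outward_unit_normal \<Omega> x n"
  shows "n = graph_normal e g x"
proof -
  let ?N = "graph_normal e g x"
  define k where "k = n \<bullet> e"
  have ee: "e \<bullet> e = 1" by (rule orthonormal_basis_norm[OF chart_basis])
  \<comment> \<open>If \<open>n\<close> is a multiple of \<open>g x - e\<close>, comparing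
    components along \<open>e\<close> forces the factor \<open>- k\<close>; \<open>w\<close> is the
    deviation from this multiple. Testing \<open>n\<close> against the tangent vector lifted from
    \<open>w\<close> itself yields \<open>w \<bullet> w = 0\<close>.\<close>
  define w where "w = n - k *\<^sub>R e + k *\<^sub>R g x"
  have we: "w \<bullet> e = 0" by (simp add: w_def k_def inner_add_left inner_diff_left ee chart_gradient_orthogonal)
  have "n \<bullet> (w + (g x \<bullet> w) *\<^sub>R e) = 0"
    using n graph_tangent_vector[OF x we] by (auto simp: is_outward_unit_normal_def)
  then have "n \<bullet> w + k * (g x \<bullet> w) = 0" by (simp add: inner_add_right k_def mult.commute)
  moreover have "w \<bullet> w = n \<bullet> w + k * (g x \<bullet> w) - k * (e \<bullet> w)"
    by (subst (1) w_def) (simp add: inner_add_left inner_diff_left)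
  ultimately have "w = 0" using we by (simp add: inner_commute)
  then have "n = - k *\<^sub>R (g x - e)" by (simp add: w_def algebra_simps eq_neg_iff_add_eq_0)
  moreover have "g x - e = sqrt (1 + (norm (g x))\<^sup>2) *\<^sub>R ?N"
    using add_pos_nonneg[of 1 "(norm (g x))\<^sup>2"] by (simp add: graph_normal_def)
  ultimately obtain c where c: "n = c *\<^sub>R ?N" by (metis scaleR_scaleR)
  have "\<bar>c\<bar> = 1" using n norm_graph_normal[of x] by (simp add: is_outward_unit_normal_def c)
  moreover have "c \<noteq> -1"
  proof
    assume "c = -1"
    then have "\<forall>\<^sub>F t in at_right 0. x - t *\<^sub>R ?N \<notin> closure \<Omega> \<and> x + t *\<^sub>R ?N \<in> \<Omega>"
      using n by (simp add: is_outward_unit_normal_def c)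
    with eventually_chart_side[OF x] have "\<forall>\<^sub>F t in at_right (0::real). False"
      by eventually_elim (use closure_subset in blast)
    then show False by simp
  qed
  ultimately show ?thesis using c by (auto simp: abs_if split: if_splits)
qed

lemma outward_normal_eq:
  assumes "x \<in> ball x0 r" "\<gamma> x = x \<bullet> e"
  shows "outward_normal \<Omega> x = graph_normal e g x"
  unfolding outward_normal_def
  using graph_normal_outward[OF assms] outward_unit_normal_unique[OF assms] by (rule the_equality)

end

end

section \<open>Test functions\<close>

definition C1_fun :: "('a::euclidean_space \<Rightarrow> real) \<Rightarrow> bool" where
  "C1_fun \<phi> \<longleftrightarrow> (\<exists>G. C1_gradient \<phi> G)"

lemma C1_fun_measurable [measurable_dest]: "C1_fun \<phi> \<Longrightarrow> \<phi> \<in> borel_measurable borel"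
  using C1_gradient_measurable by (auto simp: C1_fun_def)

lemma C1_fun_const: "C1_fun (\<lambda>x. c)"
  by (auto simp: C1_fun_def C1_gradient_def intro!: exI[of _ "\<lambda>x. 0"] GDERIV_const)

lemma C1_gradient_add:
  "C1_gradient \<phi> G \<Longrightarrow> C1_gradient \<psi> H \<Longrightarrow> C1_gradient (\<lambda>x. \<phi> x + \<psi> x) (\<lambda>x. G x + H x)"
  by (auto simp: C1_gradient_def intro: GDERIV_add continuous_on_add)

lemma C1_gradient_mult:
  assumes "C1_gradient \<phi> G" "C1_gradient \<psi> H"
  shows "C1_gradient (\<lambda>x. \<phi> x * \<psi> x) (\<lambda>x. \<phi> x *\<^sub>R H x + \<psi> x *\<^sub>R G x)"
  using assms C1_gradient_continuous[OF assms(1), of UNIV] C1_gradient_continuous[OF assms(2), of UNIV]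
  by (auto simp: C1_gradient_def intro: GDERIV_mult intro!: continuous_intros)

lemma C1_gradient_sum:
  assumes "\<And>i. i \<in> I \<Longrightarrow> C1_gradient (\<phi> i) (G i)"
  shows "C1_gradient (\<lambda>x. \<Sum>i\<in>I. \<phi> i x) (\<lambda>x. \<Sum>i\<in>I. G i x)"
  using assms
proof (induction I rule: infinite_finite_induct)
  case (insert i I)
  then show ?case by (simp add: C1_gradient_add)
qed (auto simp: C1_gradient_def GDERIV_const)

lemma C1_fun_add: "C1_fun \<phi> \<Longrightarrow> C1_fun \<psi> \<Longrightarrow> C1_fun (\<lambda>x. \<phi> x + \<psi> x)"
  using C1_gradient_add by (fastforce simp: C1_fun_def)

lemma C1_fun_mult: "C1_fun \<phi> \<Longrightarrow> C1_fun \<psi> \<Longrightarrow> C1_fun (\<lambda>x. \<phi> x * \<psi> x)"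
  using C1_gradient_mult by (fastforce simp: C1_fun_def)

lemma C1_fun_diff: "C1_fun \<phi> \<Longrightarrow> C1_fun \<psi> \<Longrightarrow> C1_fun (\<lambda>x. \<phi> x - \<psi> x)"
  using C1_fun_add[of \<phi> "\<lambda>x. (-1) * \<psi> x"] C1_fun_mult[OF C1_fun_const[of "-1"], of \<psi>] by simp

lemma C1_fun_sum:
  assumes "\<And>i. i \<in> I \<Longrightarrow> C1_fun (\<phi> i)"
  shows "C1_fun (\<lambda>x. \<Sum>i\<in>I. \<phi> i x)"
  using assms
  by (induction I rule: infinite_finite_induct) (simp_all add: C1_fun_const C1_fun_add)

lemma C1_fun_prod:
  assumes "\<And>i. i \<in> I \<Longrightarrow> C1_fun (\<phi> i)"
  shows "C1_fun (\<lambda>x. \<Prod>i\<in>I. \<phi> i x)"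
  using assms
  by (induction I rule: infinite_finite_induct) (simp_all add: C1_fun_const C1_fun_mult)

lemma C1_fun_inner: "C1_fun (\<lambda>x. x \<bullet> b)"
  by (auto simp: C1_fun_def C1_gradient_def gderiv_def intro!: exI[of _ "\<lambda>x. b"] derivative_eq_intros)

lemma C1_fun_compose:
  assumes "C1_fun \<phi>" and f: "\<And>t. (f has_real_derivative f' t) (at t)" and f': "continuous_on UNIV f'"
  shows "C1_fun (\<lambda>x. f (\<phi> x))"
proof -
  obtain G where G: "C1_gradient \<phi> G" using assms(1) by (auto simp: C1_fun_def)
  have "continuous_on UNIV (\<lambda>x. f' (\<phi> x) *\<^sub>R G x)"
    using C1_gradient_continuous[OF G, of UNIV]
    by (intro continuous_intros continuous_on_compose2[OF f']) auto
  moreover have "GDERIV (\<lambda>x. f (\<phi> x)) x :> f' (\<phi> x) *\<^sub>R G x" for x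
    using G f by (intro GDERIV_DERIV_compose) (auto simp: C1_gradient_def)
  ultimately show ?thesis
    unfolding C1_fun_def C1_gradient_def by (intro exI[of _ "\<lambda>x. f' (\<phi> x) *\<^sub>R G x"]) simp
qed

lemma C1_fun_inverse:
  assumes "C1_fun \<phi>" and nz: "\<And>x. \<phi> x \<noteq> 0"
  shows "C1_fun (\<lambda>x. inverse (\<phi> x))"
proof -
  obtain G where G: "C1_gradient \<phi> G" using assms(1) by (auto simp: C1_fun_def)
  have "continuous_on UNIV (\<lambda>x. - (inverse (\<phi> x))\<^sup>2 *\<^sub>R G x)"
    using C1_gradient_continuous[OF G, of UNIV] nz by (intro continuous_intros) auto
  moreover have "GDERIV (\<lambda>x. inverse (\<phi> x)) x :> - (inverse (\<phi> x))\<^sup>2 *\<^sub>R G x" for x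
    using G nz by (intro GDERIV_inverse) (auto simp: C1_gradient_def)
  ultimately show ?thesis
    unfolding C1_fun_def C1_gradient_def by (intro exI[of _ "\<lambda>x. - (inverse (\<phi> x))\<^sup>2 *\<^sub>R G x"]) simp
qed

text \<open>Squaring removes the kink of \<open>max 0 t\<close> at \<open>0\<close>. All cutoff
  functions below are built from this one.\<close>

lemma square_pos_part_derivative:
  "((\<lambda>t::real. (max 0 t)\<^sup>2) has_real_derivative 2 * max 0 t) (at t)"
proof -
  consider "0 < t" | "t < 0" | "t = 0" by linarith
  then show ?thesis
  proof cases
    case 1
    have "((\<lambda>t::real. t\<^sup>2) has_real_derivative 2 * max 0 t) (at t)"
      using 1 by (auto intro!: derivative_eq_intros)
    then show ?thesis
      by (rule has_field_derivative_transform_within_open[of _ _ _ "{0<..}"]) (use 1 in auto)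
  next
    case 2
    have "((\<lambda>t::real. 0) has_real_derivative 2 * max 0 t) (at t)"
      using 2 by (auto intro!: derivative_eq_intros)
    then show ?thesis
      by (rule has_field_derivative_transform_within_open[of _ _ _ "{..<0}"]) (use 2 in auto)
  next
    case 3
    have "(\<lambda>h::real. (max 0 h)\<^sup>2 / h) \<midarrow>0\<rightarrow> 0"
    proof (rule Lim_null_comparison)
      show "\<forall>\<^sub>F h in at 0. norm ((max 0 h)\<^sup>2 / h) \<le> \<bar>h::real\<bar>"
        by (intro always_eventually allI) (auto simp: max_def power2_eq_square)
      show "(\<lambda>h::real. \<bar>h\<bar>) \<midarrow>0\<rightarrow> 0" by (intro tendsto_rabs_zero tendsto_ident_at)
    qed
    then show ?thesis using 3 by (simp add: DERIV_def)
  qed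
qed

lemma C1_fun_square_pos_part: "C1_fun \<phi> \<Longrightarrow> C1_fun (\<lambda>x. (max 0 (\<phi> x))\<^sup>2)"
  by (rule C1_fun_compose[OF _ square_pos_part_derivative]) (auto intro!: continuous_intros)

text \<open>The squared distance keeps the function differentiable at the centre, and the outer
  square does so on the sphere.\<close>

definition bump :: "'a::euclidean_space \<Rightarrow> real \<Rightarrow> 'a \<Rightarrow> real" where
  "bump z R x = (max 0 (R\<^sup>2 - (norm (x - z))\<^sup>2))\<^sup>2"

lemma C1_fun_bump: "C1_fun (bump z R)"
proof -
  have "C1_fun (\<lambda>x. (norm (x - z))\<^sup>2)"
    unfolding C1_fun_def C1_gradient_def gderiv_def power2_norm_eq_inner
    by (intro exI[of _ "\<lambda>x. 2 *\<^sub>R (x - z)"] conjI allI)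
      (auto intro!: derivative_eq_intros continuous_intros simp: inner_commute algebra_simps)
  then have "C1_fun (\<lambda>x. (max 0 (R\<^sup>2 - (norm (x - z))\<^sup>2))\<^sup>2)"
    by (intro C1_fun_square_pos_part C1_fun_diff C1_fun_const)
  then show ?thesis by (simp add: bump_def[abs_def])
qed

lemma bump_nonneg: "0 \<le> bump z R x" by (simp add: bump_def)

lemma bump_pos_iff: "0 < R \<Longrightarrow> 0 < bump z R x \<longleftrightarrow> x \<in> ball z R"
  using power_strict_mono[of "norm (x - z)" R 2] power_mono[of R "norm (x - z)" 2]
  by (cases "norm (x - z) < R") (auto simp: bump_def dist_norm norm_minus_commute max_def)

lemma bump_eq_0: "0 < R \<Longrightarrow> x \<notin> ball z R \<Longrightarrow> bump z R x = 0"
  using bump_pos_iff bump_nonneg by (metis less_eq_real_def)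

text \<open>Open boxes form a generator stable under intersection, and their indicators are
  pointwise limits of C1 functions with values between \<open>0\<close> and
  \<open>1\<close>.\<close>

lemma finite_measure_eq_C1:
  fixes M N :: "'a::euclidean_space measure"
  assumes "finite_measure M" "finite_measure N" and sets: "sets M = sets borel" "sets N = sets borel"
    and eq: "\<And>\<phi>. C1_fun \<phi> \<Longrightarrow> (\<And>x. 0 \<le> \<phi> x \<and> \<phi> x \<le> 1) \<Longrightarrow> (\<integral>x. \<phi> x \<partial>M) = (\<integral>x. \<phi> x \<partial>N)"
  shows "M = N"
proof (rule measure_eqI_generator_eq)
  interpret M: finite_measure M by fact
  interpret N: finite_measure N by fact
  let ?E = "range (\<lambda>(a, b). box a b::'a set)"
  show "Int_stable ?E"
    by (auto simp: Int_stable_def box_Int_box)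
  show "?E \<subseteq> Pow UNIV" "sets M = sigma_sets UNIV ?E" "sets N = sigma_sets UNIV ?E"
    by (simp_all add: borel_eq_box sets)
  let ?A = "\<lambda>n::nat. box (- (real n *\<^sub>R One)) (real n *\<^sub>R One) :: 'a set"
  show "range ?A \<subseteq> ?E" "(\<Union>i. ?A i) = UNIV"
    unfolding UN_box_eq_UNIV by auto
  show "emeasure M (?A i) \<noteq> \<infinity>" for i using M.emeasure_finite by simp
  fix X assume "X \<in> ?E"
  then obtain a b where X: "X = box a b" by auto
  \<comment> \<open>\<open>f\<close> is positive exactly on the open box: each factor vanishes
    beyond one of its faces.\<close>
  define f where "f x = (\<Prod>i\<in>Basis. (max 0 (x \<bullet> i - a \<bullet> i))\<^sup>2 * (max 0 (b \<bullet> i - x \<bullet> i))\<^sup>2)" for x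
  have C1f: "C1_fun f"
    unfolding f_def
    by (intro C1_fun_prod C1_fun_mult C1_fun_square_pos_part C1_fun_diff C1_fun_inner C1_fun_const)
  have f0: "0 \<le> f x" for x unfolding f_def by (intro prod_nonneg) simp
  have fpos: "f x \<noteq> 0 \<longleftrightarrow> x \<in> X" for x
    by (auto simp: f_def X mem_box max_def not_le)
  \<comment> \<open>These quotients tend to \<open>1\<close> where \<open>f\<close> is positive and
    are \<open>0\<close> elsewhere; the added constant keeps the denominator positive, so they stay
    C1.\<close>
  define \<phi> where "\<phi> k x = f x * inverse (f x + inverse (real (Suc k)))" for k x
  have den: "0 < f x + inverse (real (Suc k))" for x k using f0[of x] by (simp add: add_nonneg_pos)
  have C1\<phi>: "C1_fun (\<phi> k)" for k
    unfolding \<phi>_def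
    using less_imp_neq[OF den] by (intro C1_fun_mult C1_fun_inverse C1_fun_add C1f C1_fun_const) metis
  have \<phi>01: "0 \<le> \<phi> k x \<and> \<phi> k x \<le> 1" for k x
    using f0[of x] den[of x k] by (simp add: \<phi>_def field_simps)
  have lim: "(\<lambda>k. \<integral>x. \<phi> k x \<partial>L) \<longlonglongrightarrow> measure L X"
    if "finite_measure L" and L: "sets L = sets borel" for L
  proof -
    interpret L: finite_measure L by fact
    have "(\<lambda>k. \<integral>x. \<phi> k x \<partial>L) \<longlonglongrightarrow> (\<integral>x. indicator X x \<partial>L)"
    proof (rule integral_dominated_convergence[where w = "\<lambda>x. 1"])
      show "AE x in L. (\<lambda>k. \<phi> k x) \<longlonglongrightarrow> indicator X x"
      proof (intro AE_I2)
        fix x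
        show "(\<lambda>k. \<phi> k x) \<longlonglongrightarrow> indicator X x"
        proof (cases "f x = 0")
          case True
          then show ?thesis using fpos[of x] by (simp add: \<phi>_def)
        next
          case False
          have "(\<lambda>k. f x * inverse (f x + inverse (real (Suc k)))) \<longlonglongrightarrow> f x * inverse (f x + 0)"
            by (intro tendsto_intros LIMSEQ_inverse_real_of_nat) (simp add: False)
          then show ?thesis using fpos[of x] False by (simp add: \<phi>_def)
        qed
      qed
      show "AE x in L. norm (\<phi> k x) \<le> 1" for k using \<phi>01 by simp
      show "\<phi> k \<in> borel_measurable L" for k
        using C1_fun_measurable[OF C1\<phi>] by (simp add: measurable_cong_sets[OF L refl])
      show "indicat_real X \<in> borel_measurable L"
        by (intro borel_measurable_indicator) (simp add: L X)
    qed simp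
    then show ?thesis by (simp add: L X)
  qed
  have "(\<integral>x. \<phi> k x \<partial>M) = (\<integral>x. \<phi> k x \<partial>N)" for k
    by (rule eq[OF C1\<phi> \<phi>01])
  then have "measure M X = measure N X"
    using lim[OF assms(1) sets(1)] lim[OF assms(2) sets(2)] LIMSEQ_unique by simp
  then show "emeasure M X = emeasure N X"
    by (simp add: M.emeasure_eq_measure N.emeasure_eq_measure)
qed

section \<open>The surface measure\<close>

text \<open>This is the surface measure of the whole graph of \<open>\<gamma>\<close>. Outside the
  chart ball the graph need not belong to the frontier, so comparisons are confined to sets inside
  the ball.\<close>

definition graph_measure ::
    "'a::euclidean_space set \<Rightarrow> 'a \<Rightarrow> ('a \<Rightarrow> real) \<Rightarrow> ('a \<Rightarrow> 'a) \<Rightarrow> 'a measure" where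
  "graph_measure B e \<gamma> g =
     distr (density (hyperplane_lborel B e) (\<lambda>y. ennreal (sqrt (1 + (norm (g y))\<^sup>2)))) borel
       (\<lambda>y. y + \<gamma> y *\<^sub>R e)"

lemma sets_graph_measure [simp, measurable_cong]: "sets (graph_measure B e \<gamma> g) = sets borel"
  by (simp add: graph_measure_def)

lemma space_graph_measure [simp]: "space (graph_measure B e \<gamma> g) = UNIV"
  by (simp add: graph_measure_def)

text \<open>Outside the closed ball \<open>\<phi>\<close> is locally zero; on the sphere the claim
  follows from the continuity of \<open>G\<close>.\<close>

lemma C1_gradient_eq_0:
  assumes \<phi>: "C1_gradient \<phi> G" and supp: "\<And>x. x \<notin> ball z R \<Longrightarrow> \<phi> x = 0" and x: "x \<notin> ball z R"
  shows "G x = 0"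
proof -
  have "G y = 0" if "y \<notin> cball z R" for y
  proof -
    have "((\<lambda>x. 0) has_derivative (\<lambda>h. 0)) (at y)" by simp
    then have "(\<phi> has_derivative (\<lambda>h. 0)) (at y)"
      by (rule has_derivative_transform_within_open[of _ _ _ _ "- cball z R"]) (use that supp in auto)
    then have "(\<lambda>h. h \<bullet> G y) = (\<lambda>h. 0)"
      using has_derivative_unique C1_gradient_has_derivative[OF \<phi>] by blast
    then show ?thesis by (metis inner_eq_zero_iff)
  qed
  then have "- cball z R \<subseteq> {x. G x = 0}" by auto
  moreover have "closed {x. G x = 0}"
    using \<phi> unfolding C1_gradient_def by (intro closed_Collect_eq) auto
  ultimately have "closure (- cball z R) \<subseteq> {x. G x = 0}" by (rule closure_minimal)
  then show ?thesis using x by (auto simp: closure_complement)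
qed

context
  fixes \<Omega> :: "'a::euclidean_space set" and x0 r B e \<gamma> g
  assumes chart: "C1_graph_chart \<Omega> x0 r B e \<gamma> g"
begin

lemma chart_measurable:
  "\<gamma> \<in> borel_measurable borel" "g \<in> borel_measurable borel"
  using C1_gradient_measurable[OF chart_gradient[OF chart]] by auto

lemma nn_integral_graph_measure:
  assumes [measurable]: "f \<in> borel_measurable borel"
  shows "(\<integral>\<^sup>+x. f x \<partial>graph_measure B e \<gamma> g)
    = (\<integral>\<^sup>+y. ennreal (sqrt (1 + (norm (g y))\<^sup>2)) * f (y + \<gamma> y *\<^sub>R e) \<partial>hyperplane_lborel B e)"
  supply [measurable] = chart_measurable
  unfolding graph_measure_def by (subst nn_integral_distr, simp, simp, subst nn_integral_density) simp_all

lemma emeasure_graph_measure: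
  assumes "A \<in> sets borel"
  shows "emeasure (graph_measure B e \<gamma> g) A
    = (\<integral>\<^sup>+y. ennreal (sqrt (1 + (norm (g y))\<^sup>2)) * indicator A (y + \<gamma> y *\<^sub>R e) \<partial>hyperplane_lborel B e)"
  using nn_integral_graph_measure[of "indicator A"] assms by simp

lemma integral_graph_measure:
  fixes f :: "'a \<Rightarrow> real"
  assumes [measurable]: "f \<in> borel_measurable borel"
  shows "(\<integral>x. f x \<partial>graph_measure B e \<gamma> g)
    = (\<integral>y. sqrt (1 + (norm (g y))\<^sup>2) * f (y + \<gamma> y *\<^sub>R e) \<partial>hyperplane_lborel B e)"
  supply [measurable] = chart_measurable
  unfolding graph_measure_def by (subst integral_distr, simp, simp, subst integral_density) simp_all

lemma AE_graph_measure: "AE x in graph_measure B e \<gamma> g. \<gamma> x = x \<bullet> e"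
proof -
  note [measurable] = chart_measurable
  have "AE y in hyperplane_lborel B e. \<gamma> (y + \<gamma> y *\<^sub>R e) = (y + \<gamma> y *\<^sub>R e) \<bullet> e"
    using AE_hyperplane_lborel[OF chart_basis[OF chart]]
    by eventually_elim
      (simp add: chart_const[OF chart] inner_add_left orthonormal_basis_norm[OF chart_basis[OF chart]])
  then show ?thesis
    unfolding graph_measure_def
    by (subst AE_distr_iff) (auto simp: AE_density)
qed

text \<open>The part of the graph inside a ball projects to a bounded part of the hyperplane, over
  which the gradient and so the area element are bounded.\<close>

lemma emeasure_graph_measure_ball: "emeasure (graph_measure B e \<gamma> g) (ball z R) < \<infinity>"
proof -
  let ?H = "hyperplane_lborel B e"
  note ee = orthonormal_basis_norm[OF chart_basis[OF chart]]
  define C where "C = norm z + R"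
  have "bounded (g ` cball 0 C)"
    using compact_continuous_image[OF C1_gradient_continuous(2)[OF chart_gradient[OF chart]] compact_cball]
      compact_imp_bounded by blast
  then obtain L where L: "\<And>x. x \<in> cball 0 C \<Longrightarrow> norm (g x) \<le> L"
    unfolding bounded_iff by blast
  have "emeasure (graph_measure B e \<gamma> g) (ball z R)
      = (\<integral>\<^sup>+y. ennreal (sqrt (1 + (norm (g y))\<^sup>2)) * indicator (ball z R) (y + \<gamma> y *\<^sub>R e) \<partial>?H)"
    by (rule emeasure_graph_measure) simp
  also have "\<dots> \<le> (\<integral>\<^sup>+y. ennreal (sqrt (1 + L\<^sup>2)) * indicator (cball 0 C) y \<partial>?H)"
  proof (rule nn_integral_mono_AE)
    show "AE y in ?H. ennreal (sqrt (1 + (norm (g y))\<^sup>2)) * indicator (ball z R) (y + \<gamma> y *\<^sub>R e)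
        \<le> ennreal (sqrt (1 + L\<^sup>2)) * indicator (cball 0 C) y"
      using AE_hyperplane_lborel[OF chart_basis[OF chart]]
    proof eventually_elim
      case (elim y)
      show ?case
      proof (cases "y + \<gamma> y *\<^sub>R e \<in> ball z R")
        case True
        have "(norm y)\<^sup>2 \<le> (norm (y + \<gamma> y *\<^sub>R e))\<^sup>2"
          using elim ee by (simp add: power2_norm_eq_inner inner_add_left inner_add_right inner_commute)
        then have "norm y \<le> norm (y + \<gamma> y *\<^sub>R e)" by (simp add: power2_le_iff_abs_le)
        then have y: "y \<in> cball 0 C"
          using True norm_triangle_sub[of "y + \<gamma> y *\<^sub>R e" z] by (auto simp: C_def dist_norm norm_minus_commute)
        then have "(norm (g y))\<^sup>2 \<le> L\<^sup>2" using L by (intro power_mono) auto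
        then show ?thesis using y True by (auto intro!: ennreal_leI)
      qed simp
    qed
  qed
  also have "\<dots> = ennreal (sqrt (1 + L\<^sup>2)) * emeasure ?H (cball 0 C)"
    by (rule nn_integral_cmult_indicator) simp
  also have "\<dots> < \<infinity>"
    using emeasure_hyperplane_lborel_bounded[OF chart_basis[OF chart] bounded_cball, of 0 C]
    by (simp add: ennreal_mult_less_top)
  finally show ?thesis .
qed

text \<open>Inside the ball \<open>\<Omega>\<close> coincides with the epigraph, and outside it
  \<open>G\<close> vanishes, so the formula for the whole epigraph applies.\<close>

lemma chart_divergence:
  assumes \<phi>: "C1_gradient \<phi> G" and supp: "\<And>x. x \<notin> ball x0 r \<Longrightarrow> \<phi> x = 0"
  shows "(LBINT x. indicator \<Omega> x * (G x \<bullet> v))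
    = (\<integral>x. \<phi> x * (graph_normal e g x \<bullet> v) \<partial>graph_measure B e \<gamma> g)"
proof -
  note [measurable] = C1_gradient_measurable[OF \<phi>] graph_normal_measurable[OF chart] chart_measurable
  have "G x = 0" if "x \<notin> ball x0 r" for x
    using C1_gradient_eq_0[OF \<phi> supp that] .
  then have "indicator \<Omega> x * (G x \<bullet> v) = indicator {x. \<gamma> x < x \<bullet> e} x * (G x \<bullet> v)" for x
    using chart_mem[OF chart, of x]
    by (cases "x \<in> ball x0 r") (auto simp: indicator_def)
  then have "(LBINT x. indicator \<Omega> x * (G x \<bullet> v))
      = (LBINT x. indicator {x. \<gamma> x < x \<bullet> e} x * (G x \<bullet> v))" by (simp only:)
  also have "\<dots> = (\<integral>y. \<phi> (y + \<gamma> y *\<^sub>R e) * ((g y - e) \<bullet> v) \<partial>hyperplane_lborel B e)"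
    by (rule epigraph_divergence[OF chart_basis[OF chart] chart_const[OF chart] chart_gradient[OF chart] \<phi> supp])
  also have "\<dots> = (\<integral>y. sqrt (1 + (norm (g y))\<^sup>2) *
      (\<phi> (y + \<gamma> y *\<^sub>R e) * (graph_normal e g (y + \<gamma> y *\<^sub>R e) \<bullet> v)) \<partial>hyperplane_lborel B e)"
    by (intro Bochner_Integration.integral_cong refl)
      (simp add: graph_normal_const[OF chart] graph_normal_inner[OF chart, symmetric] mult_ac)
  also have "\<dots> = (\<integral>x. \<phi> x * (graph_normal e g x \<bullet> v) \<partial>graph_measure B e \<gamma> g)"
    by (rule integral_graph_measure[symmetric]) measurable
  finally show ?thesis .
qed

end

text \<open>
  The left-hand side of \<open>chart_divergence\<close> does not depend on the chart, and \<open>n \<bullet> (- e) > 0\<close> in the chart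
  with vertical direction \<open>e\<close>; this determines the measure on the overlap of two charts.
\<close>

lemma graph_measure_overlap:
  fixes \<Omega> :: "'a::euclidean_space set"
  assumes open_\<Omega>: "open \<Omega>"
    and c1: "C1_graph_chart \<Omega> x1 r1 B1 e1 \<gamma>1 g1" and c2: "C1_graph_chart \<Omega> x2 r2 B2 e2 \<gamma>2 g2"
    and A: "A \<in> sets borel" "A \<subseteq> ball x1 r1 \<inter> ball x2 r2"
  shows "emeasure (graph_measure B1 e1 \<gamma>1 g1) A = emeasure (graph_measure B2 e2 \<gamma>2 g2) A"
proof -
  note [measurable] = A(1) graph_normal_measurable[OF c1] graph_normal_measurable[OF c2]
    C1_fun_measurable[OF C1_fun_bump]
  have r: "0 < r1" "0 < r2" using c1 c2 by (simp_all add: C1_graph_chart_def)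
  \<comment> \<open>The weight restricts test functions to the overlap of the balls, where both
    charts describe the same piece of frontier.\<close>
  define w where "w x = bump x1 r1 x * bump x2 r2 x" for x
  have C1w: "C1_fun w" unfolding w_def by (intro C1_fun_mult C1_fun_bump)
  have [measurable]: "w \<in> borel_measurable borel" using C1w by (rule C1_fun_measurable)
  have w0: "0 \<le> w x" for x by (simp add: w_def bump_nonneg)
  have wpos: "0 < w x" if "x \<in> ball x1 r1 \<inter> ball x2 r2" for x
    using that bump_pos_iff[OF r(1), of x1 x] bump_pos_iff[OF r(2), of x2 x]
    unfolding w_def by (intro mult_pos_pos) auto
  have wz: "w x = 0" if "x \<notin> ball x1 r1 \<inter> ball x2 r2" for x
    using that bump_eq_0[OF r(1)] bump_eq_0[OF r(2)] by (auto simp: w_def)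
  obtain Gw where Gw: "C1_gradient w Gw" using C1w by (auto simp: C1_fun_def)
  obtain W where W: "0 \<le> W" "\<And>x. \<bar>w x\<bar> \<le> W"
    using C1_gradient_bounded_support[OF Gw, of x1 r1] wz by blast
  \<comment> \<open>The normal component along \<open>- e1\<close> is the reciprocal of the first
    area element: positive everywhere, so it can be divided out in the end.\<close>
  define \<kappa> where "\<kappa> x = graph_normal e1 g1 x \<bullet> (- e1)" for x
  have [measurable]: "\<kappa> \<in> borel_measurable borel" unfolding \<kappa>_def by measurable
  have \<kappa>: "0 < \<kappa> x" "\<kappa> x \<le> 1" for x
  proof -
    have "0 < sqrt (1 + (norm (g1 x))\<^sup>2)" by (simp add: add_pos_nonneg)
    moreover have "sqrt (1 + (norm (g1 x))\<^sup>2) * \<kappa> x = 1"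
      unfolding \<kappa>_def graph_normal_inner[OF c1]
      using chart_gradient_orthogonal[OF c1, of x] orthonormal_basis_norm[OF chart_basis[OF c1]]
      by (simp add: inner_diff_left)
    ultimately show "0 < \<kappa> x" by (metis zero_less_mult_pos zero_less_one)
    show "\<kappa> x \<le> 1"
      using Cauchy_Schwarz_ineq2[of "graph_normal e1 g1 x" "- e1"] norm_graph_normal[OF c1, of x]
        orthonormal_basis_norm[OF chart_basis[OF c1]]
      by (simp add: \<kappa>_def)
  qed
  let ?w = "\<lambda>x. ennreal (w x * \<kappa> x)"
  let ?S1 = "graph_measure B1 e1 \<gamma>1 g1" and ?S2 = "graph_measure B2 e2 \<gamma>2 g2"
  have finite: "finite_measure (density S ?w)"
    if [measurable_cong]: "sets S = sets borel" and "emeasure S (ball x1 r1) < \<infinity>" for S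
  proof
    have "emeasure (density S ?w) (space (density S ?w)) = (\<integral>\<^sup>+x. ?w x \<partial>S)"
    proof -
      have "?w \<in> borel_measurable borel" by measurable
      then have "?w \<in> borel_measurable S" by (simp add: measurable_cong_sets[OF that(1) refl])
      then show ?thesis using sets_eq_imp_space_eq[OF that(1)] by (subst emeasure_density) simp_all
    qed
    also have "\<dots> \<le> (\<integral>\<^sup>+x. ennreal W * indicator (ball x1 r1) x \<partial>S)"
    proof (intro nn_integral_mono)
      fix x
      have "w x * \<kappa> x \<le> W * 1" using W(2)[of x] w0[of x] \<kappa>[of x] by (intro mult_mono) (auto simp: abs_le_iff)
      then show "?w x \<le> ennreal W * indicator (ball x1 r1) x"
        using wz[of x] by (auto simp: indicator_def intro!: ennreal_leI)
    qed
    also have "\<dots> = ennreal W * emeasure S (ball x1 r1)"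
      by (rule nn_integral_cmult_indicator) (simp add: that)
    also have "\<dots> < \<infinity>" using that(2) by (simp add: ennreal_mult_less_top)
    finally show "emeasure (density S ?w) (space (density S ?w)) \<noteq> \<infinity>" by simp
  qed
  \<comment> \<open>Tested against \<open>\<phi>\<close>, both weighted measures give the flux of
    \<open>w * \<phi>\<close> in the direction \<open>- e1\<close>, which
    \<open>chart_divergence\<close> expresses as one volume integral.\<close>
  have eq: "density ?S1 ?w = density ?S2 ?w"
  proof (rule finite_measure_eq_C1)
    show "finite_measure (density ?S1 ?w)" "finite_measure (density ?S2 ?w)"
      using emeasure_graph_measure_ball[OF c1] emeasure_graph_measure_ball[OF c2] by (auto intro!: finite)
    fix \<phi> :: "'a \<Rightarrow> real" assume "C1_fun \<phi>"
    then have [measurable]: "\<phi> \<in> borel_measurable borel" by (rule C1_fun_measurable)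
    obtain G where G: "C1_gradient (\<lambda>x. w x * \<phi> x) G"
      using C1_fun_mult[OF C1w \<open>C1_fun \<phi>\<close>] by (auto simp: C1_fun_def)
    have dens: "(\<integral>x. \<phi> x \<partial>density S ?w) = (\<integral>x. (w x * \<phi> x) * \<kappa> x \<partial>S)"
      if [measurable_cong]: "sets S = sets borel" for S
      using w0 \<kappa> by (subst integral_density) (auto simp: mult_ac less_imp_le)
    have "(\<integral>x. (w x * \<phi> x) * \<kappa> x \<partial>?S1) = (LBINT x. indicator \<Omega> x * (G x \<bullet> (- e1)))"
      unfolding \<kappa>_def by (rule chart_divergence[OF c1 G, symmetric]) (simp add: wz)
    also have "\<dots> = (\<integral>x. (w x * \<phi> x) * (graph_normal e2 g2 x \<bullet> (- e1)) \<partial>?S2)"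
      by (rule chart_divergence[OF c2 G]) (simp add: wz)
    also have "\<dots> = (\<integral>x. (w x * \<phi> x) * \<kappa> x \<partial>?S2)"
    proof (rule integral_cong_AE)
      show "AE x in ?S2. (w x * \<phi> x) * (graph_normal e2 g2 x \<bullet> (- e1)) = (w x * \<phi> x) * \<kappa> x"
        using AE_graph_measure[OF c2]
      proof eventually_elim
        case (elim x)
        show ?case
        proof (cases "x \<in> ball x1 r1 \<inter> ball x2 r2")
          case True
          \<comment> \<open>The frontier is described by either chart, and there both graph normals
            are the outward normal, a notion free of charts.\<close>
          then have "\<gamma>1 x = x \<bullet> e1"
            using chart_frontier[OF c1 open_\<Omega>, of x] chart_frontier[OF c2 open_\<Omega>, of x] elim by blast
          then show ?thesis
            using True elim outward_normal_eq[OF c1 open_\<Omega>, of x] outward_normal_eq[OF c2 open_\<Omega>, of x]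
            by (simp add: \<kappa>_def)
        qed (simp add: wz)
      qed
    qed measurable
    finally show "(\<integral>x. \<phi> x \<partial>density ?S1 ?w) = (\<integral>x. \<phi> x \<partial>density ?S2 ?w)"
      by (simp add: dens)
  qed simp_all
  \<comment> \<open>The weight is strictly positive on \<open>A\<close>, so the unweighted measure
    of \<open>A\<close> is recovered by dividing by it.\<close>
  have "emeasure S A = (\<integral>\<^sup>+x. ennreal (inverse (w x * \<kappa> x)) * indicator A x \<partial>density S ?w)"
    if [measurable_cong]: "sets S = sets borel" for S
  proof -
    have "emeasure S A = (\<integral>\<^sup>+x. indicator A x \<partial>S)" by (simp add: that)
    also have "\<dots> = (\<integral>\<^sup>+x. ?w x * (ennreal (inverse (w x * \<kappa> x)) * indicator A x) \<partial>S)"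
    proof (intro nn_integral_cong)
      fix x
      have "ennreal (w x * \<kappa> x) * ennreal (inverse (w x * \<kappa> x)) = 1" if "x \<in> A"
      proof -
        have "0 < w x * \<kappa> x" using wpos subsetD[OF A(2) that] \<kappa>(1) by (intro mult_pos_pos)
        moreover have "ennreal c * ennreal (inverse c) = 1" if "0 < c" for c :: real
          using that by (simp add: ennreal_mult[symmetric])
        ultimately show ?thesis by blast
      qed
      then show "indicator A x = ?w x * (ennreal (inverse (w x * \<kappa> x)) * indicator A x)"
        by (auto simp: indicator_def)
    qed
    also have "\<dots> = (\<integral>\<^sup>+x. ennreal (inverse (w x * \<kappa> x)) * indicator A x \<partial>density S ?w)"
      by (rule nn_integral_density[symmetric]) measurable
    finally show ?thesis .
  qed
  then show ?thesis by (simp add: eq)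
qed

text \<open>Finitely many chart balls cover the compact frontier and, made disjoint, cut it into
  Borel pieces. The graph measures on the pieces are glued, and \<open>graph_measure_overlap\<close>
  shows that the result is correct in every chart, not only in the chosen ones.\<close>

lemma surface_measure_exists1:
  assumes "bounded_C1_domain \<Omega>"
  shows "\<exists>!\<sigma>. is_surface_measure \<Omega> \<sigma>"
proof -
  have open_\<Omega>: "open \<Omega>" and bdd: "bounded \<Omega>"
    and charts: "\<And>x. x \<in> frontier \<Omega> \<Longrightarrow> \<exists>r B e \<gamma> g. C1_graph_chart \<Omega> x r B e \<gamma> g"
    using assms by (auto simp: bounded_C1_domain_def)
  have compact: "compact (frontier \<Omega>)" using bdd by (rule compact_frontier_bounded)
  have [measurable]: "frontier \<Omega> \<in> sets borel" using frontier_closed by (rule borel_closed)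
  obtain r B e \<gamma> g where ch: "\<And>x. x \<in> frontier \<Omega> \<Longrightarrow> C1_graph_chart \<Omega> x (r x) (B x) (e x) (\<gamma> x) (g x)"
    using charts by metis
  have "frontier \<Omega> \<subseteq> (\<Union>x\<in>frontier \<Omega>. ball x (r x))"
    using ch by (force simp: C1_graph_chart_def)
  then obtain K where K: "K \<subseteq> frontier \<Omega>" "finite K" "frontier \<Omega> \<subseteq> (\<Union>x\<in>K. ball x (r x))"
    using compactE_image[OF compact, of "frontier \<Omega>" "\<lambda>x. ball x (r x)"] by blast
  obtain f where f: "bij_betw f {0..<card K} K" using ex_bij_betw_nat_finite[OF K(2)] by blast
  define n where "n = card K"
  have fK: "f i \<in> frontier \<Omega>" if "i < n" for i
    using f K(1) that by (auto simp: bij_betw_def n_def)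
  \<comment> \<open>\<open>disjointed\<close> works with sequences, so the finite cover is padded
    with empty sets.\<close>
  define U where "U i = (if i < n then ball (f i) (r (f i)) else {})" for i
  define D where "D i = frontier \<Omega> \<inter> disjointed U i" for i
  define S where "S i = graph_measure (B (f i)) (e (f i)) (\<gamma> (f i)) (g (f i))" for i
  have Ub: "U i \<in> sets borel" for i by (simp add: U_def)
  have [measurable]: "disjointed U i \<in> sets borel" for i
    unfolding disjointed_def using Ub by (intro sets.Diff sets.finite_UN) auto
  have [measurable]: "D i \<in> sets borel" for i unfolding D_def by measurable
  have D_sub: "D i \<subseteq> frontier \<Omega> \<inter> U i" for i
    using disjointed_subset[of U i] by (auto simp: D_def)
  have D_disj: "disjoint_family D"
    using disjoint_family_disjointed[of U] by (auto simp: disjoint_family_on_def D_def)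
  have D_un: "(\<Union>i<n. D i) = frontier \<Omega>"
  proof -
    have "frontier \<Omega> \<subseteq> (\<Union>i. U i)"
    proof
      fix x assume "x \<in> frontier \<Omega>"
      then obtain k where "k \<in> K" "x \<in> ball k (r k)" using K(3) by blast
      moreover from this have "k \<in> f ` {0..<card K}" using f by (simp add: bij_betw_def)
      then obtain i where "i < n" "f i = k" by (auto simp: n_def)
      ultimately show "x \<in> (\<Union>i. U i)" by (auto simp: U_def)
    qed
    then have "(\<Union>i. D i) = frontier \<Omega>"
      using UN_disjointed_eq[of U] by (auto simp: D_def)
    moreover have "D i = {}" if "\<not> i < n" for i
      using D_sub[of i] that by (simp add: U_def)
    ultimately show ?thesis by blast
  qed
  have split: "emeasure \<tau> A = (\<Sum>i<n. emeasure \<tau> (A \<inter> D i))"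
    if "sets \<tau> = sets borel" "A \<in> sets borel" "A \<subseteq> frontier \<Omega>" for \<tau> A
  proof -
    have "(\<Sum>i<n. emeasure \<tau> (A \<inter> D i)) = emeasure \<tau> (\<Union>i\<in>{..<n}. A \<inter> D i)"
      using D_disj that by (intro sum_emeasure) (auto simp: disjoint_family_on_def)
    also have "(\<Union>i\<in>{..<n}. A \<inter> D i) = A" using D_un that by blast
    finally show ?thesis by simp
  qed
  define \<mu> where "\<mu> A = (\<Sum>i<n. emeasure (S i) (A \<inter> D i))" for A
  define \<sigma> where "\<sigma> = measure_of UNIV (sets borel) \<mu>"
  have S_sets [measurable_cong]: "sets (S i) = sets borel" for i by (simp add: S_def)
  have \<sigma>_sets: "sets \<sigma> = sets borel"
    using sets.sigma_sets_eq[of "borel :: 'a measure"] by (simp add: \<sigma>_def)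
  have \<sigma>_eq: "emeasure \<sigma> A = \<mu> A" if "A \<in> sets borel" for A
  proof (rule emeasure_measure_of[OF \<sigma>_def])
    show "positive (sets \<sigma>) \<mu>" by (simp add: positive_def \<mu>_def)
    show "countably_additive (sets \<sigma>) \<mu>"
    proof (rule countably_additiveI)
      fix C :: "nat \<Rightarrow> 'a set" assume C: "range C \<subseteq> sets \<sigma>" "disjoint_family C"
      then have [measurable]: "C j \<in> sets borel" for j by (auto simp: \<sigma>_sets)
      have "(\<Sum>j. \<mu> (C j)) = (\<Sum>i<n. \<Sum>j. emeasure (S i) (C j \<inter> D i))"
        unfolding \<mu>_def by (rule suminf_sum) simp
      also have "\<dots> = \<mu> (\<Union>j. C j)"
        unfolding \<mu>_def
      proof (intro sum.cong refl)
        fix i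
        have "(\<Sum>j. emeasure (S i) (C j \<inter> D i)) = emeasure (S i) (\<Union>j. C j \<inter> D i)"
          using C(2) by (intro suminf_emeasure) (auto simp: disjoint_family_on_def S_sets)
        then show "(\<Sum>j. emeasure (S i) (C j \<inter> D i)) = emeasure (S i) ((\<Union>j. C j) \<inter> D i)" by simp
      qed
      finally show "(\<Sum>j. \<mu> (C j)) = \<mu> (\<Union>j. C j)" .
    qed
  qed (use that in \<open>auto simp: \<sigma>_sets\<close>)
  \<comment> \<open>For an arbitrary chart, compare it on each piece with the chart chosen for that
    piece and add up.\<close>
  have chart_eq: "emeasure \<sigma> A = emeasure (graph_measure B' e' \<gamma>' g') A"
    if c: "C1_graph_chart \<Omega> x' r' B' e' \<gamma>' g'" and A: "A \<in> sets borel" "A \<subseteq> frontier \<Omega> \<inter> ball x' r'"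
    for x' r' B' e' \<gamma>' g' A
  proof -
    have "emeasure (S i) (A \<inter> D i) = emeasure (graph_measure B' e' \<gamma>' g') (A \<inter> D i)" if "i < n" for i
      unfolding S_def
      by (rule graph_measure_overlap[OF open_\<Omega> ch[OF fK[OF that]] c])
        (use A D_sub[of i] that in \<open>auto simp: U_def\<close>)
    then have "emeasure \<sigma> A = (\<Sum>i<n. emeasure (graph_measure B' e' \<gamma>' g') (A \<inter> D i))"
      by (simp add: \<sigma>_eq[OF A(1)] \<mu>_def)
    also have "\<dots> = emeasure (graph_measure B' e' \<gamma>' g') A"
      using A by (intro split[symmetric]) auto
    finally show ?thesis .
  qed
  have "is_surface_measure \<Omega> \<sigma>"
    unfolding is_surface_measure_def
  proof (intro conjI allI impI ballI)
    show "sets \<sigma> = sets borel" by (rule \<sigma>_sets)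
    have "- frontier \<Omega> \<inter> D i = {}" for i using D_sub by auto
    then show "emeasure \<sigma> (- frontier \<Omega>) = 0" by (subst \<sigma>_eq) (simp_all add: \<mu>_def)
    fix x' r' B' e' \<gamma>' g' A
    assume c: "C1_graph_chart \<Omega> x' r' B' e' \<gamma>' g'" and A: "A \<in> sets borel" "A \<subseteq> frontier \<Omega> \<inter> ball x' r'"
    show "emeasure \<sigma> A = (\<integral>\<^sup>+ y. ennreal (sqrt (1 + (norm (g' y))\<^sup>2)) * indicator A (y + \<gamma>' y *\<^sub>R e')
        \<partial>hyperplane_lborel B' e')"
      using chart_eq[OF c A] emeasure_graph_measure[OF c A(1)] by simp
  qed
  \<comment> \<open>A competitor is null off the frontier and is prescribed on each piece by the
    chart belonging to it.\<close>
  moreover have "\<tau> = \<sigma>" if \<tau>: "is_surface_measure \<Omega> \<tau>" for \<tau>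
  proof (rule measure_eqI)
    have \<tau>_sets: "sets \<tau> = sets borel" and null: "emeasure \<tau> (- frontier \<Omega>) = 0"
      using \<tau> by (simp_all add: is_surface_measure_def)
    show "sets \<tau> = sets \<sigma>" by (simp add: \<tau>_sets \<sigma>_sets)
    fix A assume "A \<in> sets \<tau>"
    then have A [measurable]: "A \<in> sets borel" by (simp add: \<tau>_sets)
    have "emeasure \<tau> A = emeasure \<tau> ((A \<inter> frontier \<Omega>) \<union> (A - frontier \<Omega>))"
      by (simp add: Int_Diff_Un)
    also have "\<dots> = emeasure \<tau> (A \<inter> frontier \<Omega>)"
    proof (rule emeasure_Un_null_set)
      have "emeasure \<tau> (A - frontier \<Omega>) \<le> emeasure \<tau> (- frontier \<Omega>)"
        by (rule emeasure_mono) (auto simp: \<tau>_sets)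
      then show "A - frontier \<Omega> \<in> null_sets \<tau>" using null by (intro null_setsI) (auto simp: \<tau>_sets)
    qed (simp add: \<tau>_sets)
    also have "\<dots> = (\<Sum>i<n. emeasure \<tau> (A \<inter> frontier \<Omega> \<inter> D i))"
      by (rule split) (auto simp: \<tau>_sets)
    also have "\<dots> = \<mu> A"
      unfolding \<mu>_def
    proof (intro sum.cong refl)
      fix i assume "i \<in> {..<n}"
      then have i: "i < n" by simp
      have "A \<inter> frontier \<Omega> \<inter> D i = A \<inter> D i" using D_sub by blast
      moreover have "A \<inter> D i \<subseteq> frontier \<Omega> \<inter> ball (f i) (r (f i))" using D_sub[of i] i by (auto simp: U_def)
      moreover have "A \<inter> D i \<in> sets borel" by measurable
      ultimately show "emeasure \<tau> (A \<inter> frontier \<Omega> \<inter> D i) = emeasure (S i) (A \<inter> D i)"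
        using \<tau> ch[OF fK[OF i]] emeasure_graph_measure[OF ch[OF fK[OF i]]]
        unfolding is_surface_measure_def S_def by simp
    qed
    finally show "emeasure \<tau> A = emeasure \<sigma> A" by (simp add: \<sigma>_eq[OF A])
  qed
  ultimately show ?thesis by blast
qed

lemma is_surface_measure_surface_measure:
  assumes "bounded_C1_domain \<Omega>"
  shows "is_surface_measure \<Omega> (surface_measure \<Omega>)"
  unfolding surface_measure_def by (rule theI'[OF surface_measure_exists1[OF assms]])

section \<open>The divergence theorem\<close>

lemma integrable_indicator_bounded:
  fixes h :: "'a::euclidean_space \<Rightarrow> real"
  assumes h: "continuous_on UNIV h" and S: "bounded S" and [measurable]: "S \<in> sets borel"
  shows "integrable lborel (\<lambda>x. indicator S x * h x)"
proof -
  have [measurable]: "h \<in> borel_measurable borel" using h by (rule borel_measurable_continuous_onI)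
  have "compact (h ` closure S)"
    using S continuous_on_subset[OF h] by (intro compact_continuous_image) (auto simp: compact_closure)
  then obtain M where M: "\<And>x. x \<in> closure S \<Longrightarrow> norm (h x) \<le> M"
    by (meson bounded_iff compact_imp_bounded imageI)
  have "emeasure lborel S < \<infinity>" using S by (rule emeasure_bounded_finite)
  then have "integrable lborel (\<lambda>x. indicator S x * M)" by simp
  then show ?thesis
  proof (rule Bochner_Integration.integrable_bound)
    have "norm (h x) \<le> \<bar>M\<bar>" if "x \<in> S" for x using M[of x] closure_subset that by force
    then show "AE x in lborel. norm (indicator S x * h x) \<le> norm (indicator S x * M)"
      by (auto simp: indicator_def)
  qed measurable
qed

text \<open>On Borel subsets of the frontier inside the ball, surface measure and graph measure
  coincide. Restricting both by the density \<open>indicator S\<close> makes them equal as measures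
  and carries the flux formula over.\<close>

lemma surface_measure_flux:
  fixes \<Omega> :: "'a::euclidean_space set"
  assumes dom: "bounded_C1_domain \<Omega>" and chart: "C1_graph_chart \<Omega> x0 r B e \<gamma> g"
    and \<phi>: "C1_gradient \<phi> G" and supp: "\<And>x. x \<notin> ball x0 r \<Longrightarrow> \<phi> x = 0"
  shows "integrable (surface_measure \<Omega>) (\<lambda>x. indicator (frontier \<Omega>) x * (\<phi> x * (outward_normal \<Omega> x \<bullet> v)))"
    and "(\<integral>x. indicator (frontier \<Omega>) x * (\<phi> x * (outward_normal \<Omega> x \<bullet> v)) \<partial>surface_measure \<Omega>)
      = (LBINT x. indicator \<Omega> x * (G x \<bullet> v))"
proof -
  have open_\<Omega>: "open \<Omega>" using dom by (simp add: bounded_C1_domain_def)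
  let ?\<sigma> = "surface_measure \<Omega>" and ?\<tau> = "graph_measure B e \<gamma> g"
  define S where "S = frontier \<Omega> \<inter> ball x0 r"
  have [measurable]: "S \<in> sets borel" unfolding S_def by (intro sets.Int borel_closed frontier_closed borel_open open_ball)
  note \<sigma> = is_surface_measure_surface_measure[OF dom]
  have [measurable_cong]: "sets ?\<sigma> = sets borel" using \<sigma> by (simp add: is_surface_measure_def)
  note [measurable] = C1_gradient_measurable[OF \<phi>] graph_normal_measurable[OF chart] chart_measurable[OF chart]
  have eq: "emeasure ?\<sigma> A = emeasure ?\<tau> A" if "A \<in> sets borel" "A \<subseteq> S" for A
    using \<sigma> chart that unfolding is_surface_measure_def S_def
    by (simp add: emeasure_graph_measure[OF chart])
  define k where "k x = \<phi> x * (graph_normal e g x \<bullet> v)" for x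
  have [measurable]: "k \<in> borel_measurable borel" unfolding k_def by measurable
  have k_eq: "indicator (frontier \<Omega>) x * (\<phi> x * (outward_normal \<Omega> x \<bullet> v)) = indicator S x * k x" for x
    using outward_normal_eq[OF chart open_\<Omega>, of x] chart_frontier[OF chart open_\<Omega>, of x] supp[of x]
    by (auto simp: indicator_def S_def k_def)
  have dens: "density ?\<sigma> (indicator S) = density ?\<tau> (indicator S)"
  proof (rule measure_eqI)
    fix A assume "A \<in> sets (density ?\<sigma> (indicator S))"
    then have [measurable]: "A \<in> sets borel" by (simp add: \<open>sets ?\<sigma> = sets borel\<close>)
    have "emeasure (density L (indicator S)) A = emeasure L (S \<inter> A)" if [measurable_cong]: "sets L = sets borel" for L
      by (subst emeasure_density)
        (auto simp: that indicator_inter_arith[symmetric] nn_integral_indicator)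
    then show "emeasure (density ?\<sigma> (indicator S)) A = emeasure (density ?\<tau> (indicator S)) A"
      by (simp add: \<open>sets ?\<sigma> = sets borel\<close> eq)
  qed (simp add: \<open>sets ?\<sigma> = sets borel\<close>)
  have ind: "(indicator S x :: ennreal) = ennreal (indicator S x)" for x by (simp add: indicator_def)
  have dens': "density ?\<sigma> (\<lambda>x. ennreal (indicator S x)) = density ?\<tau> (\<lambda>x. ennreal (indicator S x))"
    using dens by (simp add: ind[abs_def])
  obtain M where M: "0 \<le> M" "\<And>x. \<bar>\<phi> x\<bar> \<le> M"
    using C1_gradient_bounded_support[OF \<phi> supp] by blast
  have "emeasure ?\<sigma> S \<le> emeasure ?\<tau> (ball x0 r)"
    using eq[of S] emeasure_mono[of S "ball x0 r" ?\<tau>] by (simp add: S_def)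
  then have "emeasure ?\<sigma> S < \<infinity>"
    using emeasure_graph_measure_ball[OF chart, of x0 r] by simp
  then have "integrable ?\<sigma> (\<lambda>x. indicator S x * (M * norm v))"
    by (simp add: \<open>sets ?\<sigma> = sets borel\<close>)
  then have "integrable ?\<sigma> (\<lambda>x. indicator S x * k x)"
  proof (rule Bochner_Integration.integrable_bound)
    have "\<bar>k x\<bar> \<le> M * norm v" for x
      using Cauchy_Schwarz_ineq2[of "graph_normal e g x" v] norm_graph_normal[OF chart, of x] M
      by (auto simp: k_def abs_mult intro!: mult_mono)
    then show "AE x in ?\<sigma>. norm (indicator S x * k x) \<le> norm (indicator S x * (M * norm v))"
      using M(1) by (auto simp: indicator_def)
  qed measurable
  then show "integrable ?\<sigma> (\<lambda>x. indicator (frontier \<Omega>) x * (\<phi> x * (outward_normal \<Omega> x \<bullet> v)))"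
    by (simp add: k_eq)
  have "(\<integral>x. indicator (frontier \<Omega>) x * (\<phi> x * (outward_normal \<Omega> x \<bullet> v)) \<partial>?\<sigma>)
      = (\<integral>x. k x \<partial>density ?\<sigma> (\<lambda>x. ennreal (indicator S x)))"
    by (subst integral_density) (simp_all add: k_eq)
  also have "\<dots> = (\<integral>x. indicator S x * k x \<partial>?\<tau>)"
    unfolding dens' by (subst integral_density) simp_all
  \<comment> \<open>The graph measure sits on the graph; a graph point off \<open>S\<close> lies
    outside the ball, where \<open>k\<close> vanishes.\<close>
  also have "\<dots> = (\<integral>x. k x \<partial>?\<tau>)"
  proof (rule integral_cong_AE)
    show "AE x in ?\<tau>. indicator S x * k x = k x"
      using AE_graph_measure[OF chart]
    proof eventually_elim
      case (elim x)
      then show ?case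
        using chart_frontier[OF chart open_\<Omega>, of x] supp[of x] by (auto simp: indicator_def S_def k_def)
    qed
  qed measurable
  also have "\<dots> = (LBINT x. indicator \<Omega> x * (G x \<bullet> v))"
    unfolding k_def by (rule chart_divergence[OF chart \<phi> supp, symmetric])
  finally show "(\<integral>x. indicator (frontier \<Omega>) x * (\<phi> x * (outward_normal \<Omega> x \<bullet> v)) \<partial>?\<sigma>)
      = (LBINT x. indicator \<Omega> x * (G x \<bullet> v))" .
qed

text \<open>The bumps are divided by their sum, altered off \<open>K\<close> so that the quotients
  are C1 on the whole space. The functions therefore sum to \<open>1\<close> only on
  \<open>K\<close>.\<close>

lemma C1_partition_of_unity:
  fixes K :: "'a::euclidean_space set"
  assumes K: "compact K" and R: "\<And>x. x \<in> K \<Longrightarrow> 0 < R x"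
  obtains I \<phi> where "finite I" "I \<subseteq> K" "\<And>i. C1_fun (\<phi> i)"
    "\<And>i x. i \<in> I \<Longrightarrow> x \<notin> ball i (R i) \<Longrightarrow> \<phi> i x = 0"
    "\<And>x. x \<in> K \<Longrightarrow> (\<Sum>i\<in>I. \<phi> i x) = 1"
proof -
  have "K \<subseteq> (\<Union>x\<in>K. ball x (R x))" using R by force
  then obtain I where I: "I \<subseteq> K" "finite I" "K \<subseteq> (\<Union>x\<in>I. ball x (R x))"
    using compactE_image[OF K, of K "\<lambda>x. ball x (R x)"] by blast
  define s where "s x = (\<Sum>i\<in>I. bump i (R i) x)" for x
  have C1s: "C1_fun s" unfolding s_def by (intro C1_fun_sum C1_fun_bump)
  have s0: "0 \<le> s x" for x unfolding s_def by (intro sum_nonneg bump_nonneg)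
  have spos: "0 < s x" if x: "x \<in> K" for x
  proof -
    obtain i where i: "i \<in> I" "x \<in> ball i (R i)" using I(3) x by blast
    have "0 < bump i (R i) x" using bump_pos_iff[of "R i" i x] R[of i] I(1) i by auto
    also have "\<dots> \<le> s x"
      unfolding s_def using I(2) i(1) by (intro member_le_sum) (auto simp: bump_nonneg)
    finally show ?thesis .
  qed
  obtain m where m: "0 < m" "\<And>x. x \<in> K \<Longrightarrow> m \<le> s x"
  proof (cases "K = {}")
    case False
    obtain G where "C1_gradient s G" using C1s by (auto simp: C1_fun_def)
    then have "continuous_on K s" by (rule C1_gradient_continuous)
    then obtain x where "x \<in> K" "\<And>y. y \<in> K \<Longrightarrow> s x \<le> s y"
      using continuous_attains_inf[OF K False] by blast
    then show ?thesis using that[of "s x"] spos by blast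
  qed (use that[of 1] in auto)
  \<comment> \<open>On \<open>K\<close> the sum \<open>s\<close> is at least \<open>m\<close>, so
    the correction is absent there. Where \<open>s\<close> vanishes, \<open>D\<close> equals the
    square of \<open>m\<close>, so it has no zeros.\<close>
  define D where "D x = s x + (max 0 (m - s x))\<^sup>2" for x
  have C1D: "C1_fun D"
    unfolding D_def by (intro C1_fun_add C1_fun_square_pos_part C1_fun_diff C1_fun_const C1s)
  have D: "D x \<noteq> 0" for x
    using s0[of x] m(1) by (cases "s x = 0") (simp_all add: D_def add_nonneg_eq_0_iff)
  have DK: "D x = s x" if "x \<in> K" for x using m(2)[OF that] by (simp add: D_def)
  show ?thesis
  proof (rule that[of I "\<lambda>i x. bump i (R i) x * inverse (D x)"])
    show "C1_fun (\<lambda>x. bump i (R i) x * inverse (D x))" for i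
      by (intro C1_fun_mult C1_fun_inverse C1_fun_bump C1D D)
    show "bump i (R i) x * inverse (D x) = 0" if "i \<in> I" "x \<notin> ball i (R i)" for i x
      using bump_eq_0[of "R i" x i] R[of i] I(1) that by auto
    show "(\<Sum>i\<in>I. bump i (R i) x * inverse (D x)) = 1" if "x \<in> K" for x
      using DK[OF that] D[of x] by (simp add: s_def sum_distrib_right[symmetric])
  qed (use I in auto)
qed

text \<open>A partition of unity on the closure reduces the claim to small balls. Around an interior
  point both sides are zero; around a frontier point one chart suffices. The gradients of the
  partition functions add up to zero on \<open>\<Omega>\<close>, where their sum is
  constant.\<close>

theorem C1_domain_divergence_theorem:
  fixes \<Omega> :: "'a::euclidean_space set" and E :: "'a \<Rightarrow> 'a"
  assumes dom: "bounded_C1_domain \<Omega>"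
    and G: "\<And>b. b \<in> Basis \<Longrightarrow> C1_gradient (\<lambda>x. E x \<bullet> b) (G b)"
  shows "(LINT x:frontier \<Omega>|surface_measure \<Omega>. E x \<bullet> outward_normal \<Omega> x)
    = (LBINT x. indicator \<Omega> x * (\<Sum>b\<in>Basis. G b x \<bullet> b))"
proof -
  have open_\<Omega>: "open \<Omega>" and bdd: "bounded \<Omega>"
    and charts: "\<And>x. x \<in> frontier \<Omega> \<Longrightarrow> \<exists>r B e \<gamma> g. C1_graph_chart \<Omega> x r B e \<gamma> g"
    using dom by (auto simp: bounded_C1_domain_def)
  have [measurable]: "\<Omega> \<in> sets borel" using open_\<Omega> by (rule borel_open)
  let ?\<sigma> = "surface_measure \<Omega>"
  define flux where "flux v \<phi> = (\<lambda>x. indicator (frontier \<Omega>) x * (\<phi> x * (outward_normal \<Omega> x \<bullet> v)))"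
    for v :: 'a and \<phi>
  \<comment> \<open>\<open>good z R\<close> is the divergence theorem for fields
    \<open>\<phi>\<close> times a constant vector, with \<open>\<phi>\<close> supported in
    \<open>ball z R\<close>.\<close>
  define good where "good z R \<longleftrightarrow> (\<forall>\<phi> H v. C1_gradient \<phi> H \<longrightarrow> (\<forall>x. x \<notin> ball z R \<longrightarrow> \<phi> x = 0) \<longrightarrow>
      integrable ?\<sigma> (flux v \<phi>) \<and> (\<integral>x. flux v \<phi> x \<partial>?\<sigma>) = (LBINT x. indicator \<Omega> x * (H x \<bullet> v)))"
    for z :: 'a and R
  have "\<exists>R>0. good z R"
    if z: "z \<in> closure \<Omega>" for z
  proof (cases "z \<in> \<Omega>")
    case True
    then obtain R where R: "0 < R" "ball z R \<subseteq> \<Omega>" using open_\<Omega> openE by blast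
    have "integrable ?\<sigma> (flux v \<phi>) \<and> (\<integral>x. flux v \<phi> x \<partial>?\<sigma>) = (LBINT x. indicator \<Omega> x * (H x \<bullet> v))"
      if \<phi>: "C1_gradient \<phi> H" and supp: "\<forall>x. x \<notin> ball z R \<longrightarrow> \<phi> x = 0" for \<phi> H v
    proof -
      have "\<phi> x = 0" if "x \<in> frontier \<Omega>" for x
      proof -
        have "x \<notin> \<Omega>" using that open_\<Omega> by (simp add: frontier_def interior_open)
        then show ?thesis using supp R(2) by blast
      qed
      then have 1: "flux v \<phi> = (\<lambda>x. 0)" by (auto simp: flux_def indicator_def)
      have "H x = 0" if "x \<notin> \<Omega>" for x
        using C1_gradient_eq_0[OF \<phi>, of z R x] supp R(2) that by blast
      then have "(LBINT x. indicator \<Omega> x * (H x \<bullet> v)) = (LBINT x. H x \<bullet> v)"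
        by (intro Bochner_Integration.integral_cong) (auto simp: indicator_def)
      also have "\<dots> = 0" using supp by (intro integral_gradient_eq_0[OF \<phi>]) blast
      finally show ?thesis by (simp add: 1)
    qed
    then show ?thesis using R(1) unfolding good_def by blast
  next
    case False
    then have "z \<in> frontier \<Omega>" using z open_\<Omega> by (simp add: frontier_def interior_open)
    then obtain r B e \<gamma> g where chart: "C1_graph_chart \<Omega> z r B e \<gamma> g"
      using charts by blast
    then have "0 < r" by (simp add: C1_graph_chart_def)
    then show ?thesis
      using surface_measure_flux[OF dom chart] unfolding flux_def good_def by blast
  qed
  then obtain R where R: "\<And>z. z \<in> closure \<Omega> \<Longrightarrow> 0 < R z"
    and good: "\<And>z. z \<in> closure \<Omega> \<Longrightarrow> good z (R z)"
    by metis
  obtain I \<phi> where I: "finite I" "I \<subseteq> closure \<Omega>" and C1\<phi>: "\<And>i. C1_fun (\<phi> i)"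
    and supp: "\<And>i x. i \<in> I \<Longrightarrow> x \<notin> ball i (R i) \<Longrightarrow> \<phi> i x = 0"
    and one: "\<And>x. x \<in> closure \<Omega> \<Longrightarrow> (\<Sum>i\<in>I. \<phi> i x) = 1"
    by (rule C1_partition_of_unity[of "closure \<Omega>" R]) (use bdd R in \<open>auto simp: compact_closure\<close>)
  define \<psi> where "\<psi> i b x = \<phi> i x * (E x \<bullet> b)" for i b x
  have "\<exists>H. \<forall>b\<in>Basis. C1_gradient (\<psi> i b) (H b)" for i
  proof -
    obtain P where P: "C1_gradient (\<phi> i) P" using C1\<phi>[of i] by (auto simp: C1_fun_def)
    show ?thesis
      unfolding \<psi>_def using C1_gradient_mult[OF P G]
      by (intro exI[of _ "\<lambda>b x. \<phi> i x *\<^sub>R G b x + (E x \<bullet> b) *\<^sub>R P x"]) simp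
  qed
  then obtain H where H: "\<And>i b. b \<in> Basis \<Longrightarrow> C1_gradient (\<psi> i b) (H i b)" by metis
  have fl: "integrable ?\<sigma> (flux b (\<psi> i b))"
    "(\<integral>x. flux b (\<psi> i b) x \<partial>?\<sigma>) = (LBINT x. indicator \<Omega> x * (H i b x \<bullet> b))"
    if "i \<in> I" "b \<in> Basis" for i b
  proof -
    have "\<forall>x. x \<notin> ball i (R i) \<longrightarrow> \<psi> i b x = 0" using supp that(1) by (simp add: \<psi>_def)
    with good[of i] I(2) that H[OF that(2), of i]
    show "integrable ?\<sigma> (flux b (\<psi> i b))"
      "(\<integral>x. flux b (\<psi> i b) x \<partial>?\<sigma>) = (LBINT x. indicator \<Omega> x * (H i b x \<bullet> b))"
      unfolding good_def by blast+
  qed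
  have flux_sum: "indicator (frontier \<Omega>) x *\<^sub>R (E x \<bullet> outward_normal \<Omega> x)
      = (\<Sum>i\<in>I. \<Sum>b\<in>Basis. flux b (\<psi> i b) x)" for x
  proof (cases "x \<in> frontier \<Omega>")
    case True
    then have "x \<in> closure \<Omega>" by (simp add: frontier_def)
    have "(\<Sum>i\<in>I. \<Sum>b\<in>Basis. flux b (\<psi> i b) x) = (\<Sum>i\<in>I. \<phi> i x * (E x \<bullet> outward_normal \<Omega> x))"
    proof (rule sum.cong[OF refl])
      fix i
      have "(\<Sum>b\<in>Basis. flux b (\<psi> i b) x) = (\<Sum>b\<in>Basis. \<phi> i x * ((E x \<bullet> b) * (outward_normal \<Omega> x \<bullet> b)))"
        using True by (simp add: flux_def \<psi>_def mult.assoc)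
      then show "(\<Sum>b\<in>Basis. flux b (\<psi> i b) x) = \<phi> i x * (E x \<bullet> outward_normal \<Omega> x)"
        by (simp only: euclidean_inner[of "E x" "outward_normal \<Omega> x"] sum_distrib_left)
    qed
    also have "\<dots> = E x \<bullet> outward_normal \<Omega> x"
      using one[OF \<open>x \<in> closure \<Omega>\<close>] by (simp add: sum_distrib_right[symmetric])
    finally show ?thesis using True by simp
  qed (simp add: flux_def)
  \<comment> \<open>The localised fields recover \<open>E\<close> on the closure only. Since
    \<open>\<Omega>\<close> is open, agreement there still determines the derivative at each of its
    points.\<close>
  have div_sum: "(\<Sum>i\<in>I. H i b x) = G b x" if x: "x \<in> \<Omega>" and b: "b \<in> Basis" for x b
  proof -
    have "C1_gradient (\<lambda>x. \<Sum>i\<in>I. \<psi> i b x) (\<lambda>x. \<Sum>i\<in>I. H i b x)"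
      by (rule C1_gradient_sum) (rule H[OF b])
    then have "((\<lambda>x. \<Sum>i\<in>I. \<psi> i b x) has_derivative (\<lambda>h. h \<bullet> (\<Sum>i\<in>I. H i b x))) (at x)"
      by (rule C1_gradient_has_derivative)
    then have "((\<lambda>x. E x \<bullet> b) has_derivative (\<lambda>h. h \<bullet> (\<Sum>i\<in>I. H i b x))) (at x)"
    proof (rule has_derivative_transform_within_open[OF _ open_\<Omega> x])
      fix y assume "y \<in> \<Omega>"
      then have "(\<Sum>i\<in>I. \<phi> i y) = 1" using one closure_subset by blast
      then show "(\<Sum>i\<in>I. \<psi> i b y) = E y \<bullet> b"
        unfolding \<psi>_def by (simp add: sum_distrib_right[symmetric])
    qed
    then have "(\<lambda>h. h \<bullet> (\<Sum>i\<in>I. H i b x)) = (\<lambda>h. h \<bullet> G b x)"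
      using has_derivative_unique C1_gradient_has_derivative[OF G[OF b]] by blast
    then have "\<forall>h. h \<bullet> (\<Sum>i\<in>I. H i b x) = h \<bullet> G b x" by (simp add: fun_eq_iff)
    then show ?thesis by (simp only: vector_eq_ldot)
  qed
  have "(LINT x:frontier \<Omega>|?\<sigma>. E x \<bullet> outward_normal \<Omega> x)
      = (\<integral>x. (\<Sum>i\<in>I. \<Sum>b\<in>Basis. flux b (\<psi> i b) x) \<partial>?\<sigma>)"
    unfolding set_lebesgue_integral_def by (simp only: flux_sum)
  also have "\<dots> = (\<Sum>i\<in>I. \<Sum>b\<in>Basis. \<integral>x. flux b (\<psi> i b) x \<partial>?\<sigma>)"
    using fl(1) by (simp add: Bochner_Integration.integral_sum Bochner_Integration.integrable_sum)
  also have "\<dots> = (\<Sum>i\<in>I. \<Sum>b\<in>Basis. \<integral>x. indicator \<Omega> x * (H i b x \<bullet> b) \<partial>lborel)"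
    by (intro sum.cong refl fl(2))
  also have "\<dots> = (LBINT x. (\<Sum>i\<in>I. \<Sum>b\<in>Basis. indicator \<Omega> x * (H i b x \<bullet> b)))"
  proof -
    have int: "integrable lborel (\<lambda>x. indicator \<Omega> x * (H i b x \<bullet> b))" if "b \<in> Basis" for i b
      using C1_gradient_continuous(2)[OF H[OF that], of UNIV i] bdd
      by (intro integrable_indicator_bounded continuous_intros) auto
    have "(LBINT x. (\<Sum>i\<in>I. \<Sum>b\<in>Basis. indicator \<Omega> x * (H i b x \<bullet> b)))
        = (\<Sum>i\<in>I. \<integral>x. (\<Sum>b\<in>Basis. indicator \<Omega> x * (H i b x \<bullet> b)) \<partial>lborel)"
      by (intro Bochner_Integration.integral_sum Bochner_Integration.integrable_sum int)
    also have "\<dots> = (\<Sum>i\<in>I. \<Sum>b\<in>Basis. \<integral>x. indicator \<Omega> x * (H i b x \<bullet> b) \<partial>lborel)"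
      by (intro sum.cong refl Bochner_Integration.integral_sum int)
    finally show ?thesis by (rule sym)
  qed
  also have "\<dots> = (LBINT x. indicator \<Omega> x * (\<Sum>b\<in>Basis. G b x \<bullet> b))"
  proof (intro Bochner_Integration.integral_cong refl)
    fix x
    have "(\<Sum>i\<in>I. \<Sum>b\<in>Basis. indicator \<Omega> x * (H i b x \<bullet> b))
        = indicator \<Omega> x * (\<Sum>b\<in>Basis. (\<Sum>i\<in>I. H i b x) \<bullet> b)"
      by (subst sum.swap) (simp add: inner_sum_left sum_distrib_left)
    then show "(\<Sum>i\<in>I. \<Sum>b\<in>Basis. indicator \<Omega> x * (H i b x \<bullet> b))
        = indicator \<Omega> x * (\<Sum>b\<in>Basis. G b x \<bullet> b)"
      by (cases "x \<in> \<Omega>") (simp_all add: div_sum)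
  qed
  finally show ?thesis .
qed

section \<open>Volume of the boundary strip\<close>

text \<open>A step \<open>h\<close> changes \<open>\<gamma>\<close> by at most
  \<open>L * norm h\<close> and the height by at most \<open>norm h\<close>. A point that it carries
  into \<open>\<Omega>\<close> thus lies at most \<open>(1 + L) * norm h\<close> below the graph.
  Steps and points are limited to half the radius to remain in the chart ball.\<close>

lemma chart_strip_bound:
  assumes chart: "C1_graph_chart \<Omega> x0 r B e \<gamma> g"
  obtains C where "0 \<le> C" "\<And>h. norm h < r / 2 \<Longrightarrow>
    emeasure lborel {x \<in> ball x0 (r / 2). x \<notin> \<Omega> \<and> x + h \<in> \<Omega>} \<le> ennreal (C * norm h)"
proof -
  let ?H = "hyperplane_lborel B e"
  note basis = chart_basis[OF chart] and ee = orthonormal_basis_norm[OF chart_basis[OF chart]]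
  note [measurable] = chart_measurable[OF chart]
  obtain L where L: "0 \<le> L" "\<And>x y. x \<in> cball x0 r \<Longrightarrow> y \<in> cball x0 r \<Longrightarrow> \<bar>\<gamma> x - \<gamma> y\<bar> \<le> L * norm (x - y)"
    using C1_gradient_lipschitz[OF chart_gradient[OF chart]] by blast
  define R where "R = norm x0 + r"
  define V where "V = measure ?H (cball 0 R)"
  have V: "emeasure ?H (cball 0 R) = ennreal V"
    using emeasure_hyperplane_lborel_bounded[OF basis bounded_cball, of 0 R]
    by (simp add: V_def emeasure_eq_ennreal_measure)
  show ?thesis
  proof (rule that[of "(1 + L) * V"])
    show "0 \<le> (1 + L) * V" using L by (simp add: V_def)
    fix h :: 'a assume h: "norm h < r / 2"
    let ?c = "(1 + L) * norm h"
    let ?S = "{x \<in> ball x0 (r / 2). x \<notin> \<Omega> \<and> x + h \<in> \<Omega>}"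
    \<comment> \<open>The strip is enlarged to a set with simple slices: a vertical interval of
      length \<open>?c\<close> over each point of a ball in the hyperplane.\<close>
    define T where "T = {x. norm (x - (x \<bullet> e) *\<^sub>R e) \<le> R \<and> \<gamma> x - ?c \<le> x \<bullet> e \<and> x \<bullet> e \<le> \<gamma> x}"
    have T [measurable]: "T \<in> sets borel" unfolding T_def by measurable
    have "?S \<subseteq> T"
    proof
      fix x assume x: "x \<in> ?S"
      have "dist x0 (x + h) \<le> dist x0 x + norm h"
        using dist_triangle[of x0 "x + h" x] by (simp add: dist_norm)
      then have b: "x \<in> ball x0 r" "x + h \<in> ball x0 r" using x h norm_ge_zero[of h] by (auto simp del: norm_ge_zero)
      have 1: "x \<bullet> e \<le> \<gamma> x" using x chart_mem[OF chart b(1)] by auto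
      have 2: "\<gamma> (x + h) < x \<bullet> e + h \<bullet> e" using x chart_mem[OF chart b(2)] by (simp add: inner_add_left)
      have 3: "\<bar>\<gamma> x - \<gamma> (x + h)\<bar> \<le> L * norm h" using L(2)[of x "x + h"] b by simp
      have 4: "h \<bullet> e \<le> norm h" using norm_cauchy_schwarz[of h e] ee by simp
      have "\<gamma> x - ?c \<le> x \<bullet> e" using 2 3 4 by (simp add: algebra_simps)
      moreover have "norm (x - (x \<bullet> e) *\<^sub>R e) \<le> norm x"
      proof -
        have "(norm (x - (x \<bullet> e) *\<^sub>R e))\<^sup>2 \<le> (norm x)\<^sup>2"
          using ee by (simp add: power2_norm_eq_inner inner_diff_left inner_diff_right inner_commute)
        then show ?thesis by (simp add: power2_le_iff_abs_le)
      qed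
      moreover have "norm x \<le> R"
        using b(1) norm_triangle_sub[of x x0] by (simp add: R_def dist_norm norm_minus_commute)
      ultimately show "x \<in> T" using 1 by (simp add: T_def)
    qed
    then have "emeasure lborel ?S \<le> emeasure lborel T" by (intro emeasure_mono) auto
    also have "\<dots> = (\<integral>\<^sup>+x. indicator T x \<partial>lborel)" by simp
    also have "\<dots> = (\<integral>\<^sup>+y. \<integral>\<^sup>+t. indicator T (y + t *\<^sub>R e) \<partial>lborel \<partial>?H)"
      by (rule nn_integral_lborel_hyperplane[OF basis]) simp
    also have "\<dots> = (\<integral>\<^sup>+y. ennreal ?c * indicator (cball 0 R) y \<partial>?H)"
    proof (rule nn_integral_cong_AE)
      show "AE y in ?H. (\<integral>\<^sup>+t. indicator T (y + t *\<^sub>R e) \<partial>lborel) = ennreal ?c * indicator (cball 0 R) y"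
        using AE_hyperplane_lborel[OF basis]
      proof eventually_elim
        case (elim y)
        have "indicator T (y + t *\<^sub>R e) = (indicator {\<gamma> y - ?c..\<gamma> y} t * indicator (cball 0 R) y :: ennreal)" for t
          using elim ee by (auto simp: T_def indicator_def inner_add_left chart_const[OF chart])
        then have "(\<integral>\<^sup>+t. indicator T (y + t *\<^sub>R e) \<partial>lborel)
            = (\<integral>\<^sup>+t. indicator {\<gamma> y - ?c..\<gamma> y} t * indicator (cball 0 R) y \<partial>lborel)" by simp
        also have "\<dots> = emeasure lborel {\<gamma> y - ?c..\<gamma> y} * indicator (cball 0 R) y"
          by (subst nn_integral_multc) simp_all
        also have "\<dots> = ennreal ?c * indicator (cball 0 R) y"
          using L(1) by (subst emeasure_lborel_Icc) simp_all
        finally show ?case .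
      qed
    qed
    also have "\<dots> = ennreal ?c * emeasure ?H (cball 0 R)" by (rule nn_integral_cmult_indicator) simp
    also have "\<dots> = ennreal ((1 + L) * V * norm h)"
      unfolding V using L(1) by (simp add: ennreal_mult[symmetric] V_def mult_ac)
    finally show "emeasure lborel ?S \<le> ennreal ((1 + L) * V * norm h)" .
  qed
qed

text \<open>For short \<open>h\<close> the segment from \<open>x\<close> to \<open>x + h\<close>
  meets the frontier, so finitely many chart strips cover the set. For long \<open>h\<close> it lies
  in a translate of \<open>\<Omega>\<close>, which has finite volume.\<close>

lemma boundary_strip_bound:
  fixes \<Omega> :: "'a::euclidean_space set"
  assumes dom: "bounded_C1_domain \<Omega>"
  obtains C where "0 \<le> C"
    "\<And>h. emeasure lborel {x. x \<notin> \<Omega> \<and> x + h \<in> \<Omega>} \<le> ennreal (C * min 1 (norm h))"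
proof -
  have open_\<Omega>: "open \<Omega>" and bdd: "bounded \<Omega>"
    and charts: "\<And>x. x \<in> frontier \<Omega> \<Longrightarrow> \<exists>r B e \<gamma> g. C1_graph_chart \<Omega> x r B e \<gamma> g"
    using dom by (auto simp: bounded_C1_domain_def)
  have [measurable]: "\<Omega> \<in> sets borel" using open_\<Omega> by (rule borel_open)
  let ?S = "\<lambda>z r h. {x \<in> ball z (r / 2). x \<notin> \<Omega> \<and> x + h \<in> \<Omega>}"
  have "\<forall>z\<in>frontier \<Omega>. \<exists>r C. 0 < r \<and> 0 \<le> C \<and>
      (\<forall>h. norm h < r / 2 \<longrightarrow> emeasure lborel (?S z r h) \<le> ennreal (C * norm h))"
  proof
    fix z assume "z \<in> frontier \<Omega>"
    then obtain r B e \<gamma> g where chart: "C1_graph_chart \<Omega> z r B e \<gamma> g" using charts by blast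
    obtain C where "0 \<le> C" "\<And>h. norm h < r / 2 \<Longrightarrow> emeasure lborel (?S z r h) \<le> ennreal (C * norm h)"
      using chart_strip_bound[OF chart] by blast
    moreover have "0 < r" using chart by (simp add: C1_graph_chart_def)
    ultimately show "\<exists>r C. 0 < r \<and> 0 \<le> C \<and>
      (\<forall>h. norm h < r / 2 \<longrightarrow> emeasure lborel (?S z r h) \<le> ennreal (C * norm h))" by blast
  qed
  from bchoice[OF this] obtain r where "\<forall>z\<in>frontier \<Omega>. \<exists>C. 0 < r z \<and> 0 \<le> C \<and>
      (\<forall>h. norm h < r z / 2 \<longrightarrow> emeasure lborel (?S z (r z) h) \<le> ennreal (C * norm h))" ..
  from bchoice[OF this] obtain C where *: "\<forall>z\<in>frontier \<Omega>. 0 < r z \<and> 0 \<le> C z \<and>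
      (\<forall>h. norm h < r z / 2 \<longrightarrow> emeasure lborel (?S z (r z) h) \<le> ennreal (C z * norm h))" ..
  have r: "0 < r z" and C: "0 \<le> C z" if "z \<in> frontier \<Omega>" for z using * that by simp_all
  have S: "emeasure lborel (?S z (r z) h) \<le> ennreal (C z * norm h)"
    if "z \<in> frontier \<Omega>" "norm h < r z / 2" for z h using *[rule_format, OF that(1)] that(2) by simp
  \<comment> \<open>Quarter radii leave room for the step: a frontier point within
    \<open>r z / 4\<close> of \<open>z\<close> and a step shorter than \<open>r z / 4\<close> place
    \<open>x\<close> within \<open>r z / 2\<close>.\<close>
  have "frontier \<Omega> \<subseteq> (\<Union>z\<in>frontier \<Omega>. ball z (r z / 4))" using r by force
  then obtain I where I: "I \<subseteq> frontier \<Omega>" "finite I" "frontier \<Omega> \<subseteq> (\<Union>z\<in>I. ball z (r z / 4))"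
    using compactE_image[OF compact_frontier_bounded[OF bdd], of "frontier \<Omega>" "\<lambda>z. ball z (r z / 4)"] by blast
  define \<delta> where "\<delta> = Min (insert 1 ((\<lambda>z. r z / 4) ` I))"
  have \<delta>: "0 < \<delta>" "\<delta> \<le> 1"
    using I(1,2) r by (auto simp: \<delta>_def Min_gr_iff)
  have \<delta>r: "\<delta> \<le> r z / 4" if "z \<in> I" for z
    unfolding \<delta>_def using I(2) that by (intro Min_le) auto
  define A where "A h = {x. x \<notin> \<Omega> \<and> x + h \<in> \<Omega>}" for h
  have small: "emeasure lborel (A h) \<le> ennreal ((\<Sum>z\<in>I. C z) * norm h)" if h: "norm h < \<delta>" for h
  proof -
    have "A h \<subseteq> (\<Union>z\<in>I. ?S z (r z) h)"
    proof
      fix x assume x: "x \<in> A h"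
      have "closed_segment x (x + h) \<inter> frontier \<Omega> \<noteq> {}"
        using x by (intro connected_Int_frontier convex_connected convex_closed_segment) (auto simp: A_def)
      then obtain p where p: "p \<in> closed_segment x (x + h)" "p \<in> frontier \<Omega>" by blast
      then obtain z where z: "z \<in> I" "p \<in> ball z (r z / 4)" using I(3) by blast
      have "dist x p \<le> norm h" using segment_bound1[OF p(1)] by (simp add: dist_norm norm_minus_commute)
      then have "dist z x < r z / 2"
        using dist_triangle[of z x p] z(2) h \<delta>r[OF z(1)] by (simp add: dist_commute)
      then show "x \<in> (\<Union>z\<in>I. ?S z (r z) h)" using x z(1) by (auto simp: A_def)
    qed
    moreover have meas: "?S z (r z) h \<in> sets lborel" for z
      by measurable
    ultimately have "emeasure lborel (A h) \<le> emeasure lborel (\<Union>z\<in>I. ?S z (r z) h)"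
      using I(2) by (intro emeasure_mono) auto
    also have "\<dots> \<le> (\<Sum>z\<in>I. emeasure lborel (?S z (r z) h))"
      using meas I(2) by (intro emeasure_subadditive_finite) auto
    also have "\<dots> \<le> (\<Sum>z\<in>I. ennreal (C z * norm h))"
    proof (intro sum_mono S)
      fix z assume "z \<in> I"
      then show "z \<in> frontier \<Omega>" "norm h < r z / 2" using I(1) h \<delta>r[of z] r[of z] by auto
    qed
    also have "\<dots> = ennreal ((\<Sum>z\<in>I. C z) * norm h)"
      using C I(1) by (subst sum_ennreal) (auto simp: sum_distrib_right)
    finally show ?thesis .
  qed
  define V where "V = measure lborel \<Omega>"
  have V: "emeasure lborel \<Omega> = ennreal V"
    using emeasure_bounded_finite[OF bdd] by (simp add: V_def emeasure_eq_ennreal_measure)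
  have large: "emeasure lborel (A h) \<le> ennreal V" for h
  proof -
    have "(+) h -` \<Omega> \<in> sets borel"
      using measurable_sets_borel[of "(+) h" borel \<Omega>] by simp
    then have "emeasure lborel (A h) \<le> emeasure lborel ((+) h -` \<Omega> \<inter> space lborel)"
      by (intro emeasure_mono) (auto simp: A_def add.commute)
    also have "\<dots> = emeasure (distr lborel borel ((+) h)) \<Omega>" by (subst emeasure_distr) simp_all
    also have "\<dots> = ennreal V" by (simp add: lborel_distr_plus V)
    finally show ?thesis .
  qed
  show ?thesis
  \<comment> \<open>The summand \<open>V / \<delta>\<close> handles long steps: for
    \<open>norm h \<ge> \<delta>\<close>, as \<open>\<delta> \<le> 1\<close>, the minimum of
    \<open>1\<close> and \<open>norm h\<close> is at least \<open>\<delta>\<close>.\<close>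
  proof (rule that[of "(\<Sum>z\<in>I. C z) + V / \<delta>"])
    have C0: "0 \<le> (\<Sum>z\<in>I. C z)" using C I(1) by (intro sum_nonneg) auto
    have V0: "0 \<le> V / \<delta>" using \<delta>(1) by (simp add: V_def)
    show "0 \<le> (\<Sum>z\<in>I. C z) + V / \<delta>" using C0 V0 by simp
    fix h :: 'a
    show "emeasure lborel {x. x \<notin> \<Omega> \<and> x + h \<in> \<Omega>} \<le> ennreal (((\<Sum>z\<in>I. C z) + V / \<delta>) * min 1 (norm h))"
    proof (cases "norm h < \<delta>")
      case True
      have "(\<Sum>z\<in>I. C z) * norm h \<le> ((\<Sum>z\<in>I. C z) + V / \<delta>) * min 1 (norm h)"
        using True \<delta>(2) V0 by (simp add: mult_right_mono)
      then show ?thesis using order_trans[OF small[OF True] ennreal_leI] unfolding A_def by blast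
    next
      case False
      have "V = (V / \<delta>) * \<delta>" using \<delta>(1) by simp
      also have "\<dots> \<le> ((\<Sum>z\<in>I. C z) + V / \<delta>) * min 1 (norm h)"
        using False \<delta> V0 C0 by (intro mult_mono) auto
      finally show ?thesis using order_trans[OF large[of h] ennreal_leI] unfolding A_def by blast
    qed
  qed
qed

section \<open>Integrals along segments\<close>

text \<open>This is \<open>\<Phi>(x, h)\<close> of the overview, written as a Lebesgue integral so
  that joint measurability in \<open>x\<close> and \<open>h\<close> comes with it.\<close>

definition segment_integral :: "('a::euclidean_space \<Rightarrow> 'a) \<Rightarrow> 'a \<Rightarrow> 'a \<Rightarrow> real" where
  "segment_integral E x h = (LBINT t. indicator {0..1::real} t * (E (x + t *\<^sub>R h) \<bullet> h))"

lemma segment_integral_integrable: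
  assumes "continuous_on UNIV E"
  shows "integrable lborel (\<lambda>t. indicator {0..1::real} t * (E (x + t *\<^sub>R h) \<bullet> h))"
  by (intro integrable_indicator_bounded continuous_intros continuous_on_compose2[OF assms]) auto

lemma segment_integral_eq_integral:
  assumes "continuous_on UNIV E"
  shows "segment_integral E x h = integral {0..1} (\<lambda>t. E (x + t *\<^sub>R h) \<bullet> h)"
proof -
  have "set_integrable lborel {0..1} (\<lambda>t. E (x + t *\<^sub>R h) \<bullet> h)"
    using segment_integral_integrable[OF assms] by (simp add: set_integrable_def)
  from set_borel_integral_eq_integral(2)[OF this] show ?thesis
    by (simp add: segment_integral_def set_lebesgue_integral_def)
qed

lemma segment_integral_measurable [measurable]:
  assumes [measurable]: "E \<in> borel_measurable borel" "f \<in> borel_measurable M" "g \<in> borel_measurable M"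
  shows "(\<lambda>x. segment_integral E (f x) (g x)) \<in> borel_measurable M"
  unfolding segment_integral_def by measurable

lemma segment_integral_zero [simp]: "segment_integral E x 0 = 0"
  by (simp add: segment_integral_def)

text \<open>The substitution of \<open>1 - t\<close> for \<open>t\<close>: the same segment is run
  through backwards.\<close>

lemma segment_integral_reverse:
  assumes "continuous_on UNIV E"
  shows "segment_integral E (x + h) (- h) = - segment_integral E x h"
proof -
  note [measurable] = borel_measurable_continuous_onI[OF assms]
  let ?f = "\<lambda>t. indicator {0..1::real} t * (E (x + t *\<^sub>R h) \<bullet> h)"
  have "(LBINT t. ?f t) = (LBINT t. ?f (1 + t))"
    by (rule integral_lborel_translation[symmetric]) measurable
  also have "\<dots> = (\<integral>t. ?f (1 + t) \<partial>distr lborel borel uminus)"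
    by (simp add: lborel_distr_uminus)
  also have "\<dots> = (LBINT t. ?f (1 - t))"
    by (subst integral_distr) simp_all
  also have "\<dots> = (LBINT t. - (indicator {0..1::real} t * (E (x + h + t *\<^sub>R (- h)) \<bullet> (- h))))"
    by (intro Bochner_Integration.integral_cong refl) (auto simp: indicator_def algebra_simps)
  finally show ?thesis by (simp add: segment_integral_def)
qed

text \<open>For small \<open>h\<close> the integrand is at most \<open>M * norm h\<close>. For large
  \<open>h\<close> the line stays in the support ball only during a parameter interval of length at
  most \<open>4 * R / norm h\<close>, which offsets that factor \<open>norm h\<close>.\<close>

lemma segment_integral_bound:
  fixes E :: "'a::euclidean_space \<Rightarrow> 'a"
  assumes E: "continuous_on UNIV E" and M: "\<And>x. norm (E x) \<le> M" and R: "\<And>x. x \<notin> cball 0 R \<Longrightarrow> E x = 0" "0 \<le> R"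
  shows "\<bar>segment_integral E x h\<bar> \<le> (M + 4 * M * R) * min 1 (norm h)"
proof -
  have M0: "0 \<le> M" using M[of 0] norm_ge_zero order_trans by blast
  have Eh: "\<bar>E z \<bullet> h\<bar> \<le> M * norm h" for z
    using Cauchy_Schwarz_ineq2[of "E z" h] M[of z] mult_right_mono[OF M[of z], of "norm h"] by fastforce
  note int = segment_integral_integrable[OF E]
  have le: "\<bar>segment_integral E x h\<bar> \<le> (LBINT t. indicator J t * (M * norm h))"
    if J: "J = {a..b::real}" and "\<And>t. t \<in> {0..1} \<Longrightarrow> t \<notin> J \<Longrightarrow> E (x + t *\<^sub>R h) = 0" for J a b
  proof -
    have "integrable lborel (\<lambda>t. indicator J t * (M * norm h))"
      unfolding J by (rule integrable_indicator_bounded) auto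
    moreover have "\<bar>indicator {0..1::real} t * (E (x + t *\<^sub>R h) \<bullet> h)\<bar> \<le> indicator J t * (M * norm h)" for t
      using that(2)[of t] Eh[of "x + t *\<^sub>R h"] M0 by (auto simp: indicator_def)
    ultimately show ?thesis
      unfolding segment_integral_def
      by (intro order_trans[OF integral_abs_bound] integral_mono_AE integrable_abs int AE_I2)
  qed
  have 1: "\<bar>segment_integral E x h\<bar> \<le> M * norm h"
    using le[OF refl, of 0 1] by simp
  have 2: "\<bar>segment_integral E x h\<bar> \<le> 4 * M * R"
  proof (cases "\<exists>t\<^sub>0. x + t\<^sub>0 *\<^sub>R h \<in> cball 0 R \<and> h \<noteq> 0")
    case True
    then obtain t\<^sub>0 where t\<^sub>0: "norm (x + t\<^sub>0 *\<^sub>R h) \<le> R" and h: "0 < norm h" by auto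
    \<comment> \<open>Two points of the ball are at most \<open>2 * R\<close> apart, so every
      parameter that hits it is within \<open>?c\<close> of the hit
      \<open>t\<^sub>0\<close>.\<close>
    let ?c = "2 * R / norm h"
    have "E (x + t *\<^sub>R h) = 0" if "t \<notin> {t\<^sub>0 - ?c..t\<^sub>0 + ?c}" for t
    proof (rule R(1), rule notI)
      assume "x + t *\<^sub>R h \<in> cball 0 R"
      then have "norm ((x + t *\<^sub>R h) - (x + t\<^sub>0 *\<^sub>R h)) \<le> 2 * R"
        using norm_triangle_ineq4[of "x + t *\<^sub>R h" "x + t\<^sub>0 *\<^sub>R h"] t\<^sub>0 by simp
      moreover have "(x + t *\<^sub>R h) - (x + t\<^sub>0 *\<^sub>R h) = (t - t\<^sub>0) *\<^sub>R h" by (simp add: algebra_simps)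
      ultimately have "\<bar>t - t\<^sub>0\<bar> * norm h \<le> 2 * R" by simp
      then have "\<bar>t - t\<^sub>0\<bar> \<le> ?c" using h by (simp add: field_simps)
      then show False using that by auto
    qed
    then have "\<bar>segment_integral E x h\<bar> \<le> (LBINT t. indicator {t\<^sub>0 - ?c..t\<^sub>0 + ?c} t * (M * norm h))"
      by (intro le[OF refl]) blast
    also have "\<dots> = (2 * ?c) * (M * norm h)" using h R(2) by simp
    also have "\<dots> = 4 * M * R" using h by simp
    finally show ?thesis .
  next
    case False
    then have "segment_integral E x h = 0"
      using R(1) by (cases "h = 0") (simp_all add: segment_integral_def)
    then show ?thesis using M0 R(2) by simp
  qed
  show ?thesis
  proof (cases "norm h \<le> 1")
    case True
    have "M * norm h \<le> (M + 4 * M * R) * norm h" using M0 R(2) by (simp add: mult_right_mono)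
    then show ?thesis using 1 True by simp
  next
    case False
    then show ?thesis using 2 M0 by simp
  qed
qed

text \<open>Taylor expansion of first order at \<open>x\<close>, uniform over the bounded set
  \<open>S\<close> because \<open>DE\<close> is uniformly continuous on compact balls. Integrating
  the linear term over \<open>t\<close> produces the factor \<open>1/2\<close>.\<close>

lemma segment_integral_expansion:
  fixes E :: "'a::euclidean_space \<Rightarrow> 'a"
  assumes E: "\<And>x. (E has_derivative blinfun_apply (DE x)) (at x)" and DE: "continuous_on UNIV DE"
    and S: "bounded S" and \<eta>: "0 < \<eta>"
  obtains \<delta> where "0 < \<delta>" "\<And>x h. x \<in> S \<Longrightarrow> norm h \<le> \<delta> \<Longrightarrow>
    \<bar>segment_integral E x h - (E x \<bullet> h + (1/2) * (DE x h \<bullet> h))\<bar> \<le> \<eta> * (norm h)\<^sup>2"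
proof -
  have contE: "continuous_on UNIV E"
    by (rule has_derivative_continuous_on[where f' = "\<lambda>x. blinfun_apply (DE x)"])
      (rule has_derivative_at_withinI[OF E])
  obtain R where R: "\<And>x. x \<in> S \<Longrightarrow> norm x \<le> R" using S unfolding bounded_iff by blast
  \<comment> \<open>The margin \<open>1\<close> accommodates the steps, since
    \<open>\<delta>\<close> is chosen at most \<open>1\<close>.\<close>
  have "uniformly_continuous_on (cball 0 (R + 1)) DE"
    using continuous_on_subset[OF DE] by (intro compact_uniformly_continuous) auto
  then obtain d where d: "0 < d" "\<And>x y. x \<in> cball 0 (R + 1) \<Longrightarrow> y \<in> cball 0 (R + 1) \<Longrightarrow> dist y x < d \<Longrightarrow> dist (DE y) (DE x) < \<eta>"
    unfolding uniformly_continuous_on_def using \<eta> by metis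
  define \<delta> where "\<delta> = min (d / 2) 1"
  have \<delta>: "0 < \<delta>" "\<delta> < d" "\<delta> \<le> 1" using d(1) by (auto simp: \<delta>_def)
  show ?thesis
  proof (rule that[OF \<delta>(1)])
    fix x h :: 'a assume x: "x \<in> S" and h: "norm h \<le> \<delta>"
    have lin: "norm (E (x + t *\<^sub>R h) - E x - DE x (t *\<^sub>R h)) \<le> norm (t *\<^sub>R h) * \<eta>" if t: "t \<in> {0..1}" for t
    proof -
      have "norm (t *\<^sub>R h) \<le> norm h" using t by (simp add: mult_left_le_one_le)
      then have th: "norm (t *\<^sub>R h) \<le> \<delta>" using h by linarith
      have "norm (E (x + t *\<^sub>R h) - E x - DE x ((x + t *\<^sub>R h) - x)) \<le> norm ((x + t *\<^sub>R h) - x) * \<eta>"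
      proof (rule differentiable_bound_linearization[where S = "cball x \<delta>" and f' = "\<lambda>x. blinfun_apply (DE x)"])
        show "x + s *\<^sub>R (x + t *\<^sub>R h - x) \<in> cball x \<delta>" if "s \<in> {0..1}" for s
        proof -
          have "norm (s *\<^sub>R (t *\<^sub>R h)) \<le> norm (t *\<^sub>R h)" using that by (simp add: mult_left_le_one_le del: scaleR_scaleR)
          then show ?thesis using th by (simp add: dist_norm)
        qed
        show "(E has_derivative blinfun_apply (DE y)) (at y within cball x \<delta>)" for y
          by (rule has_derivative_at_withinI[OF E])
        show "onorm (blinfun_apply (DE y) - blinfun_apply (DE x)) \<le> \<eta>" if y: "y \<in> cball x \<delta>" for y
        proof -
          have "x \<in> cball 0 (R + 1)" using R[OF x] by simp
          moreover have "y \<in> cball 0 (R + 1)"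
            using y R[OF x] \<delta>(3) norm_triangle_sub[of y x] by (simp add: dist_norm norm_minus_commute)
          moreover have "dist y x < d" using y \<delta>(2) by (simp add: dist_commute)
          ultimately have "norm (DE y - DE x) < \<eta>" using d(2) by (simp add: dist_norm)
          moreover have "onorm (blinfun_apply (DE y) - blinfun_apply (DE x)) = norm (DE y - DE x)"
            by (simp add: norm_blinfun.rep_eq minus_blinfun.rep_eq fun_diff_def)
          ultimately show ?thesis by simp
        qed
      qed (use \<delta> in simp)
      then show ?thesis by simp
    qed
    let ?I = "\<lambda>t. indicator {0..1::real} t :: real"
    have i1: "integrable lborel (\<lambda>t. ?I t * (E x \<bullet> h))" "integrable lborel (\<lambda>t. ?I t * (t * (DE x h \<bullet> h)))"
      by (intro integrable_indicator_bounded continuous_intros; simp)+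
    have half: "(LBINT t. ?I t * (t * c)) = (1/2) * c" for c
    proof -
      have "(LBINT t. t * ?I t) = 1\<^sup>2 / 2 - 0\<^sup>2 / 2"
        by (rule integral_FTC_Icc_real) (auto intro!: derivative_eq_intros)
      then have "(LBINT t. (t * ?I t) * c) = (1/2) * c" by simp
      then show ?thesis by (simp add: mult_ac)
    qed
    have eq: "segment_integral E x h - (E x \<bullet> h + (1/2) * (DE x h \<bullet> h))
        = (LBINT t. ?I t * (E (x + t *\<^sub>R h) \<bullet> h) - ?I t * (E x \<bullet> h) - ?I t * (t * (DE x h \<bullet> h)))"
      using segment_integral_integrable[OF contE, of x h] i1 by (simp add: segment_integral_def half)
    have "norm (LBINT t. ?I t * (E (x + t *\<^sub>R h) \<bullet> h) - ?I t * (E x \<bullet> h) - ?I t * (t * (DE x h \<bullet> h)))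
        \<le> (LBINT t. ?I t * (\<eta> * (norm h)\<^sup>2))"
    proof (rule Bochner_Integration.integral_norm_bound_integral)
      show "integrable lborel (\<lambda>t. ?I t * (\<eta> * (norm h)\<^sup>2))"
        by (intro integrable_indicator_bounded continuous_intros; simp)
      show "integrable lborel (\<lambda>t. ?I t * (E (x + t *\<^sub>R h) \<bullet> h) - ?I t * (E x \<bullet> h) - ?I t * (t * (DE x h \<bullet> h)))"
        by (intro Bochner_Integration.integrable_diff i1 segment_integral_integrable[OF contE])
      fix t :: real
      show "norm (?I t * (E (x + t *\<^sub>R h) \<bullet> h) - ?I t * (E x \<bullet> h) - ?I t * (t * (DE x h \<bullet> h))) \<le> ?I t * (\<eta> * (norm h)\<^sup>2)"
      proof (cases "t \<in> {0..1}")
        case True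
        have "\<bar>(E (x + t *\<^sub>R h) - E x - DE x (t *\<^sub>R h)) \<bullet> h\<bar> \<le> norm (E (x + t *\<^sub>R h) - E x - DE x (t *\<^sub>R h)) * norm h"
          by (rule Cauchy_Schwarz_ineq2)
        also have "\<dots> \<le> (norm h * \<eta>) * norm h"
        proof (rule mult_right_mono)
          have "norm (t *\<^sub>R h) * \<eta> \<le> norm h * \<eta>"
            using True \<eta> by (intro mult_right_mono) (simp_all add: mult_left_le_one_le)
          then show "norm (E (x + t *\<^sub>R h) - E x - DE x (t *\<^sub>R h)) \<le> norm h * \<eta>" using lin[OF True] by linarith
        qed simp
        finally show ?thesis
          using True by (simp add: inner_diff_left blinfun.scaleR_right power2_eq_square mult_ac)
      qed simp
    qed
    then show "\<bar>segment_integral E x h - (E x \<bullet> h + (1/2) * (DE x h \<bullet> h))\<bar> \<le> \<eta> * (norm h)\<^sup>2"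
      unfolding eq by simp
  qed
qed

section \<open>The integral over the points that a step carries into the domain\<close>

definition crossing_integral :: "('a::euclidean_space \<Rightarrow> 'a) \<Rightarrow> 'a set \<Rightarrow> 'a \<Rightarrow> real" where
  "crossing_integral E \<Omega> h =
     (LBINT x. indicator (- \<Omega>) x * indicator \<Omega> (x + h) * segment_integral E x h)"

context
  fixes \<Omega> :: "'a::euclidean_space set" and E :: "'a \<Rightarrow> 'a" and DE :: "'a \<Rightarrow> 'a \<Rightarrow>\<^sub>L 'a" and R :: real
  assumes dom: "bounded_C1_domain \<Omega>"
    and E: "\<And>x. (E has_derivative blinfun_apply (DE x)) (at x)" and DE: "continuous_on UNIV DE"
    and supp: "\<And>x. x \<notin> cball 0 R \<Longrightarrow> E x = 0" and R: "0 \<le> R"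
begin

lemma field_continuous: "continuous_on UNIV E"
  by (rule has_derivative_continuous_on[where f' = "\<lambda>x. blinfun_apply (DE x)"])
    (rule has_derivative_at_withinI[OF E])

lemma field_measurable: "E \<in> borel_measurable borel"
  by (rule borel_measurable_continuous_onI[OF field_continuous])

lemma domain_sets: "\<Omega> \<in> sets borel" "bounded \<Omega>"
  using dom by (auto simp: bounded_C1_domain_def)

lemma field_segment_bound:
  obtains C where "0 \<le> C" "\<And>x h. \<bar>segment_integral E x h\<bar> \<le> C * min 1 (norm h)"
proof -
  have "compact (E ` cball 0 R)"
    by (intro compact_continuous_image continuous_on_subset[OF field_continuous]) auto
  then obtain M where M: "\<And>x. x \<in> cball 0 R \<Longrightarrow> norm (E x) \<le> M"
    by (meson bounded_iff compact_imp_bounded imageI)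
  have M': "norm (E x) \<le> max 0 M" for x
    using M[of x] supp[of x] by (cases "x \<in> cball 0 R") auto
  show ?thesis
    by (rule that[OF _ segment_integral_bound[OF field_continuous M' supp R]]) (use R in auto)
qed

lemma integrable_indicator_domain:
  assumes [measurable]: "f \<in> borel_measurable borel" and c: "\<And>x. \<bar>f x\<bar> \<le> c"
  shows "integrable lborel (\<lambda>x. indicator \<Omega> x * f x :: real)"
proof -
  note [measurable] = domain_sets(1)
  have "integrable lborel (\<lambda>x. indicator \<Omega> x * c)"
    using emeasure_bounded_finite[OF domain_sets(2)] by simp
  then show ?thesis
  proof (rule Bochner_Integration.integrable_bound)
    have "\<bar>f x\<bar> \<le> \<bar>c\<bar>" for x using c[of x] by linarith
    then show "AE x in lborel. norm (indicator \<Omega> x * f x) \<le> norm (indicator \<Omega> x * c)"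
      by (auto simp: indicator_def)
  qed measurable
qed

lemma integrable_indicator_domain_shift:
  assumes [measurable]: "f \<in> borel_measurable borel" and c: "\<And>x. \<bar>f x\<bar> \<le> c"
  shows "integrable lborel (\<lambda>x. indicator \<Omega> (x + h) * f x :: real)"
proof -
  have "integrable lborel (\<lambda>x. indicator \<Omega> x * f (x - h))"
    using c by (intro integrable_indicator_domain) auto
  from integrable_lborel_translation[OF this, of h] show ?thesis by (simp add: add.commute)
qed

text \<open>Strip volume and segment integral contribute one factor \<open>min 1 (norm h)\<close>
  each, whose product matches the integrability of the kernel. Absolute values stand inside because
  Fubini will require them.\<close>

lemma crossing_nn_integral_bound:
  obtains C where "0 \<le> C"
    "\<And>h. (\<integral>\<^sup>+x. ennreal \<bar>indicator (- \<Omega>) x * indicator \<Omega> (x + h) * segment_integral E x h\<bar> \<partial>lborel)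
      \<le> ennreal (C * min 1 ((norm h)\<^sup>2))"
proof -
  note [measurable] = domain_sets(1) field_measurable
  obtain C1 where C1: "0 \<le> C1" "\<And>x h. \<bar>segment_integral E x h\<bar> \<le> C1 * min 1 (norm h)"
    using field_segment_bound by blast
  obtain C2 where C2: "0 \<le> C2" "\<And>h. emeasure lborel {x. x \<notin> \<Omega> \<and> x + h \<in> \<Omega>} \<le> ennreal (C2 * min 1 (norm h))"
    using boundary_strip_bound[OF dom] by blast
  show ?thesis
  proof (rule that[of "C1 * C2"])
    show "0 \<le> C1 * C2" using C1 C2 by simp
    fix h :: 'a
    let ?m = "min 1 (norm h)"
    have "(\<integral>\<^sup>+x. ennreal \<bar>indicator (- \<Omega>) x * indicator \<Omega> (x + h) * segment_integral E x h\<bar> \<partial>lborel)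
        \<le> (\<integral>\<^sup>+x. ennreal (C1 * ?m) * indicator {x. x \<notin> \<Omega> \<and> x + h \<in> \<Omega>} x \<partial>lborel)"
      using C1(2) by (intro nn_integral_mono) (auto simp: indicator_def intro!: ennreal_leI)
    also have "\<dots> = ennreal (C1 * ?m) * emeasure lborel {x. x \<notin> \<Omega> \<and> x + h \<in> \<Omega>}"
      by (rule nn_integral_cmult_indicator) measurable
    also have "\<dots> \<le> ennreal (C1 * ?m) * ennreal (C2 * ?m)"
      by (intro mult_left_mono C2(2)) simp
    also have "\<dots> = ennreal (C1 * C2 * (?m * ?m))"
      using C1(1) C2(1) by (subst ennreal_mult[symmetric]) (auto simp: mult_ac)
    also have "?m * ?m = min 1 ((norm h)\<^sup>2)"
    proof (cases "norm h \<le> 1")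
      case True
      then show ?thesis by (simp add: power2_eq_square mult_le_one)
    next
      case False
      then have "1 \<le> norm h * norm h" using mult_mono[of 1 "norm h" 1 "norm h"] by simp
      then show ?thesis using False by (simp add: power2_eq_square)
    qed
    finally show "(\<integral>\<^sup>+x. ennreal \<bar>indicator (- \<Omega>) x * indicator \<Omega> (x + h) * segment_integral E x h\<bar> \<partial>lborel)
      \<le> ennreal (C1 * C2 * min 1 ((norm h)\<^sup>2))" .
  qed
qed

lemma crossing_integrable:
  "integrable lborel (\<lambda>x. indicator (- \<Omega>) x * indicator \<Omega> (x + h) * segment_integral E x h)"
proof -
  note [measurable] = domain_sets(1) field_measurable
  obtain C where C: "0 \<le> C" "\<And>x h. \<bar>segment_integral E x h\<bar> \<le> C * min 1 (norm h)"
    using field_segment_bound by blast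
  have "integrable lborel (\<lambda>x. indicator \<Omega> (x + h) * (indicator (- \<Omega>) x * segment_integral E x h))"
    by (rule integrable_indicator_domain_shift[where c = "C * min 1 (norm h)"])
      (use C in \<open>auto simp: indicator_def\<close>)
  then show ?thesis by (simp add: mult_ac)
qed

lemma crossing_integral_bound:
  obtains C where "0 \<le> C" "\<And>h. \<bar>crossing_integral E \<Omega> h\<bar> \<le> C * min 1 ((norm h)\<^sup>2)"
proof -
  obtain C where C: "0 \<le> C"
    "\<And>h. (\<integral>\<^sup>+x. ennreal \<bar>indicator (- \<Omega>) x * indicator \<Omega> (x + h) * segment_integral E x h\<bar> \<partial>lborel)
      \<le> ennreal (C * min 1 ((norm h)\<^sup>2))"
    using crossing_nn_integral_bound by blast
  have "ennreal \<bar>crossing_integral E \<Omega> h\<bar> \<le> ennreal (C * min 1 ((norm h)\<^sup>2))" for h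
    using integral_norm_bound_ennreal[OF crossing_integrable[of h]] C(2)[of h]
    unfolding crossing_integral_def real_norm_def by (rule order_trans)
  then show ?thesis using C(1) by (intro that[OF C(1)]) (simp add: ennreal_le_iff)
qed

text \<open>Translation by \<open>h\<close> and reversal of segments turn the term for
  \<open>- h\<close> into minus the integral over the points that \<open>h\<close> carries out of
  \<open>\<Omega>\<close>. Entering minus leaving is a difference of two indicators, so the
  condition of crossing disappears.\<close>

lemma crossing_integral_symmetrised:
  "crossing_integral E \<Omega> h + crossing_integral E \<Omega> (- h)
    = - (LBINT x. indicator \<Omega> x * (segment_integral E x h + segment_integral E x (- h)))"
proof -
  note [measurable] = domain_sets(1) field_measurable
  obtain C where C: "0 \<le> C" "\<And>x h. \<bar>segment_integral E x h\<bar> \<le> C * min 1 (norm h)"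
    using field_segment_bound by blast
  have int: "integrable lborel (\<lambda>x. indicator \<Omega> x * segment_integral E x k)"
    "integrable lborel (\<lambda>x. indicator \<Omega> (x + h) * segment_integral E x k)" for k
    by (rule integrable_indicator_domain[where c = "C * min 1 (norm k)"]
          integrable_indicator_domain_shift[where c = "C * min 1 (norm k)"];
        use C in simp)+
  have shift: "segment_integral E (x - h) h = - segment_integral E x (- h)" for x
    using segment_integral_reverse[OF field_continuous, of "x - h" h] by simp
  have "crossing_integral E \<Omega> (- h)
      = (LBINT x. indicator (- \<Omega>) (h + x) * indicator \<Omega> ((h + x) + - h) * segment_integral E (h + x) (- h))"
    unfolding crossing_integral_def by (rule integral_lborel_translation[symmetric]) measurable
  also have "\<dots> = (LBINT x. - (indicator (- \<Omega>) (x + h) * indicator \<Omega> x * segment_integral E x h))"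
    using segment_integral_reverse[OF field_continuous, of _ h]
    by (intro Bochner_Integration.integral_cong refl) (simp add: add.commute)
  finally have neg: "crossing_integral E \<Omega> (- h)
      = (LBINT x. - (indicator (- \<Omega>) (x + h) * indicator \<Omega> x * segment_integral E x h))" .
  have int_neg: "integrable lborel (\<lambda>x. - (indicator (- \<Omega>) (x + h) * indicator \<Omega> x * segment_integral E x h))"
  proof -
    have "integrable lborel (\<lambda>x. indicator \<Omega> x * (- indicator (- \<Omega>) (x + h) * segment_integral E x h))"
      by (rule integrable_indicator_domain[where c = "C * min 1 (norm h)"])
        (use C in \<open>auto simp: indicator_def\<close>)
    then show ?thesis by (simp add: mult_ac)
  qed
  have "crossing_integral E \<Omega> h + crossing_integral E \<Omega> (- h)
      = (LBINT x. indicator (- \<Omega>) x * indicator \<Omega> (x + h) * segment_integral E x h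
          + - (indicator (- \<Omega>) (x + h) * indicator \<Omega> x * segment_integral E x h))"
    unfolding neg unfolding crossing_integral_def
    by (rule Bochner_Integration.integral_add[OF crossing_integrable int_neg, symmetric])
  \<comment> \<open>With \<open>a\<close> and \<open>b\<close> the indicators at \<open>x\<close>
    and \<open>x + h\<close>, this is \<open>(1 - a) * b - a * (1 - b) = b - a\<close>.\<close>
  also have "\<dots> = (LBINT x. indicator \<Omega> (x + h) * segment_integral E x h - indicator \<Omega> x * segment_integral E x h)"
    by (intro Bochner_Integration.integral_cong refl) (auto simp: indicator_def)
  also have "\<dots> = (LBINT x. indicator \<Omega> (x + h) * segment_integral E x h) - (LBINT x. indicator \<Omega> x * segment_integral E x h)"
    by (rule Bochner_Integration.integral_diff[OF int(2,1)])
  \<comment> \<open>A translation by \<open>- h\<close> brings this domain back to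
    \<open>\<Omega>\<close>, and reversal makes the segment start there.\<close>
  also have "(LBINT x. indicator \<Omega> (x + h) * segment_integral E x h)
      = (LBINT x. indicator \<Omega> (- h + x + h) * segment_integral E (- h + x) h)"
    by (rule integral_lborel_translation[symmetric]) measurable
  also have "\<dots> = - (LBINT x. indicator \<Omega> x * segment_integral E x (- h))"
    using shift by simp
  finally show ?thesis using int(1) by (simp add: distrib_left)
qed

text \<open>In the sum over \<open>h\<close> and \<open>- h\<close> the linear terms
  \<open>E x \<bullet> h\<close> cancel, and the two halves of the quadratic term add up to a whole
  one.\<close>

lemma crossing_integral_expansion:
  assumes "0 < \<eta>"
  obtains \<delta> where "0 < \<delta>" "\<And>h. norm h \<le> \<delta> \<Longrightarrow>
    \<bar>crossing_integral E \<Omega> h + crossing_integral E \<Omega> (- h) + (LBINT x. indicator \<Omega> x * (DE x h \<bullet> h))\<bar>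
      \<le> \<eta> * (norm h)\<^sup>2"
proof -
  note [measurable] = domain_sets(1) field_measurable
  define V where "V = measure lborel \<Omega>"
  have "0 \<le> V" by (simp add: V_def)
  \<comment> \<open>The error occurs for both signs of \<open>h\<close> and is integrated over
    volume \<open>V\<close>; the added \<open>1\<close> avoids a zero denominator.\<close>
  define \<eta>' where "\<eta>' = \<eta> / (2 * (V + 1))"
  have \<eta>': "0 < \<eta>'" "2 * \<eta>' * V \<le> \<eta>"
    using assms \<open>0 \<le> V\<close> by (auto simp: \<eta>'_def field_simps)
  obtain C where C: "0 \<le> C" "\<And>x h. \<bar>segment_integral E x h\<bar> \<le> C * min 1 (norm h)"
    using field_segment_bound by blast
  obtain \<delta> where \<delta>: "0 < \<delta>" "\<And>x h. x \<in> \<Omega> \<Longrightarrow> norm h \<le> \<delta> \<Longrightarrow>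
    \<bar>segment_integral E x h - (E x \<bullet> h + (1/2) * (DE x h \<bullet> h))\<bar> \<le> \<eta>' * (norm h)\<^sup>2"
    using segment_integral_expansion[OF E DE domain_sets(2) \<eta>'(1)] by blast
  show ?thesis
  proof (rule that[OF \<delta>(1)])
    fix h :: 'a assume h: "norm h \<le> \<delta>"
    have i1: "integrable lborel (\<lambda>x. indicator \<Omega> x * (segment_integral E x h + segment_integral E x (- h)))"
    proof (rule integrable_indicator_domain[where c = "2 * (C * min 1 (norm h))"])
      show "\<bar>segment_integral E x h + segment_integral E x (- h)\<bar> \<le> 2 * (C * min 1 (norm h))" for x
        using C(2)[of x h] C(2)[of x "- h"] by simp
    qed measurable
    have i2: "integrable lborel (\<lambda>x. indicator \<Omega> x * (DE x h \<bullet> h))"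
      by (intro integrable_indicator_bounded continuous_intros DE domain_sets)
    have i3: "integrable lborel (\<lambda>x. indicator \<Omega> x * (2 * \<eta>' * (norm h)\<^sup>2))"
      using emeasure_bounded_finite[OF domain_sets(2)] by simp
    have "norm (LBINT x. indicator \<Omega> x * (DE x h \<bullet> h) - indicator \<Omega> x * (segment_integral E x h + segment_integral E x (- h)))
        \<le> (LBINT x. indicator \<Omega> x * (2 * \<eta>' * (norm h)\<^sup>2))"
    proof (rule Bochner_Integration.integral_norm_bound_integral[OF Bochner_Integration.integrable_diff[OF i2 i1] i3])
      fix x
      show "norm (indicator \<Omega> x * (DE x h \<bullet> h) - indicator \<Omega> x * (segment_integral E x h + segment_integral E x (- h)))
          \<le> indicator \<Omega> x * (2 * \<eta>' * (norm h)\<^sup>2)"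
      proof (cases "x \<in> \<Omega>")
        case True
        then show ?thesis
          using \<delta>(2)[OF True h] \<delta>(2)[OF True, of "- h"] h
          by (simp add: blinfun.minus_right abs_le_iff)
      qed simp
    qed
    also have "\<dots> = (2 * \<eta>' * V) * (norm h)\<^sup>2" by (simp add: V_def)
    also have "\<dots> \<le> \<eta> * (norm h)\<^sup>2" by (intro mult_right_mono \<eta>'(2)) simp
    finally show "\<bar>crossing_integral E \<Omega> h + crossing_integral E \<Omega> (- h) + (LBINT x. indicator \<Omega> x * (DE x h \<bullet> h))\<bar>
      \<le> \<eta> * (norm h)\<^sup>2"
      using i1 i2 by (simp add: crossing_integral_symmetrised)
  qed
qed

text \<open>Separates \<open>h\<close> from \<open>x\<close>, so that only products of two
  coordinates of \<open>h\<close> meet the kernel.\<close>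

lemma quadratic_form_expansion:
  "(LBINT x. indicator \<Omega> x * (DE x h \<bullet> h))
    = (\<Sum>b\<in>Basis. \<Sum>c\<in>Basis. (h \<bullet> b) * (h \<bullet> c) * (LBINT x. indicator \<Omega> x * (DE x b \<bullet> c)))"
proof -
  have int: "integrable lborel (\<lambda>x. indicator \<Omega> x * (DE x b \<bullet> c))" for b c
    by (intro integrable_indicator_bounded continuous_intros DE domain_sets)
  have "DE x h \<bullet> h = (\<Sum>b\<in>Basis. \<Sum>c\<in>Basis. (h \<bullet> b) * (h \<bullet> c) * (DE x b \<bullet> c))" for x
  proof -
    have "DE x h = (\<Sum>b\<in>Basis. (h \<bullet> b) *\<^sub>R DE x b)"
      by (subst euclidean_representation[of h, symmetric])
        (simp only: blinfun.sum_right blinfun.scaleR_right)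
    then have "DE x h \<bullet> h = (\<Sum>b\<in>Basis. (h \<bullet> b) * (DE x b \<bullet> h))"
      by (simp add: inner_sum_left)
    also have "\<dots> = (\<Sum>b\<in>Basis. \<Sum>c\<in>Basis. (h \<bullet> b) * (h \<bullet> c) * (DE x b \<bullet> c))"
    proof (rule sum.cong[OF refl])
      fix b :: 'a
      show "(h \<bullet> b) * (DE x b \<bullet> h) = (\<Sum>c\<in>Basis. (h \<bullet> b) * (h \<bullet> c) * (DE x b \<bullet> c))"
        by (simp only: euclidean_inner[of "DE x b" h] sum_distrib_left) (simp add: mult_ac)
    qed
    finally show ?thesis .
  qed
  then have "(LBINT x. indicator \<Omega> x * (DE x h \<bullet> h))
      = (LBINT x. (\<Sum>b\<in>Basis. \<Sum>c\<in>Basis. (h \<bullet> b) * (h \<bullet> c) * (indicator \<Omega> x * (DE x b \<bullet> c))))"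
    by (intro Bochner_Integration.integral_cong refl) (simp only: sum_distrib_left mult.left_commute)
  also have "\<dots> = (\<Sum>b\<in>Basis. \<integral>x. (\<Sum>c\<in>Basis. (h \<bullet> b) * (h \<bullet> c) * (indicator \<Omega> x * (DE x b \<bullet> c))) \<partial>lborel)"
    by (intro Bochner_Integration.integral_sum Bochner_Integration.integrable_sum integrable_mult_right int)
  also have "\<dots> = (\<Sum>b\<in>Basis. \<Sum>c\<in>Basis. \<integral>x. (h \<bullet> b) * (h \<bullet> c) * (indicator \<Omega> x * (DE x b \<bullet> c)) \<partial>lborel)"
    by (intro sum.cong refl Bochner_Integration.integral_sum integrable_mult_right int)
  finally show ?thesis by simp
qed

end

section \<open>Isotropic kernels\<close>

text \<open>A Householder reflection. For a basis vector \<open>u\<close> and \<open>c = 2\<close>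
  it flips one coordinate; for the difference \<open>u\<close> of two basis vectors and
  \<open>c = 1\<close> it exchanges two.\<close>

lemma orthogonal_transformation_reflection:
  fixes u :: "'a::euclidean_space"
  assumes "c * (u \<bullet> u) = 2"
  shows "orthogonal_transformation (\<lambda>h. h - (c * (h \<bullet> u)) *\<^sub>R u)"
proof -
  have "linear (\<lambda>h. h - (c * (h \<bullet> u)) *\<^sub>R u)"
    by (intro linearI) (simp_all add: inner_add_left algebra_simps)
  moreover have "norm (h - (c * (h \<bullet> u)) *\<^sub>R u) = norm h" for h
  proof -
    have "(norm (h - (c * (h \<bullet> u)) *\<^sub>R u))\<^sup>2
        = h \<bullet> h - 2 * (c * (h \<bullet> u)\<^sup>2) + (c * (u \<bullet> u)) * (c * (h \<bullet> u)\<^sup>2)"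
      unfolding power2_norm_eq_inner
      by (simp add: inner_diff_left inner_diff_right inner_commute power2_eq_square algebra_simps)
    also have "\<dots> = (norm h)\<^sup>2" unfolding assms by (simp add: power2_norm_eq_inner)
    finally show ?thesis by simp
  qed
  ultimately show ?thesis by (simp add: orthogonal_transformation)
qed

text \<open>A Borel representative of a radial Lebesgue measurable density need not be radial everywhere.\<close>

definition isotropic_kernel :: "('a::euclidean_space \<Rightarrow> real) \<Rightarrow> bool" where
  "isotropic_kernel \<nu> \<longleftrightarrow> \<nu> \<in> borel_measurable borel \<and> (\<forall>h. 0 \<le> \<nu> h) \<and>
     integrable lborel (\<lambda>h. min 1 ((norm h)\<^sup>2) * \<nu> h) \<and>
     (\<forall>T. orthogonal_transformation T \<longrightarrow> (AE h in lborel. \<nu> (T h) = \<nu> h))"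

context
  fixes \<nu> :: "'a::euclidean_space \<Rightarrow> real"
  assumes \<nu>: "isotropic_kernel \<nu>"
begin

lemma kernel_measurable: "\<nu> \<in> borel_measurable borel"
  and kernel_nonneg: "0 \<le> \<nu> h"
  and kernel_integrable: "integrable lborel (\<lambda>h. min 1 ((norm h)\<^sup>2) * \<nu> h)"
  using \<nu> by (simp_all add: isotropic_kernel_def)

lemma kernel_integral_orthogonal:
  assumes T: "orthogonal_transformation T" and [measurable]: "f \<in> borel_measurable borel"
  shows "(LBINT h. \<nu> h * f (T h)) = (LBINT h. \<nu> h * (f h :: real))"
proof -
  note [measurable] = kernel_measurable orthogonal_transformation_measurable[OF T]
  have "(LBINT h. \<nu> h * f h) = (\<integral>h. \<nu> h * f h \<partial>distr lborel borel T)"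
    by (simp add: lborel_distr_orthogonal_transformation[OF T])
  also have "\<dots> = (LBINT h. \<nu> (T h) * f (T h))"
    by (rule integral_distr) measurable
  also have "\<dots> = (LBINT h. \<nu> h * f (T h))"
  proof (rule integral_cong_AE)
    have "AE h in lborel. \<nu> (T h) = \<nu> h" using \<nu> T by (simp add: isotropic_kernel_def)
    then show "AE h in lborel. \<nu> (T h) * f (T h) = \<nu> h * f (T h)" by eventually_elim simp
  qed measurable
  finally show ?thesis by simp
qed

lemma kernel_integrable_bound:
  assumes [measurable]: "f \<in> borel_measurable borel" and c: "\<And>h. \<bar>f h\<bar> \<le> c * min 1 ((norm h)\<^sup>2)"
  shows "integrable lborel (\<lambda>h. \<nu> h * f h :: real)"
proof -
  note [measurable] = kernel_measurable
  have "integrable lborel (\<lambda>h. c * (min 1 ((norm h)\<^sup>2) * \<nu> h))"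
    using kernel_integrable by simp
  then show ?thesis
  proof (rule Bochner_Integration.integrable_bound)
    have "\<nu> h * \<bar>f h\<bar> \<le> \<bar>c * (min 1 ((norm h)\<^sup>2) * \<nu> h)\<bar>" for h
    proof -
      have "\<nu> h * \<bar>f h\<bar> \<le> \<nu> h * (c * min 1 ((norm h)\<^sup>2))" by (intro mult_left_mono c kernel_nonneg)
      also have "\<dots> \<le> \<bar>c * (min 1 ((norm h)\<^sup>2) * \<nu> h)\<bar>" by (simp add: mult_ac)
      finally show ?thesis .
    qed
    then show "AE h in lborel. norm (\<nu> h * f h) \<le> norm (c * (min 1 ((norm h)\<^sup>2) * \<nu> h))"
      using kernel_nonneg by (simp add: abs_mult)
  qed measurable
qed

lemma kernel_tail_integrable:
  assumes "0 < \<delta>"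
  shows "integrable lborel (\<lambda>h. \<nu> h * indicator {h. \<delta> < norm h} h)"
proof (rule kernel_integrable_bound[where c = "1 / min 1 (\<delta>\<^sup>2)"])
  fix h :: 'a
  show "\<bar>indicator {h. \<delta> < norm h} h\<bar> \<le> 1 / min 1 (\<delta>\<^sup>2) * min 1 ((norm h)\<^sup>2)"
  proof (cases "\<delta> < norm h")
    case True
    then have "\<delta>\<^sup>2 \<le> (norm h)\<^sup>2" using assms by (intro power_mono) auto
    then have "min 1 (\<delta>\<^sup>2) \<le> min 1 ((norm h)\<^sup>2)" by (rule min.mono[OF order_refl])
    moreover have "0 < min 1 (\<delta>\<^sup>2)" using assms by simp
    ultimately show ?thesis using True by (simp add: field_simps)
  next
    case False
    have "0 \<le> min 1 ((norm h)\<^sup>2) / min 1 (\<delta>\<^sup>2)" by (intro divide_nonneg_nonneg) auto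
    then show ?thesis using False by simp
  qed
qed measurable

lemma truncated_product_measurable:
  "(\<lambda>h. indicator (cball 0 \<delta>) h * ((h \<bullet> u) * (h \<bullet> v)) :: real) \<in> borel_measurable (borel :: 'a measure)"
  by (intro borel_measurable_times borel_measurable_indicator borel_closed closed_cball) simp_all

lemma truncated_second_moment_integrable:
  assumes "0 < \<delta>" "\<delta> \<le> 1"
  shows "integrable lborel (\<lambda>h. \<nu> h * (indicator (cball 0 \<delta>) h * ((h \<bullet> u) * (h \<bullet> v))))"
proof (rule kernel_integrable_bound[where c = "norm u * norm v"])
  fix h :: 'a
  have "\<bar>(h \<bullet> u) * (h \<bullet> v)\<bar> \<le> (norm h * norm u) * (norm h * norm v)"
    unfolding abs_mult by (intro mult_mono Cauchy_Schwarz_ineq2) auto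
  moreover have "min 1 ((norm h)\<^sup>2) = (norm h)\<^sup>2" if "norm h \<le> \<delta>"
    using that assms by (simp add: power_le_one)
  ultimately show "\<bar>indicator (cball 0 \<delta>) h * ((h \<bullet> u) * (h \<bullet> v))\<bar> \<le> norm u * norm v * min 1 ((norm h)\<^sup>2)"
    by (auto simp: indicator_def power2_eq_square mult_ac)
qed (rule truncated_product_measurable)

text \<open>Flipping one coordinate changes the sign of the mixed moments, so they vanish.
  Exchanging two coordinates makes the diagonal moments equal, and their sum is the moment of
  \<open>(norm h)\<^sup>2\<close>.\<close>

lemma truncated_second_moment:
  assumes \<delta>: "0 < \<delta>" "\<delta> \<le> 1" and b: "b \<in> Basis" and c: "c \<in> Basis"
  shows "(LBINT h. \<nu> h * (indicator (cball 0 \<delta>) h * ((h \<bullet> b) * (h \<bullet> c))))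
    = (if b = c then (LBINT h. \<nu> h * (indicator (cball 0 \<delta>) h * (norm h)\<^sup>2)) / real DIM('a) else 0)"
proof -
  define m where "m u v = (LBINT h. \<nu> h * (indicator (cball 0 \<delta>) h * ((h \<bullet> u) * (h \<bullet> v))))" for u v :: 'a
  have inv: "(LBINT h. \<nu> h * (indicator (cball 0 \<delta>) h * ((T h \<bullet> u) * (T h \<bullet> v)))) = m u v"
    if T: "orthogonal_transformation T" for T u v
    using kernel_integral_orthogonal[OF T truncated_product_measurable, of \<delta> u v]
      orthogonal_transformation_norm[OF T]
    by (simp add: m_def indicator_def)
  have off: "m b c = 0" if "b \<in> Basis" "c \<in> Basis" "b \<noteq> c" for b c
  proof -
    let ?T = "\<lambda>h. h - (2 * (h \<bullet> b)) *\<^sub>R b"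
    have "orthogonal_transformation ?T"
      using that by (intro orthogonal_transformation_reflection) simp
    moreover have "(?T h \<bullet> b) * (?T h \<bullet> c) = - ((h \<bullet> b) * (h \<bullet> c))" for h
      using that by (simp add: inner_diff_left inner_not_same_Basis)
    ultimately show ?thesis using inv[of ?T b c] by (simp add: m_def)
  qed
  have diag: "m b b = m c c" if "b \<in> Basis" "c \<in> Basis" for b c
  proof (cases "b = c")
    case False
    let ?T = "\<lambda>h. h - (1 * (h \<bullet> (b - c))) *\<^sub>R (b - c)"
    have "orthogonal_transformation ?T"
      using that False
      by (intro orthogonal_transformation_reflection)
        (simp add: inner_diff_left inner_diff_right inner_not_same_Basis)
    moreover have "?T h \<bullet> b = h \<bullet> c" for h
      using that False by (simp add: inner_diff_left inner_diff_right inner_not_same_Basis)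
    ultimately show ?thesis using inv[of ?T b b] by (simp add: m_def)
  qed simp
  have "(LBINT h. \<nu> h * (indicator (cball 0 \<delta>) h * (norm h)\<^sup>2))
      = (LBINT h. (\<Sum>i\<in>Basis. \<nu> h * (indicator (cball 0 \<delta>) h * ((h \<bullet> i) * (h \<bullet> i)))))"
    by (intro Bochner_Integration.integral_cong refl)
      (simp only: power2_norm_eq_inner sum_distrib_left[symmetric] euclidean_inner[symmetric])
  also have "\<dots> = (\<Sum>i\<in>Basis. m i i)"
    unfolding m_def by (intro Bochner_Integration.integral_sum truncated_second_moment_integrable \<delta>)
  also have "\<dots> = (\<Sum>i\<in>(Basis::'a set). m b b)" using diag[OF _ b] by (intro sum.cong) auto
  also have "\<dots> = real DIM('a) * m b b" by simp
  finally have "(LBINT h. \<nu> h * (indicator (cball 0 \<delta>) h * (norm h)\<^sup>2)) = real DIM('a) * m b b" .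
  then show ?thesis using off[OF b c] by (auto simp: m_def)
qed

end

text \<open>The quantity whose limit is sought, with the product of the two kernels replaced by one
  Borel function and all integrals taken over \<open>lborel\<close>.\<close>

definition boundary_flux :: "('a::euclidean_space \<Rightarrow> 'a) \<Rightarrow> 'a set \<Rightarrow> ('a \<Rightarrow> real) \<Rightarrow> real" where
  "boundary_flux E \<Omega> \<nu> =
     (LBINT x. indicator (- \<Omega>) x * (-2 * (LBINT y. indicator \<Omega> y * (\<nu> (y - x) * segment_integral E x (y - x)))))"

section \<open>The estimate for a single kernel\<close>

context
  fixes \<Omega> :: "'a::euclidean_space set" and E :: "'a \<Rightarrow> 'a" and DE :: "'a \<Rightarrow> 'a \<Rightarrow>\<^sub>L 'a" and R :: real
  assumes dom: "bounded_C1_domain \<Omega>"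
    and E: "\<And>x. (E has_derivative blinfun_apply (DE x)) (at x)" and DE: "continuous_on UNIV DE"
    and supp: "\<And>x. x \<notin> cball 0 R \<Longrightarrow> E x = 0" and R: "0 \<le> R"
begin

lemma crossing_integral_measurable: "crossing_integral E \<Omega> \<in> borel_measurable borel"
proof -
  note [measurable] = domain_sets(1)[OF dom E DE supp R] field_measurable[OF dom E DE supp R]
  show ?thesis unfolding crossing_integral_def[abs_def] by measurable
qed

text \<open>Substitute \<open>y = x + h\<close>, exchange the integrals and average over
  \<open>h\<close> and \<open>- h\<close>; the average absorbs the factor \<open>2\<close>.\<close>

lemma boundary_flux_eq_crossing:
  assumes \<nu>: "isotropic_kernel \<nu>"
  shows "boundary_flux E \<Omega> \<nu>
    = - (LBINT h. \<nu> h * (crossing_integral E \<Omega> h + crossing_integral E \<Omega> (- h)))"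
proof -
  note [measurable] = domain_sets(1)[OF dom E DE supp R] field_measurable[OF dom E DE supp R] kernel_measurable[OF \<nu>]
    crossing_integral_measurable
  let ?k = "\<lambda>x h. indicator (- \<Omega>) x * indicator \<Omega> (x + h) * segment_integral E x h"
  let ?f = "\<lambda>x h. \<nu> h * ?k x h"
  obtain C where C: "0 \<le> C"
    "\<And>h. (\<integral>\<^sup>+x. ennreal \<bar>?k x h\<bar> \<partial>lborel) \<le> ennreal (C * min 1 ((norm h)\<^sup>2))"
    using crossing_nn_integral_bound[OF dom E DE supp R] by blast
  obtain C' where C': "0 \<le> C'" "\<And>h. \<bar>crossing_integral E \<Omega> h\<bar> \<le> C' * min 1 ((norm h)\<^sup>2)"
    using crossing_integral_bound[OF dom E DE supp R] by blast
  have int: "integrable (lborel \<Otimes>\<^sub>M lborel) (\<lambda>(x, h). ?f x h)"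
  proof (rule integrableI_bounded)
    have "(\<integral>\<^sup>+p. ennreal (norm (case p of (x, h) \<Rightarrow> ?f x h)) \<partial>(lborel \<Otimes>\<^sub>M lborel))
        = (\<integral>\<^sup>+h. (\<integral>\<^sup>+x. ennreal \<bar>?f x h\<bar> \<partial>lborel) \<partial>lborel)"
      by (subst lborel_pair.nn_integral_snd[symmetric]) simp_all
    also have "\<dots> \<le> (\<integral>\<^sup>+h. ennreal (C * (min 1 ((norm h)\<^sup>2) * \<nu> h)) \<partial>lborel)"
    proof (intro nn_integral_mono)
      fix h :: 'a
      have "(\<integral>\<^sup>+x. ennreal \<bar>?f x h\<bar> \<partial>lborel) = (\<integral>\<^sup>+x. ennreal (\<nu> h) * ennreal \<bar>?k x h\<bar> \<partial>lborel)"
        using kernel_nonneg[OF \<nu>, of h] by (intro nn_integral_cong) (simp add: abs_mult ennreal_mult)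
      also have "\<dots> = ennreal (\<nu> h) * (\<integral>\<^sup>+x. ennreal \<bar>?k x h\<bar> \<partial>lborel)"
        by (rule nn_integral_cmult) measurable
      also have "\<dots> \<le> ennreal (\<nu> h) * ennreal (C * min 1 ((norm h)\<^sup>2))"
        by (intro mult_left_mono C(2)) simp
      also have "\<dots> = ennreal (C * (min 1 ((norm h)\<^sup>2) * \<nu> h))"
        using C(1) kernel_nonneg[OF \<nu>, of h] by (subst ennreal_mult[symmetric]) (auto simp: mult_ac)
      finally show "(\<integral>\<^sup>+x. ennreal \<bar>?f x h\<bar> \<partial>lborel) \<le> ennreal (C * (min 1 ((norm h)\<^sup>2) * \<nu> h))" .
    qed
    also have "\<dots> < \<infinity>"
    proof -
      have "integrable lborel (\<lambda>h. C * (min 1 ((norm h)\<^sup>2) * \<nu> h))" using kernel_integrable[OF \<nu>] by simp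
      moreover have "0 \<le> C * (min 1 ((norm h)\<^sup>2) * \<nu> h)" for h using C(1) kernel_nonneg[OF \<nu>, of h] by simp
      ultimately show ?thesis by (subst nn_integral_eq_integral) auto
    qed
    finally show "(\<integral>\<^sup>+p. ennreal (norm (case p of (x, h) \<Rightarrow> ?f x h)) \<partial>(lborel \<Otimes>\<^sub>M lborel)) < \<infinity>" .
  qed measurable
  have "indicator (- \<Omega>) x * (-2 * (LBINT y. indicator \<Omega> y * (\<nu> (y - x) * segment_integral E x (y - x))))
      = -2 * (LBINT h. ?f x h)" for x
  proof -
    have "(LBINT y. indicator \<Omega> y * (\<nu> (y - x) * segment_integral E x (y - x)))
        = (LBINT h. indicator \<Omega> (x + h) * (\<nu> ((x + h) - x) * segment_integral E x ((x + h) - x)))"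
      by (rule integral_lborel_translation[symmetric]) measurable
    then have "indicator (- \<Omega>) x * (LBINT y. indicator \<Omega> y * (\<nu> (y - x) * segment_integral E x (y - x)))
        = (LBINT h. indicator (- \<Omega>) x * (indicator \<Omega> (x + h) * (\<nu> h * segment_integral E x h)))"
      by simp
    also have "\<dots> = (LBINT h. ?f x h)"
      by (intro Bochner_Integration.integral_cong refl) (simp only: mult_ac)
    finally show ?thesis by (simp only: mult_ac)
  qed
  then have "boundary_flux E \<Omega> \<nu>
      = -2 * (LBINT x. (LBINT h. ?f x h))" by (simp only: boundary_flux_def integral_mult_right_zero)
  also have "(LBINT x. (LBINT h. ?f x h)) = (LBINT h. (LBINT x. ?f x h))"
    by (rule lborel_pair.Fubini_integral[OF int, symmetric])
  also have "\<dots> = (LBINT h. \<nu> h * crossing_integral E \<Omega> h)"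
    by (simp add: crossing_integral_def)
  finally have I: "boundary_flux E \<Omega> \<nu>
      = -2 * (LBINT h. \<nu> h * crossing_integral E \<Omega> h)" .
  \<comment> \<open>Evenness of the kernel is its invariance under the orthogonal map
    \<open>uminus\<close>.\<close>
  have neg: "(LBINT h. \<nu> h * crossing_integral E \<Omega> (- h)) = (LBINT h. \<nu> h * crossing_integral E \<Omega> h)"
    by (rule kernel_integral_orthogonal[OF \<nu>, of uminus "crossing_integral E \<Omega>"])
      (auto simp: orthogonal_transformation_def linear_uminus)
  have "integrable lborel (\<lambda>h. \<nu> h * crossing_integral E \<Omega> h)" "integrable lborel (\<lambda>h. \<nu> h * crossing_integral E \<Omega> (- h))"
    using C'(2) C'(2)[of "- _"] by (auto intro!: kernel_integrable_bound[OF \<nu>, of _ C'])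
  then show ?thesis unfolding I by (simp add: neg distrib_left)
qed

text \<open>\<open>\<delta>\<close> and \<open>K\<close> are chosen before the kernel, so the
  estimate is uniform along the family and the kernel enters the error only through its mass outside
  radius \<open>\<delta>\<close>. Inside, the quadratic expansion and isotropy apply; outside,
  everything is bounded.\<close>

lemma boundary_flux_estimate:
  assumes \<eta>: "0 < \<eta>"
  shows "\<exists>\<delta> K. 0 < \<delta> \<and> 0 \<le> K \<and>
    (\<forall>\<nu>. isotropic_kernel \<nu> \<longrightarrow> (LBINT h. min 1 ((norm h)\<^sup>2) * \<nu> h) = real DIM('a) \<longrightarrow>
      \<bar>boundary_flux E \<Omega> \<nu>
        - (\<Sum>b\<in>Basis. \<integral>x. indicator \<Omega> x * (DE x b \<bullet> b) \<partial>lborel)\<bar>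
      \<le> \<eta> + K * (LBINT h. \<nu> h * indicator {h. \<delta> < norm h} h))"
proof -
  note [measurable] = crossing_integral_measurable
  define A where "A b c = (LBINT x. indicator \<Omega> x * (DE x b \<bullet> c))" for b c
  define T where "T = (\<Sum>b\<in>Basis. A b b)"
  define K where "K h = crossing_integral E \<Omega> h + crossing_integral E \<Omega> (- h)" for h
  have [measurable]: "K \<in> borel_measurable borel" unfolding K_def by measurable
  let ?Q = "\<lambda>h. \<Sum>b\<in>Basis. \<Sum>c\<in>Basis. (h \<bullet> b) * (h \<bullet> c) * A b c"
  let ?d = "real DIM('a)"
  have d: "1 \<le> ?d" using DIM_positive[where 'a = 'a] by linarith
  \<comment> \<open>The tolerance is divided by the dimension because the second moment of the
    kernel inside the ball is at most \<open>DIM('a)\<close>.\<close>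
  obtain \<delta>\<^sub>0 where \<delta>\<^sub>0: "0 < \<delta>\<^sub>0" "\<And>h. norm h \<le> \<delta>\<^sub>0 \<Longrightarrow>
    \<bar>K h + (LBINT x. indicator \<Omega> x * (DE x h \<bullet> h))\<bar> \<le> (\<eta> / ?d) * (norm h)\<^sup>2"
    using crossing_integral_expansion[OF dom E DE supp R, of "\<eta> / ?d"] \<eta> d unfolding K_def by auto
  obtain C where C: "0 \<le> C" "\<And>h. \<bar>crossing_integral E \<Omega> h\<bar> \<le> C * min 1 ((norm h)\<^sup>2)"
    using crossing_integral_bound[OF dom E DE supp R] by blast
  have KC: "\<bar>K h\<bar> \<le> 2 * C * min 1 ((norm h)\<^sup>2)" for h
    using C(2)[of h] C(2)[of "- h"] unfolding K_def by simp
  define \<delta> where "\<delta> = min \<delta>\<^sub>0 1"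
  have \<delta>: "0 < \<delta>" "\<delta> \<le> 1" "\<delta> \<le> \<delta>\<^sub>0" using \<delta>\<^sub>0(1) by (auto simp: \<delta>_def)
  have KQ: "\<bar>K h + ?Q h\<bar> \<le> (\<eta> / ?d) * (norm h)\<^sup>2" if "norm h \<le> \<delta>" for h
  proof -
    have "(LBINT x. indicator \<Omega> x * (DE x h \<bullet> h)) = ?Q h"
      unfolding A_def by (rule quadratic_form_expansion[OF dom E DE supp R])
    then show ?thesis using \<delta>\<^sub>0(2)[of h] that \<delta>(3) by simp
  qed
  show ?thesis
  \<comment> \<open>\<open>2 * C\<close> bounds the contribution of large \<open>h\<close>, and
    \<open>\<bar>T\<bar>\<close> accounts for the part of the total mass that is missing from the
    truncated second moment.\<close>
  proof (rule exI[of _ \<delta>], rule exI[of _ "2 * C + \<bar>T\<bar>"], intro conjI allI impI)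
    show "0 < \<delta>" "0 \<le> 2 * C + \<bar>T\<bar>" using \<delta> C by simp_all
    fix \<nu> :: "'a \<Rightarrow> real"
    assume \<nu>: "isotropic_kernel \<nu>" and mass: "(LBINT h. min 1 ((norm h)\<^sup>2) * \<nu> h) = ?d"
    note [measurable] = kernel_measurable[OF \<nu>]
    let ?in = "\<lambda>h. indicator (cball 0 \<delta>) h :: real" and ?out = "\<lambda>h. indicator {h. \<delta> < norm h} h :: real"
    have in_out: "?in h + ?out h = 1" for h :: 'a by (simp add: indicator_def)
    define \<tau> where "\<tau> = (LBINT h. \<nu> h * ?out h)"
    note tail = kernel_tail_integrable[OF \<nu> \<delta>(1)]
    have \<tau>0: "0 \<le> \<tau>" unfolding \<tau>_def using kernel_nonneg[OF \<nu>] by (intro integral_nonneg_AE) simp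
    \<comment> \<open>\<open>s\<close> is the second moment inside the ball; it falls short of the
      normalisation \<open>DIM('a)\<close> by at most the tail mass \<open>\<tau>\<close>.\<close>
    define s where "s = (LBINT h. \<nu> h * (?in h * (norm h)\<^sup>2))"
    have sq1: "(norm h)\<^sup>2 \<le> 1" if "norm h \<le> \<delta>" for h :: 'a
      using that \<delta>(2) by (simp add: power_le_one)
    have min_in: "?in h * min 1 ((norm h)\<^sup>2) = ?in h * (norm h)\<^sup>2" for h :: 'a
      by (auto simp: indicator_def sq1)
    have i_s: "integrable lborel (\<lambda>h. \<nu> h * (?in h * (norm h)\<^sup>2))"
      by (rule kernel_integrable_bound[OF \<nu>, of _ 1]) (auto simp: indicator_def sq1)
    have i_K: "integrable lborel (\<lambda>h. \<nu> h * (?in h * K h))" "integrable lborel (\<lambda>h. \<nu> h * (?out h * K h))"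
      by (rule kernel_integrable_bound[OF \<nu>, of _ "2 * C"]; use KC C in \<open>auto simp: indicator_def\<close>)+
    have i_o: "integrable lborel (\<lambda>h. \<nu> h * (?out h * min 1 ((norm h)\<^sup>2)))"
      by (rule kernel_integrable_bound[OF \<nu>, of _ 1]) (auto simp: indicator_def)
    have i_m: "integrable lborel (\<lambda>h. \<nu> h * (?in h * ((h \<bullet> b) * (h \<bullet> c))))" for b c
      by (rule truncated_second_moment_integrable[OF \<nu> \<delta>(1,2)])
    have "(LBINT h. min 1 ((norm h)\<^sup>2) * \<nu> h)
        = (LBINT h. \<nu> h * (?in h * (norm h)\<^sup>2) + \<nu> h * (?out h * min 1 ((norm h)\<^sup>2)))"
      by (intro Bochner_Integration.integral_cong refl)
        (auto simp: indicator_def sq1)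
    then have s_eq: "?d = s + (LBINT h. \<nu> h * (?out h * min 1 ((norm h)\<^sup>2)))"
      using i_s i_o by (simp add: mass s_def)
    have o: "0 \<le> (LBINT h. \<nu> h * (?out h * min 1 ((norm h)\<^sup>2)))"
      "(LBINT h. \<nu> h * (?out h * min 1 ((norm h)\<^sup>2))) \<le> \<tau>"
    proof -
      show "0 \<le> (LBINT h. \<nu> h * (?out h * min 1 ((norm h)\<^sup>2)))"
        using kernel_nonneg[OF \<nu>] by (intro integral_nonneg_AE) simp
      show "(LBINT h. \<nu> h * (?out h * min 1 ((norm h)\<^sup>2))) \<le> \<tau>"
        unfolding \<tau>_def using kernel_nonneg[OF \<nu>]
        by (intro integral_mono_AE i_o tail AE_I2 mult_left_mono) (auto simp: indicator_def)
    qed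
    have s_le: "s \<le> ?d" and s_ge: "?d - s \<le> \<tau>" using s_eq o by linarith+
    have Q: "(LBINT h. \<nu> h * (?in h * ?Q h)) = (s / ?d) * T"
      and i_Q: "integrable lborel (\<lambda>h. \<nu> h * (?in h * ?Q h))"
    proof -
      have eq: "\<nu> h * (?in h * ?Q h)
          = (\<Sum>b\<in>Basis. \<Sum>c\<in>Basis. A b c * (\<nu> h * (?in h * ((h \<bullet> b) * (h \<bullet> c)))))" for h
        by (simp only: sum_distrib_left mult_ac)
      show "integrable lborel (\<lambda>h. \<nu> h * (?in h * ?Q h))"
        unfolding eq by (intro Bochner_Integration.integrable_sum integrable_mult_right i_m)
      have "(LBINT h. \<nu> h * (?in h * ?Q h))
          = (\<Sum>b\<in>Basis. \<integral>h. (\<Sum>c\<in>Basis. A b c * (\<nu> h * (?in h * ((h \<bullet> b) * (h \<bullet> c))))) \<partial>lborel)"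
        unfolding eq by (intro Bochner_Integration.integral_sum Bochner_Integration.integrable_sum integrable_mult_right i_m)
      also have "\<dots> = (\<Sum>b\<in>Basis. \<Sum>c\<in>Basis. \<integral>h. A b c * (\<nu> h * (?in h * ((h \<bullet> b) * (h \<bullet> c)))) \<partial>lborel)"
        by (intro sum.cong refl Bochner_Integration.integral_sum integrable_mult_right i_m)
      \<comment> \<open>Isotropy enters here: only the diagonal survives, and the quadratic form is
        reduced to the trace \<open>T\<close>.\<close>
      also have "\<dots> = (\<Sum>b\<in>Basis. \<Sum>c\<in>Basis. if b = c then A b c * (s / ?d) else 0)"
        by (intro sum.cong refl)
          (simp only: integral_mult_right_zero truncated_second_moment[OF \<nu> \<delta>(1,2)] s_def[symmetric], simp)
      also have "\<dots> = (\<Sum>b\<in>Basis. A b b * (s / ?d))"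
        by (intro sum.cong refl) (simp add: sum.delta')
      also have "\<dots> = (s / ?d) * T" unfolding T_def by (simp only: sum_distrib_right[symmetric] mult.commute)
      finally show "(LBINT h. \<nu> h * (?in h * ?Q h)) = (s / ?d) * T" .
    qed
    have near: "\<bar>(LBINT h. \<nu> h * (?in h * K h)) + (s / ?d) * T\<bar> \<le> \<eta>"
    proof -
      have "\<bar>(LBINT h. \<nu> h * (?in h * K h)) + (s / ?d) * T\<bar>
          = norm (LBINT h. \<nu> h * (?in h * K h) + \<nu> h * (?in h * ?Q h))"
        using i_K(1) i_Q by (simp add: Q)
      also have "\<dots> \<le> (LBINT h. (\<eta> / ?d) * (\<nu> h * (?in h * (norm h)\<^sup>2)))"
      proof (rule Bochner_Integration.integral_norm_bound_integral)
        show "integrable lborel (\<lambda>h. \<nu> h * (?in h * K h) + \<nu> h * (?in h * ?Q h))"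
          by (intro Bochner_Integration.integrable_add i_K i_Q)
        show "integrable lborel (\<lambda>h. (\<eta> / ?d) * (\<nu> h * (?in h * (norm h)\<^sup>2)))"
          by (intro integrable_mult_right i_s)
        fix h :: 'a
        have "\<nu> h * (?in h * K h) + \<nu> h * (?in h * ?Q h) = (\<nu> h * ?in h) * (K h + ?Q h)"
          by (simp only: distrib_left mult.assoc)
        moreover have "\<bar>(\<nu> h * ?in h) * (K h + ?Q h)\<bar> \<le> (\<nu> h * ?in h) * ((\<eta> / ?d) * (norm h)\<^sup>2)"
        proof (cases "norm h \<le> \<delta>")
          case True
          then show ?thesis
            using KQ[OF True] kernel_nonneg[OF \<nu>, of h]
            by (simp only: abs_mult) (intro mult_mono, auto)
        qed simp
        ultimately show "norm (\<nu> h * (?in h * K h) + \<nu> h * (?in h * ?Q h)) \<le> (\<eta> / ?d) * (\<nu> h * (?in h * (norm h)\<^sup>2))"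
          by (simp only: real_norm_def mult_ac)
      qed
      also have "\<dots> = (\<eta> / ?d) * s" by (simp add: s_def)
      also have "\<dots> \<le> (\<eta> / ?d) * ?d" using \<eta> s_le by (intro mult_left_mono) auto
      finally show ?thesis by simp
    qed
    have far: "\<bar>\<integral>h. \<nu> h * (?out h * K h) \<partial>lborel\<bar> \<le> 2 * C * \<tau>"
    proof -
      have "norm (LBINT h. \<nu> h * (?out h * K h)) \<le> (LBINT h. (2 * C) * (\<nu> h * ?out h))"
      proof (rule Bochner_Integration.integral_norm_bound_integral[OF i_K(2)])
        show "integrable lborel (\<lambda>h. (2 * C) * (\<nu> h * ?out h))" by (intro integrable_mult_right tail)
        fix h :: 'a
        have "\<bar>K h\<bar> \<le> 2 * C * 1" using C(1) by (intro order_trans[OF KC mult_left_mono]) auto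
        then have "\<nu> h * \<bar>K h\<bar> \<le> \<nu> h * (2 * C)" using kernel_nonneg[OF \<nu>, of h] by (intro mult_left_mono) auto
        then show "norm (\<nu> h * (?out h * K h)) \<le> (2 * C) * (\<nu> h * ?out h)"
          using kernel_nonneg[OF \<nu>, of h] by (auto simp: indicator_def abs_mult mult_ac)
      qed
      then show ?thesis by (simp add: \<tau>_def)
    qed
    have "(LBINT h. \<nu> h * K h) = (LBINT h. \<nu> h * (?in h * K h) + \<nu> h * (?out h * K h))"
      by (intro Bochner_Integration.integral_cong refl)
        (auto simp: indicator_def)
    also have "\<dots> = (LBINT h. \<nu> h * (?in h * K h)) + (LBINT h. \<nu> h * (?out h * K h))"
      by (rule Bochner_Integration.integral_add[OF i_K])
    finally have K_split: "(LBINT h. \<nu> h * K h)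
        = (LBINT h. \<nu> h * (?in h * K h)) + (LBINT h. \<nu> h * (?out h * K h))" .
    \<comment> \<open>The relative loss \<open>(?d - s) / ?d\<close> is at most
      \<open>?d - s\<close>, as the dimension is at least \<open>1\<close>, and so at most
      \<open>\<tau>\<close>.\<close>
    have "\<bar>(s / ?d) * T - T\<bar> \<le> \<tau> * \<bar>T\<bar>"
    proof -
      have "(s / ?d) * T - T = - ((?d - s) / ?d) * T" using d by (simp add: field_simps)
      then have "\<bar>(s / ?d) * T - T\<bar> = ((?d - s) / ?d) * \<bar>T\<bar>" using s_le d by (simp add: abs_mult)
      also have "\<dots> \<le> \<tau> * \<bar>T\<bar>"
      proof (rule mult_right_mono)
        have "(?d - s) / ?d \<le> (?d - s) / 1" using s_le d by (intro divide_left_mono) auto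
        then show "(?d - s) / ?d \<le> \<tau>" using s_ge by simp
      qed simp
      finally show ?thesis .
    qed
    moreover have "\<bar>- k - T\<bar> \<le> \<eta> + (c + t)"
      if "\<bar>a + q\<bar> \<le> \<eta>" "\<bar>b\<bar> \<le> c" "k = a + b" "\<bar>q - T\<bar> \<le> t" for a b c k q t :: real
      using that by linarith
    ultimately have "\<bar>- (LBINT h. \<nu> h * K h) - T\<bar> \<le> \<eta> + (2 * C * \<tau> + \<tau> * \<bar>T\<bar>)"
      using near far K_split by blast
    then show "\<bar>boundary_flux E \<Omega> \<nu>
        - (\<Sum>b\<in>Basis. \<integral>x. indicator \<Omega> x * (DE x b \<bullet> b) \<partial>lborel)\<bar>
      \<le> \<eta> + (2 * C + \<bar>T\<bar>) * (LBINT h. \<nu> h * ?out h)"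
      unfolding boundary_flux_eq_crossing[OF \<nu>] K_def T_def A_def \<tau>_def by (simp add: algebra_simps)
  qed
qed

end

section \<open>The limit\<close>

lemma radial_orthogonal:
  assumes "radial f" "orthogonal_transformation T"
  shows "f (T h) = f h"
  using assms(1) orthogonal_transformation_norm[OF assms(2), of h] unfolding radial_def by blast

text \<open>Almost everywhere invariance under an orthogonal map passes to the representative, since
  such a map preserves \<open>lborel\<close> and hence null sets.\<close>

lemma isotropic_representative:
  fixes \<alpha> \<mu> :: "'a::euclidean_space \<Rightarrow> real"
  assumes \<alpha> [measurable]: "\<alpha> \<in> borel_measurable lebesgue" and r\<alpha>: "radial \<alpha>" and \<alpha>0: "\<And>h. h \<noteq> 0 \<Longrightarrow> 0 \<le> \<alpha> h"
    and \<mu> [measurable]: "\<mu> \<in> borel_measurable lebesgue" and r\<mu>: "radial \<mu>" and \<mu>0: "\<And>h. 0 \<le> \<mu> h"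
    and mass: "(LINT h|lebesgue. min 1 ((norm h)\<^sup>2) * \<alpha> h * \<mu> h) \<noteq> 0"
  obtains \<nu> where "isotropic_kernel \<nu>" "AE h in lborel. \<alpha> h * \<mu> h = \<nu> h"
proof -
  have "(\<lambda>h. \<alpha> h * \<mu> h) \<in> borel_measurable lebesgue" by measurable
  then obtain \<nu>\<^sub>1 where \<nu>\<^sub>1: "\<nu>\<^sub>1 \<in> borel_measurable lborel" "AE h in lborel. \<alpha> h * \<mu> h = \<nu>\<^sub>1 h"
    using completion_ex_borel_measurable_real by blast
  \<comment> \<open>The representative may be negative on a null set; the absolute value makes it
    nonnegative everywhere.\<close>
  define \<nu> where "\<nu> h = \<bar>\<nu>\<^sub>1 h\<bar>" for h
  have \<nu> [measurable]: "\<nu> \<in> borel_measurable borel" using \<nu>\<^sub>1(1) unfolding \<nu>_def by simp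
  have ae: "AE h in lborel. \<alpha> h * \<mu> h = \<nu> h"
    using \<nu>\<^sub>1(2) AE_lborel_singleton[of "0::'a"]
  proof eventually_elim
    case (elim h)
    have "0 \<le> \<alpha> h * \<mu> h" using \<alpha>0[OF elim(2)] \<mu>0[of h] by (rule mult_nonneg_nonneg)
    then show ?case using elim by (simp add: \<nu>_def)
  qed
  have "\<nu> \<in> borel_measurable lebesgue" "(\<lambda>h::'a. min 1 ((norm h)\<^sup>2)) \<in> borel_measurable lebesgue"
    by (intro measurable_completion; simp)+
  \<comment> \<open>A function that is not integrable has Bochner integral \<open>0\<close>, so the
    nonzero mass already contains integrability.\<close>
  have "integrable lebesgue (\<lambda>h. min 1 ((norm h)\<^sup>2) * \<alpha> h * \<mu> h)"
    using mass not_integrable_integral_eq by blast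
  moreover have "AE h in lebesgue. min 1 ((norm h)\<^sup>2) * \<alpha> h * \<mu> h = min 1 ((norm h)\<^sup>2) * \<nu> h"
    using AE_completion[OF ae] by eventually_elim (simp add: mult.assoc)
  moreover have "(\<lambda>h. min 1 ((norm h)\<^sup>2) * \<alpha> h * \<mu> h) \<in> borel_measurable lebesgue"
    "(\<lambda>h. min 1 ((norm h)\<^sup>2) * \<nu> h) \<in> borel_measurable lebesgue"
    by (intro borel_measurable_times; fact)+
  ultimately have "integrable lebesgue (\<lambda>h. min 1 ((norm h)\<^sup>2) * \<nu> h)"
    using integrable_cong_AE by blast
  then have "integrable lborel (\<lambda>h. min 1 ((norm h)\<^sup>2) * \<nu> h)"
    by (subst (asm) integrable_completion) simp_all
  moreover have "AE h in lborel. \<nu> (T h) = \<nu> h" if T: "orthogonal_transformation T" for T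
  proof -
    have "AE h in distr lborel borel T. \<alpha> h * \<mu> h = \<nu> h"
      unfolding lborel_distr_orthogonal_transformation[OF T] by (rule ae)
    then have "AE h in lborel. \<alpha> (T h) * \<mu> (T h) = \<nu> (T h)"
      by (rule AE_distrD[rotated]) (simp add: orthogonal_transformation_measurable[OF T])
    with ae show ?thesis
      by eventually_elim (simp add: radial_orthogonal[OF r\<alpha> T] radial_orthogonal[OF r\<mu> T])
  qed
  ultimately have "isotropic_kernel \<nu>" by (simp add: isotropic_kernel_def) (simp add: \<nu>_def)
  then show ?thesis using ae that by blast
qed

lemma lebesgue_translation_measurable: "(\<lambda>y::'a::euclidean_space. y - x) \<in> lebesgue \<rightarrow>\<^sub>M lebesgue"
  using lebesgue_affine_measurable[of "\<lambda>_. 1" "- x"] by (simp add: euclidean_representation)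

text \<open>Translates of null sets are null, so passing to the Borel representative leaves the
  inner integral unchanged for every single \<open>x\<close>. The order of the arguments of the
  radial \<open>\<alpha>\<close> is reversed on the way.\<close>

lemma nonlocal_normal_eq:
  fixes \<alpha> \<mu> :: "'a::euclidean_space \<Rightarrow> real"
  assumes \<alpha>: "\<alpha> \<in> borel_measurable lebesgue" and r\<alpha>: "radial \<alpha>" and \<mu>: "\<mu> \<in> borel_measurable lebesgue"
    and \<nu>: "\<nu> \<in> borel_measurable borel" and ae: "AE h in lborel. \<alpha> h * \<mu> h = \<nu> h"
    and E: "continuous_on UNIV E" and \<Omega>: "\<Omega> \<in> sets borel"
  shows "nonlocal_normal \<Omega> \<mu> (nonlocal_field \<alpha> E) x
    = -2 * (LBINT y. indicator \<Omega> y * (\<nu> (y - x) * segment_integral E x (y - x)))"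
proof -
  note [measurable] = \<nu> \<Omega> borel_measurable_continuous_onI[OF E]
  let ?r = "\<lambda>y. indicator \<Omega> y * (\<nu> (y - x) * segment_integral E x (y - x))"
  let ?l = "\<lambda>y. indicator \<Omega> y * ((\<alpha> (y - x) * \<mu> (y - x)) * segment_integral E x (y - x))"
  have field: "nonlocal_field \<alpha> E x y = \<alpha> (y - x) * segment_integral E x (y - x)" for y
  proof -
    have "\<alpha> (x - y) = \<alpha> (y - x)" using r\<alpha> norm_minus_commute[of x y] unfolding radial_def by blast
    then show ?thesis by (simp add: nonlocal_field_def segment_integral_eq_integral[OF E])
  qed
  have r_meas: "?r \<in> borel_measurable borel" by measurable
  have l_meas: "?l \<in> borel_measurable lebesgue"
  proof -
    have "(\<lambda>y. \<alpha> (y - x)) \<in> borel_measurable lebesgue" "(\<lambda>y. \<mu> (y - x)) \<in> borel_measurable lebesgue"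
      by (rule measurable_compose[OF lebesgue_translation_measurable \<alpha>]
            measurable_compose[OF lebesgue_translation_measurable \<mu>])+
    moreover have "(\<lambda>y. segment_integral E x (y - x)) \<in> borel_measurable lebesgue"
      "(\<lambda>y. indicator \<Omega> y :: real) \<in> borel_measurable lebesgue"
      by (intro measurable_completion; simp)+
    ultimately show ?thesis by (intro borel_measurable_times)
  qed
  have "AE h in distr lborel borel ((+) (- x)). \<alpha> h * \<mu> h = \<nu> h" unfolding lborel_distr_plus by (rule ae)
  then have "AE y in lborel. \<alpha> (- x + y) * \<mu> (- x + y) = \<nu> (- x + y)"
    by (rule AE_distrD[rotated]) simp
  then have "AE y in lborel. ?l y = ?r y" by eventually_elim simp
  then have "AE y in lebesgue. ?l y = ?r y" by (rule AE_completion)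
  then have "(\<integral>y. ?l y \<partial>lebesgue) = (\<integral>y. ?r y \<partial>lebesgue)"
    using l_meas measurable_completion[of ?r lborel borel] r_meas by (intro integral_cong_AE) simp_all
  also have "\<dots> = (LBINT y. ?r y)"
    by (rule integral_completion) (use r_meas in simp)
  finally show ?thesis
    unfolding nonlocal_normal_def set_lebesgue_integral_def field by (simp add: mult_ac)
qed

theorem corollary3p4:
  fixes \<Omega> :: "'a::euclidean_space set"
    and \<alpha> \<mu> :: "real \<Rightarrow> 'a \<Rightarrow> real"
    and F E :: "'a \<Rightarrow> 'a"
  assumes "bounded_C1_domain \<Omega>"
    and "\<And>\<epsilon>. \<epsilon> \<in> {0<..<1} \<Longrightarrow> \<alpha> \<epsilon> \<in> borel_measurable lebesgue"
    and "\<And>\<epsilon>. \<epsilon> \<in> {0<..<1} \<Longrightarrow> radial (\<alpha> \<epsilon>)"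
    and "\<And>\<epsilon> h. \<epsilon> \<in> {0<..<1} \<Longrightarrow> h \<noteq> 0 \<Longrightarrow> 0 \<le> \<alpha> \<epsilon> h"
    and "\<And>\<epsilon>. \<epsilon> \<in> {0<..<1} \<Longrightarrow> \<mu> \<epsilon> \<in> borel_measurable lebesgue"
    and "\<And>\<epsilon>. \<epsilon> \<in> {0<..<1} \<Longrightarrow> radial (\<mu> \<epsilon>)"
    and "\<And>\<epsilon> h. \<epsilon> \<in> {0<..<1} \<Longrightarrow> 0 \<le> \<mu> \<epsilon> h"
    and "\<And>\<epsilon>. \<epsilon> \<in> {0<..<1} \<Longrightarrow>
           (LINT h|lebesgue. min 1 ((norm h)\<^sup>2) * \<alpha> \<epsilon> h * \<mu> \<epsilon> h) = real DIM('a)"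
    and "\<And>\<delta>. 0 < \<delta> \<Longrightarrow>
           ((\<lambda>\<epsilon>. LINT h:{h. \<delta> < norm h}|lebesgue. \<alpha> \<epsilon> h * \<mu> \<epsilon> h) \<longlongrightarrow> 0) (at_right 0)"
    and "C1_closure \<Omega> F"
    and "C1_closure UNIV E"
    and "compact (closure {x. E x \<noteq> 0})"
    and "\<And>x. x \<in> closure \<Omega> \<Longrightarrow> E x = F x"
  shows "((\<lambda>\<epsilon>. LINT x:- \<Omega>|lebesgue. nonlocal_normal \<Omega> (\<mu> \<epsilon>) (nonlocal_field (\<alpha> \<epsilon>) E) x)
           \<longlongrightarrow> (LINT x:frontier \<Omega>|surface_measure \<Omega>. F x \<bullet> outward_normal \<Omega> x)) (at_right 0)"
proof -
  note dom = assms(1)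
  obtain DE where DE: "continuous_on UNIV DE" and E: "\<And>x. (E has_derivative blinfun_apply (DE x)) (at x)"
    using assms(11) by (auto simp: C1_closure_def)
  have "bounded {x. E x \<noteq> 0}"
    using assms(12) compact_imp_bounded bounded_subset closure_subset by blast
  then obtain R\<^sub>0 where R\<^sub>0: "\<And>x. E x \<noteq> 0 \<Longrightarrow> norm x \<le> R\<^sub>0" unfolding bounded_iff by blast
  define R where "R = max 0 R\<^sub>0"
  have R: "0 \<le> R" by (simp add: R_def)
  have supp: "E x = 0" if "x \<notin> cball 0 R" for x
    using R\<^sub>0[of x] that unfolding R_def by force
  have contE: "continuous_on UNIV E" by (rule field_continuous[OF dom E DE supp R])
  have \<Omega>: "\<Omega> \<in> sets borel" "bounded \<Omega>" using dom by (auto simp: bounded_C1_domain_def)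
  define T where "T = (\<Sum>b\<in>Basis. \<integral>x. indicator \<Omega> x * (DE x b \<bullet> b) \<partial>lborel)"
  have T: "(LINT x:frontier \<Omega>|surface_measure \<Omega>. F x \<bullet> outward_normal \<Omega> x) = T"
  proof -
    \<comment> \<open>The frontier lies in the closure, where the field and its extension agree, so
      the flux may be computed with \<open>E\<close>.\<close>
    have "indicator (frontier \<Omega>) x *\<^sub>R (F x \<bullet> outward_normal \<Omega> x)
        = indicator (frontier \<Omega>) x *\<^sub>R (E x \<bullet> outward_normal \<Omega> x)" for x
      using assms(13)[of x] by (auto simp: indicator_def frontier_def)
    then have "(LINT x:frontier \<Omega>|surface_measure \<Omega>. F x \<bullet> outward_normal \<Omega> x)
        = (LINT x:frontier \<Omega>|surface_measure \<Omega>. E x \<bullet> outward_normal \<Omega> x)"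
      unfolding set_lebesgue_integral_def by (simp only:)
    also have "\<dots> = (LBINT x. indicator \<Omega> x * (\<Sum>b\<in>Basis. (\<Sum>j\<in>Basis. (DE x j \<bullet> b) *\<^sub>R j) \<bullet> b))"
    proof (rule C1_domain_divergence_theorem[OF dom])
      fix b :: 'a
      \<comment> \<open>In coordinates, the gradient of the component of \<open>E\<close> along
        \<open>b\<close> is the adjoint of the derivative applied to \<open>b\<close>.\<close>
      show "C1_gradient (\<lambda>x. E x \<bullet> b) (\<lambda>x. \<Sum>j\<in>Basis. (DE x j \<bullet> b) *\<^sub>R j)"
        unfolding C1_gradient_def gderiv_def
      proof (intro conjI allI)
        fix x
        have "h \<bullet> (\<Sum>j\<in>Basis. (DE x j \<bullet> b) *\<^sub>R j) = DE x h \<bullet> b" for h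
          by (subst (2) euclidean_representation[of h, symmetric])
            (simp add: blinfun.sum_right blinfun.scaleR_right inner_sum_left inner_sum_right mult.commute)
        then show "((\<lambda>x. E x \<bullet> b) has_derivative (\<lambda>h. h \<bullet> (\<Sum>j\<in>Basis. (DE x j \<bullet> b) *\<^sub>R j))) (at x)"
          by (simp add: has_derivative_inner_left[OF E])
        show "continuous_on UNIV (\<lambda>x. \<Sum>j\<in>Basis. (DE x j \<bullet> b) *\<^sub>R j)"
          by (intro continuous_intros DE)
      qed
    qed
    also have "\<dots> = (LBINT x. (\<Sum>b\<in>Basis. indicator \<Omega> x * (DE x b \<bullet> b)))"
    proof (intro Bochner_Integration.integral_cong refl)
      fix x
      have "(\<Sum>j\<in>Basis. (DE x j \<bullet> b) *\<^sub>R j) \<bullet> b = DE x b \<bullet> b" if "b \<in> Basis" for b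
        using that by (rule inner_sum_left_Basis)
      then show "indicator \<Omega> x * (\<Sum>b\<in>Basis. (\<Sum>j\<in>Basis. (DE x j \<bullet> b) *\<^sub>R j) \<bullet> b)
          = (\<Sum>b\<in>Basis. indicator \<Omega> x * (DE x b \<bullet> b))"
        by (simp only: sum_distrib_left cong: sum.cong)
    qed
    also have "\<dots> = T"
      unfolding T_def
      by (intro Bochner_Integration.integral_sum integrable_indicator_bounded continuous_intros DE \<Omega>)
    finally show ?thesis .
  qed
  define I where "I \<epsilon> = (LINT x:- \<Omega>|lebesgue. nonlocal_normal \<Omega> (\<mu> \<epsilon>) (nonlocal_field (\<alpha> \<epsilon>) E) x)" for \<epsilon>
  define \<tau> where "\<tau> \<delta> \<epsilon> = (LINT h:{h. \<delta> < norm h}|lebesgue. \<alpha> \<epsilon> h * \<mu> \<epsilon> h)" for \<delta> \<epsilon>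
  have "(I \<longlongrightarrow> T) (at_right 0)"
  proof (rule tendstoI)
    fix \<eta> :: real assume "0 < \<eta>"
    then have "0 < \<eta> / 2" by simp
    \<comment> \<open>Both constants are fixed before \<open>\<epsilon>\<close>, so the tail
      hypothesis for this one \<open>\<delta>\<close> makes the remaining error smaller than
      \<open>\<eta> / 2\<close>.\<close>
    obtain \<delta> K where \<delta>: "0 < \<delta>" and K: "0 \<le> K" and est:
      "\<forall>\<nu>. isotropic_kernel \<nu> \<longrightarrow> (LBINT h. min 1 ((norm h)\<^sup>2) * \<nu> h) = real DIM('a) \<longrightarrow>
        \<bar>boundary_flux E \<Omega> \<nu>
          - (\<Sum>b\<in>Basis. \<integral>x. indicator \<Omega> x * (DE x b \<bullet> b) \<partial>lborel)\<bar>
        \<le> \<eta> / 2 + K * (LBINT h. \<nu> h * indicator {h. \<delta> < norm h} h)"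
      by (atomize_elim, rule boundary_flux_estimate[OF dom E DE supp R \<open>0 < \<eta> / 2\<close>])
    have bound: "\<bar>I \<epsilon> - T\<bar> \<le> \<eta> / 2 + K * \<tau> \<delta> \<epsilon>" if \<epsilon>: "\<epsilon> \<in> {0<..<1}" for \<epsilon>
    proof -
      note a = assms(2)[OF \<epsilon>] and m = assms(5)[OF \<epsilon>]
      have "(LINT h|lebesgue. min 1 ((norm h)\<^sup>2) * \<alpha> \<epsilon> h * \<mu> \<epsilon> h) \<noteq> 0"
        using assms(8)[OF \<epsilon>] by simp
      then obtain \<nu> where \<nu>: "isotropic_kernel \<nu>" and ae: "AE h in lborel. \<alpha> \<epsilon> h * \<mu> \<epsilon> h = \<nu> h"
        using isotropic_representative[OF a assms(3)[OF \<epsilon>] assms(4)[OF \<epsilon>] m assms(6)[OF \<epsilon>] assms(7)[OF \<epsilon>]]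
        by blast
      note [measurable] = kernel_measurable[OF \<nu>] \<Omega>(1) borel_measurable_continuous_onI[OF contE]
      \<comment> \<open>Carries the mass normalisation and the tail from the Lebesgue measurable
        kernels over to \<open>\<nu>\<close>.\<close>
      have transfer: "(\<integral>h. g h * (\<alpha> \<epsilon> h * \<mu> \<epsilon> h) \<partial>lebesgue) = (LBINT h. g h * \<nu> h)"
        if [measurable]: "g \<in> borel_measurable borel" for g :: "'a \<Rightarrow> real"
      proof -
        have b: "(\<lambda>h. g h * \<nu> h) \<in> borel_measurable lborel" by measurable
        have "g \<in> borel_measurable lebesgue" by (rule measurable_completion) simp
        then have "(\<lambda>h. g h * (\<alpha> \<epsilon> h * \<mu> \<epsilon> h)) \<in> borel_measurable lebesgue"
          using a m by (intro borel_measurable_times)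
        moreover have "AE h in lebesgue. g h * (\<alpha> \<epsilon> h * \<mu> \<epsilon> h) = g h * \<nu> h"
          using AE_completion[OF ae] by eventually_elim simp
        ultimately have "(\<integral>h. g h * (\<alpha> \<epsilon> h * \<mu> \<epsilon> h) \<partial>lebesgue) = (\<integral>h. g h * \<nu> h \<partial>lebesgue)"
          using measurable_completion[OF b] by (intro integral_cong_AE)
        also have "\<dots> = (LBINT h. g h * \<nu> h)" by (rule integral_completion[OF b])
        finally show ?thesis .
      qed
      have mass: "(LBINT h. min 1 ((norm h)\<^sup>2) * \<nu> h) = real DIM('a)"
        using transfer[of "\<lambda>h. min 1 ((norm h)\<^sup>2)"] assms(8)[OF \<epsilon>] by (simp add: mult.assoc)
      have tail: "(LBINT h. \<nu> h * indicator {h. \<delta> < norm h} h) = \<tau> \<delta> \<epsilon>"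
        using transfer[of "indicator {h. \<delta> < norm h}"]
        by (simp add: \<tau>_def set_lebesgue_integral_def mult.commute)
      have "I \<epsilon> = (\<integral>x. indicator (- \<Omega>) x * (-2 * (LBINT y. indicator \<Omega> y * (\<nu> (y - x) * segment_integral E x (y - x)))) \<partial>lebesgue)"
        unfolding I_def set_lebesgue_integral_def
          nonlocal_normal_eq[OF a assms(3)[OF \<epsilon>] m kernel_measurable[OF \<nu>] ae contE \<Omega>(1)]
        by simp
      also have "\<dots> = boundary_flux E \<Omega> \<nu>"
        unfolding boundary_flux_def by (rule integral_completion) measurable
      finally show ?thesis
        using est[rule_format, OF \<nu> mass] unfolding tail T_def by simp
    qed
    have "((\<lambda>\<epsilon>. \<eta> / 2 + K * \<tau> \<delta> \<epsilon>) \<longlongrightarrow> \<eta> / 2 + K * 0) (at_right 0)"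
      unfolding \<tau>_def by (intro tendsto_intros assms(9) \<delta>)
    from order_tendstoD(2)[OF this, of \<eta>]
    have "\<forall>\<^sub>F \<epsilon> in at_right 0. \<eta> / 2 + K * \<tau> \<delta> \<epsilon> < \<eta>"
      using \<open>0 < \<eta>\<close> by simp
    moreover have "\<forall>\<^sub>F \<epsilon> in at_right (0::real). \<epsilon> \<in> {0<..<1}"
      by (rule eventually_at_right_real) simp
    ultimately show "\<forall>\<^sub>F \<epsilon> in at_right 0. dist (I \<epsilon>) T < \<eta>"
      by eventually_elim (use bound in \<open>fastforce simp: dist_real_def\<close>)
  qed
  then show ?thesis unfolding T I_def .
qed

end
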